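(* For every positive integer $t$, there is an algorithm that, given an $n$-vertex graph $G$ that does not contain $K_1+tK_2$ as an induced minor, computes a maximum independent set of $G$ in time $n^{O(t^5)}$.
   Context: An independent set is a set of pairwise non-adjacent vertices. A graph $H$ is an induced minor of $G$ if $H$ can be obtained from $G$ by a sequence of vertex deletions and edge contractions. $tK_2$ denotes the disjoint union of $t$ edges, and $K_1+tK_2$ (the friendship graph) is the join of a single vertex with $tK_2$, i.e., $t$ pairwise disjoint, non-adjacent edges together with a $(2t+1)$-st vertex adjacent to all $2t$ endpoints. The constant hidden in $O(\cdot)$ does not depend on $t$ or $n$. *)

theory Defs
  imports Main "HOL-Library.Ramsey"
begin

section \<open>Graphs and induced minors\<close>

type_synonym 'a ugraph = "'a set \<times> 'a set set"

definition simple_graph :: "'a ugraph \<Rightarrow> bool" where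
  "simple_graph G \<longleftrightarrow> finite (fst G) \<and> snd G \<subseteq> nsets (fst G) 2"

definition graph_iso :: "'a ugraph \<Rightarrow> 'b ugraph \<Rightarrow> bool" where
  "graph_iso G H \<longleftrightarrow>
     (\<exists>f. bij_betw f (fst G) (fst H) \<and>
          (\<forall>u\<in>fst G. \<forall>v\<in>fst G. {u, v} \<in> snd G \<longleftrightarrow> {f u, f v} \<in> snd H))"

definition delete_vertex :: "'a \<Rightarrow> 'a ugraph \<Rightarrow> 'a ugraph" where
  "delete_vertex v G = (fst G - {v}, {e \<in> snd G. v \<notin> e})"

text \<open>Contracting the edge \<open>uv\<close>: the merged vertex keeps the name \<open>u\<close>;
  the loop is discarded and parallel edges coincide, so that the result is again simple.\<close>

definition contract_edge :: "'a \<Rightarrow> 'a \<Rightarrow> 'a ugraph \<Rightarrow> 'a ugraph" where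
  "contract_edge u v G =
     (fst G - {v}, {e \<in> snd G. v \<notin> e} \<union> {{u, w} | w. {v, w} \<in> snd G \<and> w \<noteq> u})"

inductive induced_minor_step :: "'a ugraph \<Rightarrow> 'a ugraph \<Rightarrow> bool" where
  delete: "v \<in> fst G \<Longrightarrow> induced_minor_step G (delete_vertex v G)"
| contract: "{u, v} \<in> snd G \<Longrightarrow> induced_minor_step G (contract_edge u v G)"

definition induced_minor :: "'a ugraph \<Rightarrow> 'b ugraph \<Rightarrow> bool" where
  "induced_minor H G \<longleftrightarrow> (\<exists>G'. induced_minor_step\<^sup>*\<^sup>* G G' \<and> graph_iso H G')"

text \<open>The friendship graph \<open>K\<^sub>1 + t K\<^sub>2\<close>: vertex \<open>0\<close> is the centre, and the
  \<open>i\<close>-th copy of \<open>K\<^sub>2\<close> has the ends \<open>2 i + 1\<close> and \<open>2 i + 2\<close>.\<close>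

definition friendship_graph :: "nat \<Rightarrow> nat ugraph" where
  "friendship_graph t =
     ({0..2 * t}, {{0, i} | i. i \<in> {1..2 * t}} \<union> {{2 * i + 1, 2 * i + 2} | i. i < t})"

definition independent_set :: "'a ugraph \<Rightarrow> 'a set \<Rightarrow> bool" where
  "independent_set G S \<longleftrightarrow> S \<subseteq> fst G \<and> indep S (snd G)"

definition maximum_independent_set :: "'a ugraph \<Rightarrow> 'a set \<Rightarrow> bool" where
  "maximum_independent_set G S \<longleftrightarrow>
     independent_set G S \<and> (\<forall>S'. independent_set G S' \<longrightarrow> card S' \<le> card S)"

lemma simple_graph_delete_vertex:
  "simple_graph G \<Longrightarrow> simple_graph (delete_vertex v G)"
  by (auto simp: simple_graph_def delete_vertex_def nsets_def)

lemma simple_graph_contract_edge: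
  assumes "simple_graph G" and "{u, v} \<in> snd G"
  shows "simple_graph (contract_edge u v G)"
proof -
  have e: "x \<in> fst G \<and> y \<in> fst G \<and> x \<noteq> y" if "{x, y} \<in> snd G" for x y
  proof -
    from that assms(1) have "{x, y} \<subseteq> fst G" and c: "card {x, y} = 2"
      by (auto simp: simple_graph_def nsets_def)
    moreover from c have "x \<noteq> y" by auto
    ultimately show ?thesis by simp
  qed
  have "f \<in> nsets (fst G - {v}) 2" if "f \<in> snd (contract_edge u v G)" for f
    using that assms e[OF assms(2)]
    by (auto simp: simple_graph_def contract_edge_def nsets_def card_insert_if dest: e)
  then show ?thesis
    using assms(1) by (auto simp: simple_graph_def contract_edge_def)
qed

lemma simple_graph_friendship_graph: "simple_graph (friendship_graph t)"
  by (auto simp: simple_graph_def friendship_graph_def nsets_def card_insert_if)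


section \<open>Random access machines\<close>

text \<open>Algorithms are structured programs for a random access machine with registers (named
  by the program, hence finitely many in each program) and a memory that is addressed
  indirectly. Every instruction and every test takes one unit of time. Since addition and
  (truncated) subtraction are the only arithmetic operations, the maximal bit length of
  the numbers (constants of the program aside) grows by at most one per step, so this uniform cost measure is polynomially related to
  the logarithmic cost measure and to the running time of Turing machines.\<close>

type_synonym reg = nat

datatype prog =
    Skip
  | Const reg nat
  | Copy reg reg
  | Add reg reg reg
  | Sub reg reg reg
  | Load reg reg
  | Store reg reg
  | Seq prog prog
  | IfNZ reg prog prog
  | WhileNZ reg prog

text \<open>A state consists of the register contents and the memory contents.\<close>

type_synonym state = "(reg \<Rightarrow> nat) \<times> (nat \<Rightarrow> nat)"

text \<open>\<open>exec P s k s'\<close>: started in \<open>s\<close>, the program \<open>P\<close> halts in \<open>s'\<close> after exactly \<open>k\<close>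
  steps.\<close>

inductive exec :: "prog \<Rightarrow> state \<Rightarrow> nat \<Rightarrow> state \<Rightarrow> bool" where
  Skip: "exec Skip s 1 s"
| Const: "exec (Const x c) (r, m) 1 (r(x := c), m)"
| Copy: "exec (Copy x y) (r, m) 1 (r(x := r y), m)"
| Add: "exec (Add x y z) (r, m) 1 (r(x := r y + r z), m)"
| Sub: "exec (Sub x y z) (r, m) 1 (r(x := r y - r z), m)"
| Load: "exec (Load x y) (r, m) 1 (r(x := m (r y)), m)"
| Store: "exec (Store x y) (r, m) 1 (r, m(r x := r y))"
| Seq: "exec P s k s' \<Longrightarrow> exec Q s' l s'' \<Longrightarrow> exec (Seq P Q) s (k + l) s''"
| IfTrue: "fst s x \<noteq> 0 \<Longrightarrow> exec P s k s' \<Longrightarrow> exec (IfNZ x P Q) s (1 + k) s'"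
| IfFalse: "fst s x = 0 \<Longrightarrow> exec Q s k s' \<Longrightarrow> exec (IfNZ x P Q) s (1 + k) s'"
| WhileTrue: "fst s x \<noteq> 0 \<Longrightarrow> exec P s k s' \<Longrightarrow> exec (WhileNZ x P) s' l s'' \<Longrightarrow>
    exec (WhileNZ x P) s (1 + k + l) s''"
| WhileFalse: "fst s x = 0 \<Longrightarrow> exec (WhileNZ x P) s 1 s"

inductive_cases exec_elims:
  "exec Skip s k s'" "exec (Const x c) s k s'" "exec (Copy x y) s k s'"
  "exec (Add x y z) s k s'" "exec (Sub x y z) s k s'"
  "exec (Load x y) s k s'" "exec (Store x y) s k s'"
  "exec (Seq P Q) s k s'" "exec (IfNZ x P Q) s k s'" "exec (WhileNZ x P) s k s'"

lemma exec_deterministic: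
  "exec P s k s' \<Longrightarrow> exec P s k1 s1 \<Longrightarrow> k = k1 \<and> s' = s1"
proof (induction arbitrary: k1 s1 rule: exec.induct)
  case (Seq P s k s' Q l s'')
  from Seq.prems obtain i u j where "exec P s i u" "exec Q u j s1" "k1 = i + j"
    by (rule exec_elims)
  with Seq.IH show ?case by blast
next
  case (WhileTrue s x P k s' l s'')
  from WhileTrue.prems show ?case
  proof (rule exec_elims)
    fix i u j
    assume k1: "k1 = Suc (i + j)" and P: "exec P s i u" and W: "exec (WhileNZ x P) u j s1"
    from WhileTrue.IH(1)[OF P] have "k = i" "s' = u" by simp_all
    with WhileTrue.IH(2)[of j s1] W k1 show ?thesis by simp
  qed (use WhileTrue.hyps(1) in simp)
next
  case (IfTrue s x P k s' Q)
  from IfTrue.prems show ?case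
    by (rule exec_elims) (use IfTrue.hyps(1) in \<open>auto dest: IfTrue.IH\<close>)
next
  case (IfFalse s x Q k s' P)
  from IfFalse.prems show ?case
    by (rule exec_elims) (use IfFalse.hyps(1) in \<open>auto dest: IfFalse.IH\<close>)
next
  case (WhileFalse s x P)
  from WhileFalse.prems show ?case
    by (rule exec_elims) (use WhileFalse.hyps in auto)
qed (erule exec_elims, simp)+

text \<open>A graph on the vertices \<open>0, \<dots>, n - 1\<close> is given by \<open>n\<close> in register \<open>0\<close> and its adjacency
  matrix, row by row, in the memory cells \<open>0, \<dots>, n\<^sup>2 - 1\<close>; everything else is \<open>0\<close>. A vertex
  set is returned as its characteristic vector in the memory cells \<open>0, \<dots>, n - 1\<close>.\<close>

definition graph_input :: "nat \<Rightarrow> nat set set \<Rightarrow> state" where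
  "graph_input n E =
     ((\<lambda>_. 0)(0 := n), \<lambda>a. if a < n * n \<and> {a div n, a mod n} \<in> E then 1 else 0)"

definition set_output :: "nat \<Rightarrow> state \<Rightarrow> nat set" where
  "set_output n s = {v. v < n \<and> snd s v = 1}"

end

theory Submission
  imports Defs
begin

text \<open>
  If a connected set \<open>S\<close> has \<open>t\<close> pairwise anticomplete edges inside its neighbourhood, then contracting \<open>S\<close>
  exhibits \<open>K\<^sub>1 + t K\<^sub>2\<close> as an induced minor. Only this obstruction (a hub) is used.

  Vertices of degree at most one can be put into a maximum independent set greedily, so let the
  minimum degree be at least two. Then an induced matching all of whose edges meet a closed
  neighbourhood \<open>N[v]\<close> has only \<open>O(t\<^sup>2)\<close> edges, and hence a maximal independent set \<open>I\<close> leaves only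
  \<open>n\<close> to the \<open>O(|X| t\<^sup>2)\<close> possible traces on \<open>N[X]\<close>: the trace is recovered from \<open>O(|X| t\<^sup>2)\<close> pairs of vertices.

  Grow an induced path \<open>P\<close> into a component \<open>D\<close> of the graph without \<open>N[P]\<close>. At most \<open>3 t\<close> vertices of \<open>P\<close> have
  neighbours in \<open>N(D)\<close>, for otherwise \<open>D\<close> together with pieces of \<open>P\<close> is a hub; so \<open>N(D)\<close> is dominated by
  a set \<open>X\<close> of at most \<open>3 t\<close> vertices. Extending \<open>P\<close> towards \<open>D\<close> splits \<open>D\<close> into smaller components of the same
  kind. Dynamic programming over all \<open>(X, D, trace)\<close> finds a maximum independent set in time
  \<open>n\<close> to the \<open>O(t\<^sup>3)\<close>.
\<close>

section \<open>Connectivity in an abstract symmetric, irreflexive relation\<close>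

section \<open>Connected vertex sets\<close>

text \<open>Why degree two matters: join \<open>v\<close> to \<open>b 1, ..., b k\<close> and hang a
  leaf \<open>x i\<close> on each \<open>b i\<close>. This tree has no friendship graph with an edge
  pair as induced minor, yet the edges \<open>b i, x i\<close> form an arbitrarily large induced
  matching at \<open>v\<close>, and choosing \<open>b i\<close> or \<open>x i\<close> independently
  gives exponentially many traces. With leaves removed, each such pendant part must contain a
  cycle-like piece that feeds a hub.

  The path and its contacts occur only in the analysis. The program tries every code; a fixed
  maximum independent set \<open>I\<close> singles out the codes whose steps build sets at least as
  large as \<open>I\<close>. The other codes do no harm, because any code whatsoever assembles an
  independent set. So no table indexed by states is needed: one growing list of independent sets is
  searched for the largest one inside a prescribed vertex set, and \<open>n + 1\<close> passes over
  all codes suffice because components shrink strictly.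

  Old separator vertices can be forgotten: a vertex of \<open>I\<close> next to a new component lies
  on its boundary, which the current contacts dominate.

  Costs are bounded by powers of \<open>max n 2\<close> throughout, so that constants can be
  absorbed into the exponent.\<close>

locale adjacency =
  fixes adj :: "'a \<Rightarrow> 'a \<Rightarrow> bool"
  assumes adj_sym: "adj x y \<Longrightarrow> adj y x"
    and adj_irrefl: "\<not> adj x x"
begin

definition reach :: "'a set \<Rightarrow> 'a \<Rightarrow> 'a \<Rightarrow> bool" where
  "reach S = (\<lambda>x y. adj x y \<and> x \<in> S \<and> y \<in> S)\<^sup>*\<^sup>*"

definition conn :: "'a set \<Rightarrow> bool" where
  "conn S \<longleftrightarrow> S \<noteq> {} \<and> (\<forall>x\<in>S. \<forall>y\<in>S. reach S x y)"

definition comp :: "'a set \<Rightarrow> 'a \<Rightarrow> 'a set" where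
  "comp S c = {x. c \<in> S \<and> reach S c x}"

definition touch :: "'a set \<Rightarrow> 'a set \<Rightarrow> bool" where
  "touch S T \<longleftrightarrow> (\<exists>x\<in>S. \<exists>y\<in>T. adj x y \<or> x = y)"

definition nbr :: "'a set \<Rightarrow> 'a set" where
  "nbr S = {x. x \<notin> S \<and> (\<exists>y\<in>S. adj y x)}"

definition cnbr :: "'a set \<Rightarrow> 'a set" where
  "cnbr S = S \<union> {x. \<exists>y\<in>S. adj y x}"

text \<open>Indexing makes sub-matchings plain index sets. Non-adjacency of \<open>v i\<close> and
  \<open>u j\<close> is covered as well, since \<open>i\<close> and \<open>j\<close> range over both
  orders.\<close>

definition indm :: "nat set \<Rightarrow> (nat \<Rightarrow> 'a) \<Rightarrow> (nat \<Rightarrow> 'a) \<Rightarrow> bool" where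
  "indm J u v \<longleftrightarrow> (\<forall>i\<in>J. adj (u i) (v i)) \<and>
     (\<forall>i\<in>J. \<forall>j\<in>J. i \<noteq> j \<longrightarrow> \<not> adj (u i) (u j) \<and> \<not> adj (u i) (v j) \<and> \<not> adj (v i) (v j))"

lemma adj_commute: "adj x y = adj y x"
  using adj_sym by blast

lemma reach_refl [simp]: "reach S x x"
  by (simp add: reach_def)

lemma reach_trans [trans]: "reach S x y \<Longrightarrow> reach S y z \<Longrightarrow> reach S x z"
  by (simp add: reach_def)

lemma reach_sym: "reach S x y \<Longrightarrow> reach S y x"
  unfolding reach_def
proof (induction rule: rtranclp_induct)
  case (step y z)
  then show ?case
    by (intro converse_rtranclp_into_rtranclp[of _ z y]) (auto intro: adj_sym)
qed simp

lemma reach_step: "adj x y \<Longrightarrow> x \<in> S \<Longrightarrow> y \<in> S \<Longrightarrow> reach S x y"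
  unfolding reach_def by blast

lemma reach_mono: "reach S x y \<Longrightarrow> S \<subseteq> T \<Longrightarrow> reach T x y"
  unfolding reach_def by (erule rtranclp_mono[THEN predicate2D, rotated]) auto

lemma reach_in: "reach S x y \<Longrightarrow> x \<in> S \<Longrightarrow> y \<in> S"
  unfolding reach_def by (induction rule: rtranclp_induct) auto

lemma reach_closed:
  assumes "reach S x y" "x \<in> Y" "\<And>a b. a \<in> Y \<Longrightarrow> adj a b \<Longrightarrow> b \<in> S \<Longrightarrow> b \<in> Y"
  shows "y \<in> Y"
  using assms(1,2) unfolding reach_def by (induction rule: rtranclp_induct) (auto intro: assms(3))

lemma connI: "a \<in> S \<Longrightarrow> (\<And>x. x \<in> S \<Longrightarrow> reach S a x) \<Longrightarrow> conn S"
  unfolding conn_def using reach_sym reach_trans by blast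

lemma conn_singleton [simp]: "conn {a}"
  by (rule connI[of a]) auto

lemma conn_leave:
  assumes "conn C" "Y \<subseteq> C" "Y \<noteq> {}" "Y \<noteq> C"
  obtains a b where "a \<in> Y" "b \<in> C - Y" "adj a b"
proof -
  obtain x y where "x \<in> Y" "y \<in> C - Y" using assms by blast
  with assms have "reach C x y" unfolding conn_def by blast
  then show ?thesis
    using reach_closed[of C x y Y] \<open>x \<in> Y\<close> \<open>y \<in> C - Y\<close> that by blast
qed

lemma conn_UN:
  assumes "conn S" "\<And>i. i \<in> I \<Longrightarrow> conn (Q i)" "\<And>i. i \<in> I \<Longrightarrow> touch S (Q i)"
  shows "conn (S \<union> (\<Union>i\<in>I. Q i))"
proof -
  let ?T = "S \<union> (\<Union>i\<in>I. Q i)"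
  obtain a where a: "a \<in> S" using assms(1) by (auto simp: conn_def)
  have S: "reach ?T a x" if "x \<in> S" for x
    using that a assms(1) reach_mono[of S a x ?T] unfolding conn_def by blast
  have "reach ?T a x" if i: "i \<in> I" and x: "x \<in> Q i" for i x
  proof -
    obtain s q where sq: "s \<in> S" "q \<in> Q i" "adj s q \<or> s = q"
      using assms(3)[OF i] by (auto simp: touch_def)
    have "reach ?T a s" by (rule S) fact
    also have "reach ?T s q" using sq i by (cases "s = q") (auto intro!: reach_step)
    also have "reach ?T q x"
      using assms(2)[OF i] sq(2) i x reach_mono[of "Q i" q x ?T] unfolding conn_def by blast
    finally show ?thesis .
  qed
  with S a show ?thesis by (intro connI[of a]) auto
qed

lemma conn_Un: "conn S \<Longrightarrow> conn T \<Longrightarrow> touch S T \<Longrightarrow> conn (S \<union> T)"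
  using conn_UN[of S "{()}" "\<lambda>_. T"] by simp

lemma conn_insert: "conn S \<Longrightarrow> s \<in> S \<Longrightarrow> adj s x \<Longrightarrow> conn (insert x S)"
  using conn_Un[of S "{x}"] by (auto simp: touch_def)

lemma comp_subset: "comp S c \<subseteq> S"
  using reach_in by (auto simp: comp_def)

lemma comp_self: "c \<in> S \<Longrightarrow> c \<in> comp S c"
  by (simp add: comp_def)

lemma comp_closed: "x \<in> comp S c \<Longrightarrow> adj x y \<Longrightarrow> y \<in> S \<Longrightarrow> y \<in> comp S c"
  using comp_subset[of S c] unfolding comp_def by (auto intro: reach_trans reach_step)

lemma comp_conn: "c \<in> S \<Longrightarrow> conn (comp S c)"
proof (rule connI[of c])
  fix x assume c: "c \<in> S" and "x \<in> comp S c"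
  then have "reach S c x" by (simp add: comp_def)
  then show "reach (comp S c) c x"
    unfolding reach_def
  proof (induction rule: rtranclp_induct)
    case (step y z)
    have "y \<in> comp S c" "z \<in> comp S c"
      using step c unfolding comp_def reach_def by (auto intro: rtranclp.rtrancl_into_rtrancl)
    with step show ?case by (intro rtranclp.rtrancl_into_rtrancl[OF step.IH]) auto
  qed simp
qed (auto simp: comp_def)

lemma comp_eq: "y \<in> comp S x \<Longrightarrow> comp S y = comp S x"
  using comp_subset[of S x] unfolding comp_def
  by (auto intro: reach_trans reach_sym)

lemma comp_eqI:
  assumes "conn D" "D \<subseteq> S" "c \<in> D" "\<And>x y. x \<in> D \<Longrightarrow> adj x y \<Longrightarrow> y \<in> S \<Longrightarrow> y \<in> D"
  shows "comp S c = D"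
proof
  show "comp S c \<subseteq> D"
    using assms(3,4) by (auto simp: comp_def intro: reach_closed[of S c _ D])
  show "D \<subseteq> comp S c"
    using assms(1-3) unfolding comp_def conn_def by (auto intro: reach_mono)
qed

lemma indm_subset: "indm J u v \<Longrightarrow> J' \<subseteq> J \<Longrightarrow> indm J' u v"
  unfolding indm_def by blast

lemma indm_distinct:
  assumes "indm J u v" "i \<in> J" "j \<in> J"
  shows "u i \<noteq> v j" "u i = u j \<longleftrightarrow> i = j" "v i = v j \<longleftrightarrow> i = j"
  using assms adj_sym adj_irrefl unfolding indm_def by metis+

text \<open>Read backwards, such a build-up is an order of edge contractions that keeps the
  remaining set connected.\<close>

inductive grow :: "'a set \<Rightarrow> bool" where
  single: "grow {a}"
| insert: "grow S \<Longrightarrow> y \<in> S \<Longrightarrow> x \<notin> S \<Longrightarrow> adj y x \<Longrightarrow> grow (insert x S)"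

text \<open>A maximal buildable subset must be everything, for connectivity would otherwise supply
  one more vertex.\<close>

lemma conn_grow:
  assumes "conn S" "finite S"
  shows "grow S"
proof -
  obtain a where a: "a \<in> S" using assms(1) by (auto simp: conn_def)
  define F where "F = {B. B \<subseteq> S \<and> grow B}"
  have "finite F" "{a} \<in> F" using a assms(2) by (auto simp: F_def grow.single)
  then obtain B where B: "B \<in> F" "\<And>B'. B' \<in> F \<Longrightarrow> B \<subseteq> B' \<Longrightarrow> B = B'"
    using finite_has_maximal2[of F "{a}"] by blast
  have "B \<noteq> {}" using B(1) by (auto simp: F_def elim: grow.cases)
  have "B = S"
  proof (rule ccontr)
    assume "B \<noteq> S"
    with B(1) \<open>B \<noteq> {}\<close> obtain x y where xy: "x \<in> B" "y \<in> S - B" "adj x y"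
      using conn_leave[OF assms(1), of B] by (auto simp: F_def)
    then have "insert y B \<in> F"
      using B(1) by (auto simp: F_def intro: grow.insert)
    with B(2)[of "insert y B"] xy show False by auto
  qed
  with B(1) show ?thesis by (simp add: F_def)
qed

end

section \<open>A connected hub with \<open>t\<close> private edges contracts to the friendship
  graph\<close>

section \<open>Friendship graphs as induced minors\<close>

lemma simple_graph_edge:
  assumes "simple_graph G" "{x, y} \<in> snd G"
  shows "x \<in> fst G" "y \<in> fst G" "x \<noteq> y"
proof -
  from assms have "{x, y} \<in> nsets (fst G) 2" unfolding simple_graph_def by blast
  then have "{x, y} \<subseteq> fst G" and c: "card {x, y} = 2" by (auto simp: nsets_def)
  then show "x \<in> fst G" "y \<in> fst G" by auto
  show "x \<noteq> y" using c by auto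
qed

lemma adjacency_edges:
  assumes "simple_graph G"
  shows "adjacency (\<lambda>x y. {x, y} \<in> snd G)"
proof
  show "{y, x} \<in> snd G" if "{x, y} \<in> snd G" for x y
    using that by (simp add: insert_commute)
  show "{x, x} \<notin> snd G" for x
    using simple_graph_edge(3)[OF assms, of x x] by blast
qed

lemma induced_minor_steps_delete:
  assumes "finite W" "W \<subseteq> fst G"
  shows "induced_minor_step\<^sup>*\<^sup>* G (fst G - W, {e \<in> snd G. e \<inter> W = {}})"
  using assms
proof (induction W rule: finite_induct)
  case empty
  then show ?case by simp
next
  case (insert x W)
  let ?G = "(fst G - W, {e \<in> snd G. e \<inter> W = {}})"
  have "induced_minor_step ?G (delete_vertex x ?G)"
    using insert by (intro induced_minor_step.delete) auto
  moreover have "delete_vertex x ?G = (fst G - insert x W, {e \<in> snd G. e \<inter> insert x W = {}})"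
    by (auto simp: delete_vertex_def)
  ultimately show ?case using insert by (auto intro: rtranclp.rtrancl_into_rtrancl)
qed

definition friendship_hub :: "'a ugraph \<Rightarrow> 'a set \<Rightarrow> nat \<Rightarrow> (nat \<Rightarrow> 'a) \<Rightarrow> (nat \<Rightarrow> 'a) \<Rightarrow> bool" where
  "friendship_hub G S t u v \<longleftrightarrow>
     S \<subseteq> fst G \<and> adjacency.indm (\<lambda>x y. {x, y} \<in> snd G) {..<t} u v \<and>
     (\<forall>i<t. u i \<notin> S \<and> v i \<notin> S \<and> (\<exists>s\<in>S. {s, u i} \<in> snd G) \<and> (\<exists>s\<in>S. {s, v i} \<in> snd G))"

lemma friendship_graph_iso:
  assumes G: "simple_graph G" and hub: "friendship_hub G {a} t u v"
    and V: "fst G = insert a (u ` {..<t} \<union> v ` {..<t})"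
  shows "graph_iso (friendship_graph t) G"
proof -
  interpret adjacency "\<lambda>x y. {x, y} \<in> snd G" by (rule adjacency_edges[OF G])
  have m: "indm {..<t} u v" and aa: "\<And>i. i < t \<Longrightarrow> u i \<noteq> a \<and> v i \<noteq> a \<and> {a, u i} \<in> snd G \<and> {a, v i} \<in> snd G"
    using hub by (auto simp: friendship_hub_def)
  note d = indm_distinct[OF m]
  define f where "f k = (if k = 0 then a else if odd k then u ((k - 1) div 2) else v ((k - 2) div 2))" for k
  have f0: "f 0 = a" and f1: "\<And>i. f (2 * i + 1) = u i" and f2: "\<And>i. f (2 * i + 2) = v i"
    by (auto simp: f_def)
  have cases: "k = 0 \<or> (\<exists>i<t. k = 2 * i + 1) \<or> (\<exists>i<t. k = 2 * i + 2)" if "k \<le> 2 * t" for k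
    using that by presburger
  have inj: "inj_on f {0..2 * t}"
  proof (rule inj_onI)
    fix k l assume "k \<in> {0..2 * t}" "l \<in> {0..2 * t}" and e: "f k = f l"
    then have k: "k = 0 \<or> (\<exists>i<t. k = 2 * i + 1) \<or> (\<exists>i<t. k = 2 * i + 2)"
      and l: "l = 0 \<or> (\<exists>i<t. l = 2 * i + 1) \<or> (\<exists>i<t. l = 2 * i + 2)"
      using cases by auto
    have a': "a \<noteq> u i" "a \<noteq> v i" "u i \<noteq> a" "v i \<noteq> a" if "i < t" for i
      using aa[OF that] by auto
    have d': "u i \<noteq> v j" "v j \<noteq> u i" "u i = u j \<longleftrightarrow> i = j" "v i = v j \<longleftrightarrow> i = j"
      if "i < t" "j < t" for i j
      using d[of i j] that by auto
    from k l e show "k = l"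
      by (elim disjE exE conjE) (simp_all only: f0 f1 f2 d' a')
  qed
  have img: "f ` {0..2 * t} = fst G"
  proof
    show "f ` {0..2 * t} \<subseteq> fst G"
    proof
      fix x assume "x \<in> f ` {0..2 * t}"
      then obtain k where k: "k \<le> 2 * t" "x = f k" by auto
      then show "x \<in> fst G"
        using cases[OF k(1)] unfolding V k(2)
        by (elim disjE exE conjE) (simp_all only: f0 f1 f2, auto)
    qed
    have "a \<in> f ` {0..2 * t}" using f0 by (metis atLeastAtMost_iff image_eqI zero_le)
    moreover have "u i \<in> f ` {0..2 * t}" if "i < t" for i
      by (rule image_eqI[of _ _ "2 * i + 1"]) (use that f1 in auto)
    moreover have "v i \<in> f ` {0..2 * t}" if "i < t" for i
      by (rule image_eqI[where x = "2 * i + 2"]) (simp only: f2, use that in auto)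
    ultimately show "fst G \<subseteq> f ` {0..2 * t}" unfolding V by auto
  qed
  have F: "{k, l} \<in> snd (friendship_graph t) \<longleftrightarrow>
      (k = 0 \<and> 1 \<le> l \<and> l \<le> 2 * t) \<or> (l = 0 \<and> 1 \<le> k \<and> k \<le> 2 * t) \<or>
      (\<exists>i<t. k = 2 * i + 1 \<and> l = 2 * i + 2 \<or> k = 2 * i + 2 \<and> l = 2 * i + 1)" for k l
    by (auto simp: friendship_graph_def doubleton_eq_iff)
  have F0: "{0, 0} \<notin> snd (friendship_graph t)"
    unfolding F by presburger
  have F1: "{0, 2 * i + 1} \<in> snd (friendship_graph t)" "{2 * i + 1, 0} \<in> snd (friendship_graph t)"
    and F2: "{0, 2 * i + 2} \<in> snd (friendship_graph t)" "{2 * i + 2, 0} \<in> snd (friendship_graph t)"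
    if "i < t" for i
    unfolding F using that by presburger+
  have F11: "{2 * i + 1, 2 * j + 1} \<notin> snd (friendship_graph t)"
    and F22: "{2 * i + 2, 2 * j + 2} \<notin> snd (friendship_graph t)"
    and F12: "{2 * i + 1, 2 * j + 2} \<in> snd (friendship_graph t) \<longleftrightarrow> i = j"
      "{2 * j + 2, 2 * i + 1} \<in> snd (friendship_graph t) \<longleftrightarrow> i = j"
    if "i < t" "j < t" for i j
    unfolding F using that by presburger+
  have G0: "{a, a} \<notin> snd G" by (rule adj_irrefl)
  have G1: "{a, u i} \<in> snd G" "{u i, a} \<in> snd G"
    and G2: "{a, v i} \<in> snd G" "{v i, a} \<in> snd G"
    if ij: "i < t" for i
    using aa[OF ij] by (auto dest: adj_sym)
  have G11: "{u i, u j} \<notin> snd G"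
    and G22: "{v i, v j} \<notin> snd G"
    and G12: "{u i, v j} \<in> snd G \<longleftrightarrow> i = j" "{v j, u i} \<in> snd G \<longleftrightarrow> i = j"
    if ij: "i < t" "j < t" for i j
  proof -
    show "{u i, u j} \<notin> snd G" "{v i, v j} \<notin> snd G"
      using m ij adj_irrefl unfolding indm_def by (metis lessThan_iff)+
    show 1: "{u i, v j} \<in> snd G \<longleftrightarrow> i = j"
      using m ij unfolding indm_def by (metis lessThan_iff)
    then show "{v j, u i} \<in> snd G \<longleftrightarrow> i = j" by (simp add: insert_commute)
  qed
  have edges: "{k, l} \<in> snd (friendship_graph t) \<longleftrightarrow> {f k, f l} \<in> snd G"
    if k: "k \<le> 2 * t" and l: "l \<le> 2 * t" for k l
    using cases[OF k] cases[OF l]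
    by (elim disjE exE conjE)
      (simp_all only: f0 f1 f2 F0 F1 F2 F11 F22 F12 G0 G1 G2 G11 G22 G12)
  have "fst (friendship_graph t) = {0..2 * t}" by (simp add: friendship_graph_def)
  with inj img edges show ?thesis
    unfolding graph_iso_def bij_betw_def by (intro exI[of _ f]) auto
qed

text \<open>Induction along a build-up of \<open>S\<close>: the vertex \<open>x\<close> added last
  is contracted into a neighbour \<open>y\<close> in the rest \<open>S'\<close>. The merged vertex
  keeps the name \<open>y\<close>, so \<open>S'\<close> stays a hub that inherits the neighbours of
  \<open>x\<close>, and adjacencies among the matching vertices do not change.\<close>

lemma contract_to_vertex:
  assumes "simple_graph G" "adjacency.grow (\<lambda>x y. {x, y} \<in> snd G) S" "friendship_hub G S t u v"
  shows "\<exists>G' a. induced_minor_step\<^sup>*\<^sup>* G G' \<and> simple_graph G' \<and> friendship_hub G' {a} t u v"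
  using assms
proof (induction "card S" arbitrary: G S rule: less_induct)
  case less
  interpret adjacency "\<lambda>x y. {x, y} \<in> snd G" by (rule adjacency_edges[OF less.prems(1)])
  from less.prems(2) show ?case
  proof (cases rule: grow.cases)
    case (single a)
    then show ?thesis using less.prems by blast
  next
    case (insert S' y x)
    define G' where "G' = contract_edge y x G"
    have G': "simple_graph G'"
      unfolding G'_def using less.prems(1) insert by (intro simple_graph_contract_edge) auto
    interpret G': adjacency "\<lambda>x y. {x, y} \<in> snd G'" by (rule adjacency_edges[OF G'])
    have keep: "{p, q} \<in> snd G'" if "{p, q} \<in> snd G" "p \<noteq> x" "q \<noteq> x" for p q
      using that by (auto simp: G'_def contract_edge_def)
    have move: "{y, q} \<in> snd G'" if "{x, q} \<in> snd G" "q \<noteq> y" for q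
      using that by (auto simp: G'_def contract_edge_def)
    have old: "{p, q} \<in> snd G" if "{p, q} \<in> snd G'" "p \<noteq> y" "q \<noteq> y" for p q
      using that by (auto simp: G'_def contract_edge_def doubleton_eq_iff)
    have fst: "fst G' = fst G - {x}" by (simp add: G'_def contract_edge_def)
    have grow: "G'.grow T" if "grow T" "T \<subseteq> S'" for T
      using that
    proof (induction rule: grow.induct)
      case (insert T p q)
      with \<open>x \<notin> S'\<close> show ?case by (intro G'.grow.insert) (auto intro: keep)
    qed (rule G'.grow.single)
    have fin: "finite S"
      using less.prems(1,3) finite_subset by (auto simp: simple_graph_def friendship_hub_def)
    with insert have card: "card S' < card S" by auto
    have hub: "friendship_hub G' S' t u v"
    proof -
      have m: "indm {..<t} u v" and
        c: "\<And>i. i < t \<Longrightarrow> u i \<notin> S \<and> v i \<notin> S \<and> (\<exists>s\<in>S. {s, u i} \<in> snd G) \<and> (\<exists>s\<in>S. {s, v i} \<in> snd G)"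
        using less.prems(3) by (auto simp: friendship_hub_def)
      have ne: "u i \<noteq> x \<and> u i \<noteq> y \<and> v i \<noteq> x \<and> v i \<noteq> y" if "i < t" for i
        using c[OF that] insert by auto
      have "{p, q} \<in> snd G' \<longleftrightarrow> {p, q} \<in> snd G" if "p \<noteq> x \<and> p \<noteq> y" "q \<noteq> x \<and> q \<noteq> y" for p q
        using that keep[of p q] old[of p q] by blast
      then have "G'.indm {..<t} u v"
        using m ne unfolding indm_def G'.indm_def by simp
      moreover have "\<exists>s\<in>S'. {s, w} \<in> snd G'" if w: "\<exists>s\<in>S. {s, w} \<in> snd G" "w \<noteq> x" "w \<noteq> y" for w
      proof -
        obtain s where s: "s \<in> S" "{s, w} \<in> snd G" using w(1) by blast
        show ?thesis
        proof (cases "s = x")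
          case True
          then show ?thesis using s w insert move by auto
        next
          case False
          then show ?thesis using s w insert keep by auto
        qed
      qed
      moreover have "S' \<subseteq> fst G'"
        using insert less.prems(3) by (auto simp: friendship_hub_def fst)
      ultimately show ?thesis
        using c ne insert unfolding friendship_hub_def by auto
    qed
    obtain H a where H: "induced_minor_step\<^sup>*\<^sup>* G' H" "simple_graph H" "friendship_hub H {a} t u v"
      using less.hyps[OF card G' grow hub] insert by blast
    have "induced_minor_step G G'"
      unfolding G'_def using insert by (intro induced_minor_step.contract) auto
    with H show ?thesis by (meson converse_rtranclp_into_rtranclp)
  qed
qed

theorem friendship_hub_induced_minor:
  assumes G: "simple_graph G" and S: "adjacency.conn (\<lambda>x y. {x, y} \<in> snd G) S"
    and hub: "friendship_hub G S t u v"
  shows "induced_minor (friendship_graph t) G"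
proof -
  interpret adjacency "\<lambda>x y. {x, y} \<in> snd G" by (rule adjacency_edges[OF G])
  have "finite S" using G hub finite_subset by (auto simp: simple_graph_def friendship_hub_def)
  then obtain G' a where G': "induced_minor_step\<^sup>*\<^sup>* G G'" "simple_graph G'" "friendship_hub G' {a} t u v"
    using contract_to_vertex[OF G conn_grow[OF S] hub] by blast
  \<comment> \<open>Contraction leaves the vertices outside the hub in place; whatever is not the
    centre or an end of one of the \<open>t\<close> edges is deleted.\<close>
  define U where "U = insert a (u ` {..<t} \<union> v ` {..<t})"
  define W where "W = fst G' - U"
  define H where "H = (fst G' - W, {e \<in> snd G'. e \<inter> W = {}})"
  interpret G': adjacency "\<lambda>x y. {x, y} \<in> snd G'" by (rule adjacency_edges[OF G'(2)])
  have U: "U \<subseteq> fst G'"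
    using G'(3) simple_graph_edge[OF G'(2)] by (auto simp: U_def friendship_hub_def)
  then have fst: "fst H = U" by (auto simp: H_def W_def)
  have H: "simple_graph H"
    using G'(2) by (auto simp: simple_graph_def H_def nsets_def)
  interpret H: adjacency "\<lambda>x y. {x, y} \<in> snd H" by (rule adjacency_edges[OF H])
  have e: "{x, y} \<in> snd H \<longleftrightarrow> {x, y} \<in> snd G'" if "x \<in> U" "y \<in> U" for x y
    using that by (auto simp: H_def W_def)
  have "friendship_hub H {a} t u v"
    using G'(3) fst e unfolding friendship_hub_def G'.indm_def H.indm_def by (auto simp: U_def)
  from friendship_graph_iso[OF H this] have "graph_iso (friendship_graph t) H"
    by (simp add: fst U_def)
  moreover have "induced_minor_step\<^sup>*\<^sup>* G' H"
    unfolding H_def by (intro induced_minor_steps_delete) (use G'(2) in \<open>auto simp: W_def simple_graph_def\<close>)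
  ultimately show ?thesis
    unfolding induced_minor_def using G'(1) by (meson rtranclp_trans)
qed

section \<open>Few path vertices see the boundary of a component that the path avoids\<close>

section \<open>Contacts of an induced path\<close>

locale hub_free = adjacency adj for adj :: "'a \<Rightarrow> 'a \<Rightarrow> bool" +
  fixes V :: "'a set" and t :: nat
  assumes fin_V: "finite V"
    and adj_V: "adj x y \<Longrightarrow> x \<in> V"
    and no_hub: "\<lbrakk>conn S; S \<subseteq> V; finite J; indm J u v;
      \<And>i. i \<in> J \<Longrightarrow> u i \<notin> S \<and> v i \<notin> S \<and> (\<exists>s\<in>S. adj s (u i)) \<and> (\<exists>s\<in>S. adj s (v i))\<rbrakk>
      \<Longrightarrow> card J < t"
begin

definition induced_path :: "(nat \<Rightarrow> 'a) \<Rightarrow> nat \<Rightarrow> bool" where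
  "induced_path p m \<longleftrightarrow> p ` {..<m} \<subseteq> V \<and>
     (\<forall>i<m. \<forall>j<m. (p i = p j \<longleftrightarrow> i = j) \<and> (adj (p i) (p j) \<longleftrightarrow> i = Suc j \<or> j = Suc i))"

lemma conn_segment:
  assumes "induced_path p m" "b < m" "a \<le> b"
  shows "conn (p ` {a..b})"
  using assms(3,2)
proof (induction b rule: dec_induct)
  case (step k)
  have "conn (insert (p (Suc k)) (p ` {a..k}))"
    by (rule conn_insert[of _ "p k"]) (use step assms(1) in \<open>auto simp: induced_path_def\<close>)
  moreover have "insert (p (Suc k)) (p ` {a..k}) = p ` {a..Suc k}"
    using step.hyps by (auto simp: atLeastAtMostSuc_conv)
  ultimately show ?case by simp
qed simp

text \<open>For contacts \<open>i\<close> of equal residue, \<open>D\<close>, a vertex \<open>z i\<close> of its neighbourhood next to \<open>p i\<close>, and the path from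
  each contact up to three steps before the next one form a hub for the edges \<open>p (i - 2), p (i - 1)\<close>.\<close>

lemma contacts_residue:
  assumes p: "induced_path p m" and D: "conn D" "D \<subseteq> V"
    and apart: "\<And>i x. i < m \<Longrightarrow> x \<in> D \<Longrightarrow> p i \<noteq> x \<and> \<not> adj (p i) x"
    and T: "\<And>i. i \<in> T \<Longrightarrow> i < m \<and> i mod 3 = r \<and> (\<exists>z\<in>nbr D. adj (p i) z)"
  shows "card T \<le> t"
proof (rule ccontr)
  assume "\<not> card T \<le> t"
  then have card: "t < card T" by simp
  then have finT: "finite T" and neT: "T \<noteq> {}" by (auto intro: card_ge_0_finite)
  obtain z where z: "\<And>i. i \<in> T \<Longrightarrow> z i \<in> nbr D \<and> adj (p i) (z i)" using T by metis
  have gap: "i + 3 \<le> j" if "i \<in> T" "j \<in> T" "i < j" for i j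
  proof -
    have "i mod 3 = j mod 3" using T[OF that(1)] T[OF that(2)] by simp
    with that(3) show ?thesis by presburger
  qed
  \<comment> \<open>Last index of the path piece that starts at contact \<open>i\<close>. Stopping
    three before the next contact \<open>j\<close> leaves \<open>p (j - 2)\<close> and
    \<open>p (j - 1)\<close> free as a matching edge, with hub neighbours \<open>p (j - 3)\<close>
    and \<open>p j\<close>. The last contact contributes only itself.\<close>
  define e where "e i = (if i = Max T then i else Min {j \<in> T. i < j} - 3)" for i
  have e: "i \<le> e i" "e i < m" "\<And>j. j \<in> T \<Longrightarrow> i < j \<Longrightarrow> e i + 3 \<le> j" if i: "i \<in> T" for i
  proof -
    have "i \<le> e i \<and> e i < m \<and> (\<forall>j\<in>T. i < j \<longrightarrow> e i + 3 \<le> j)"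
    proof (cases "i = Max T")
      case True
      then show ?thesis using i T Max_ge[OF finT] by (fastforce simp: e_def)
    next
      case False
      let ?N = "{j \<in> T. i < j}"
      have "Max T \<in> ?N" using False Max_ge[OF finT i] Max_in[OF finT neT] by auto
      then have N: "finite ?N" "?N \<noteq> {}" using finT by auto
      have "Min ?N \<in> ?N" using Min_in[OF N] .
      then have 1: "Min ?N < m" "i + 3 \<le> Min ?N" using T gap i by auto
      have "Min ?N \<le> j" if "j \<in> T" "i < j" for j using N that by auto
      with 1 False show ?thesis by (fastforce simp: e_def)
    qed
    then show "i \<le> e i" "e i < m" "\<And>j. j \<in> T \<Longrightarrow> i < j \<Longrightarrow> e i + 3 \<le> j" by auto
  qed
  define Q where "Q i = insert (z i) (p ` {i..e i})" for i
  define S where "S = D \<union> (\<Union>i\<in>T. Q i)"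
  have zP: "z i \<notin> p ` {..<m}" if i: "i \<in> T" for i
  proof
    assume "z i \<in> p ` {..<m}"
    then obtain k where "k < m" "z i = p k" by auto
    moreover obtain y where "y \<in> D" "adj y (z i)" using z[OF i] by (auto simp: nbr_def)
    ultimately show False using apart[of k y] adj_sym[of y "p k"] by auto
  qed
  have S: "conn S"
    unfolding S_def
  proof (rule conn_UN[OF D(1)])
    fix i assume i: "i \<in> T"
    show "conn (Q i)"
      unfolding Q_def by (rule conn_insert[of _ "p i"]) (use conn_segment[OF p] e[OF i] z[OF i] in auto)
    show "touch D (Q i)" using z[OF i] by (auto simp: touch_def Q_def nbr_def)
  qed
  have SV: "S \<subseteq> V"
  proof -
    have "z i \<in> V" if "i \<in> T" for i using z[OF that] adj_V[OF adj_sym] by blast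
    moreover have "p k \<in> V" if "k < m" for k using p that by (auto simp: induced_path_def)
    moreover have "k < m" if "i \<in> T" "k \<le> e i" for i k using e(2)[OF that(1)] that(2) by simp
    ultimately show ?thesis using D(2) by (auto simp: S_def Q_def)
  qed
  have inS: "p k \<in> S \<longleftrightarrow> (\<exists>i\<in>T. i \<le> k \<and> k \<le> e i)" if "k < m" for k
  proof
    assume "p k \<in> S"
    with apart[OF that] obtain i where i: "i \<in> T" "p k \<in> Q i" by (auto simp: S_def)
    have "p k \<noteq> z i" using zP[OF i(1)] that by (metis imageI lessThan_iff)
    with i(2) have "p k \<in> p ` {i..e i}" by (simp add: Q_def)
    then obtain l where "l \<in> {i..e i}" "p k = p l" by auto
    moreover have "l < m" using e(2)[OF i(1)] calculation by auto
    ultimately have "l = k" using p that unfolding induced_path_def by metis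
    with \<open>l \<in> {i..e i}\<close> i(1) show "\<exists>i\<in>T. i \<le> k \<and> k \<le> e i" by auto
  next
    assume "\<exists>i\<in>T. i \<le> k \<and> k \<le> e i"
    then obtain i where i: "i \<in> T" "i \<le> k" "k \<le> e i" by blast
    then have "p k \<in> Q i" by (simp add: Q_def)
    with i(1) show "p k \<in> S" by (auto simp: S_def)
  qed
  \<comment> \<open>The first contact has no piece in front of it, hence no edge;
    \<open>t + 1\<close> contacts thus yield the \<open>t\<close> edges that contradict
    \<open>no_hub\<close>.\<close>
  define J where "J = T - {Min T}"
  have J: "finite J" "t \<le> card J"
    using finT neT card by (auto simp: J_def card_Diff_singleton)
  have J3: "\<exists>l\<in>T. l + 3 \<le> i \<and> e l = i - 3" if "i \<in> J" for i
  proof -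
    let ?L = "{l \<in> T. l < i}"
    have i: "i \<in> T" "Min T < i"
      using that Min_le[OF finT, of i] by (auto simp: J_def)
    then have L: "finite ?L" "?L \<noteq> {}" using finT Min_in[OF finT neT] by auto
    define l where "l = Max ?L"
    have l: "l \<in> T" "l < i" using Max_in[OF L] by (auto simp: l_def)
    have "j \<le> l" if "j \<in> T" "j < i" for j using L that by (auto simp: l_def)
    then have "Min {j \<in> T. l < j} = i"
      using finT i(1) l by (intro Min_eqI) (auto simp: not_less[symmetric])
    moreover have "l \<noteq> Max T" using Max_ge[OF finT i(1)] l by auto
    ultimately have "e l = i - 3" by (simp add: e_def)
    with l gap[OF l(1) i(1) l(2)] show ?thesis by auto
  qed
  have "card J < t"
  proof (rule no_hub[OF S SV J(1), of "\<lambda>i. p (i - 2)" "\<lambda>i. p (i - 1)"])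
    have m: "i < m" "3 \<le> i" if "i \<in> J" for i
      using that T J3[OF that] by (auto simp: J_def)
    have far: "i + 3 \<le> j \<or> j + 3 \<le> i" if "i \<in> J" "j \<in> J" "i \<noteq> j" for i j
      using that gap[of i j] gap[of j i] by (cases i j rule: linorder_cases) (auto simp: J_def)
    show "indm J (\<lambda>i. p (i - 2)) (\<lambda>i. p (i - 1))"
      unfolding indm_def
    proof (intro conjI ballI impI)
      fix i assume "i \<in> J"
      with m[of i] show "adj (p (i - 2)) (p (i - 1))"
        using p unfolding induced_path_def by auto
    next
      fix i j assume ij: "i \<in> J" "j \<in> J" "i \<noteq> j"
      have lt: "i - 2 < m" "i - 1 < m" "j - 2 < m" "j - 1 < m" using m[OF ij(1)] m[OF ij(2)] by auto
      have pa: "adj (p k) (p l) \<longleftrightarrow> k = Suc l \<or> l = Suc k" if "k < m" "l < m" for k l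
        using p that unfolding induced_path_def by blast
      have "i - 2 \<noteq> Suc (j - 2)" "j - 2 \<noteq> Suc (i - 2)" "i - 2 \<noteq> Suc (j - 1)" "j - 1 \<noteq> Suc (i - 2)"
        "i - 1 \<noteq> Suc (j - 1)" "j - 1 \<noteq> Suc (i - 1)"
        using far[OF ij] m(2)[OF ij(1)] m(2)[OF ij(2)] by arith+
      then show "\<not> adj (p (i - 2)) (p (j - 2))" "\<not> adj (p (i - 2)) (p (j - 1))"
        "\<not> adj (p (i - 1)) (p (j - 1))"
        using lt by (simp_all only: pa) simp_all
    qed
    fix i assume i: "i \<in> J"
    note mi = m[OF i]
    have iT: "i \<in> T" using i by (simp add: J_def)
    have out: "p (i - 2) \<notin> S" "p (i - 1) \<notin> S"
    proof -
      have "\<not> (l \<le> k \<and> k \<le> e l)" if l: "l \<in> T" and k: "k = i - 2 \<or> k = i - 1" for l k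
        using e(3)[OF l iT] k mi by (cases "l < i") auto
      then show "p (i - 2) \<notin> S" "p (i - 1) \<notin> S" using mi by (auto simp: inS)
    qed
    obtain l where l: "l \<in> T" "l + 3 \<le> i" "e l = i - 3" using J3[OF i] by blast
    have "p (i - 3) \<in> S" using l mi by (subst inS) (auto intro!: bexI[of _ l])
    moreover have "adj (p (i - 3)) (p (i - 2))" using mi p unfolding induced_path_def by auto
    moreover have "p i \<in> S" using iT mi e(1)[OF iT] by (subst inS) auto
    moreover have "adj (p i) (p (i - 1))" using mi p unfolding induced_path_def by auto
    ultimately show "p (i - 2) \<notin> S \<and> p (i - 1) \<notin> S \<and> (\<exists>s\<in>S. adj s (p (i - 2))) \<and> (\<exists>s\<in>S. adj s (p (i - 1)))"
      using out by blast
  qed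
  with J(2) show False by simp
qed

text \<open>Within one residue class modulo 3, contacts are at least three apart, which is the room
  that the matching edges need; the three classes account for the factor 3.\<close>

lemma contacts_bound:
  assumes p: "induced_path p m" and D: "conn D" "D \<subseteq> V"
    and apart: "\<And>i x. i < m \<Longrightarrow> x \<in> D \<Longrightarrow> p i \<noteq> x \<and> \<not> adj (p i) x"
  shows "card {x \<in> p ` {..<m}. \<exists>z\<in>nbr D. adj x z} \<le> 3 * t"
proof -
  define T where "T = {i. i < m \<and> (\<exists>z\<in>nbr D. adj (p i) z)}"
  have "card {i \<in> T. i mod 3 = r} \<le> t" for r
    by (rule contacts_residue[OF p D apart]) (auto simp: T_def)
  note c = this
  have "T = {i \<in> T. i mod 3 = 0} \<union> {i \<in> T. i mod 3 = 1} \<union> {i \<in> T. i mod 3 = 2}" by auto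
  then have "card T \<le> card {i \<in> T. i mod 3 = 0} + card {i \<in> T. i mod 3 = 1} + card {i \<in> T. i mod 3 = 2}"
    by (metis (no_types, lifting) add_mono_thms_linordered_semiring(3) card_Un_le order_trans)
  with c[of 0] c[of 1] c[of 2] have "card T \<le> 3 * t" by linarith
  moreover have "{x \<in> p ` {..<m}. \<exists>z\<in>nbr D. adj x z} = p ` T" by (auto simp: T_def)
  moreover have "card (p ` T) \<le> card T" by (rule card_image_le) (simp add: T_def)
  ultimately show ?thesis by simp
qed

end

section \<open>A quadratic bound for induced matchings whose edges meet a closed
  neighbourhood\<close>

section \<open>Induced matchings touching a neighbourhood\<close>

text \<open>Ore's theorem. In a graph without isolated vertices the complement of an
  inclusion-minimal dominating set \<open>Z\<close> dominates too, because a member of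
  \<open>Z\<close> without neighbours outside \<open>Z\<close> could be dropped. The smaller of the
  two sets is taken.\<close>

lemma ore_domination:
  assumes "finite J" "\<And>i. i \<in> J \<Longrightarrow> \<exists>j\<in>J. j \<noteq> i \<and> R i j" "\<And>i j. R i j \<Longrightarrow> R j i"
  shows "\<exists>Z\<subseteq>J. (\<forall>i\<in>J - Z. \<exists>l\<in>Z. R i l) \<and> card J \<le> 2 * card (J - Z)"
proof -
  define F where "F = {Z. Z \<subseteq> J \<and> (\<forall>i\<in>J - Z. \<exists>l\<in>Z. R i l)}"
  have "finite F" "J \<in> F" using assms(1) by (auto simp: F_def)
  then obtain Z where Z: "Z \<in> F" "\<And>Z'. Z' \<in> F \<Longrightarrow> Z' \<subseteq> Z \<Longrightarrow> Z' = Z"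
    using finite_has_minimal2[of F J] by metis
  have compl: "J - Z \<in> F"
  proof -
    have "\<exists>l\<in>J - Z. R z l" if z: "z \<in> Z" for z
    proof (rule ccontr)
      assume no: "\<not> (\<exists>l\<in>J - Z. R z l)"
      have "Z \<subseteq> J" using Z(1) by (simp add: F_def)
      then obtain j where j: "j \<in> J" "j \<noteq> z" "R z j" using assms(2)[of z] z by blast
      have "\<exists>l\<in>Z - {z}. R i l" if i: "i \<in> J - (Z - {z})" for i
      proof (cases "i = z")
        case True
        then show ?thesis using j no by auto
      next
        case False
        then obtain l where "l \<in> Z" "R i l" using i Z(1) by (auto simp: F_def)
        moreover have "l \<noteq> z" using False calculation i no assms(3) by blast
        ultimately show ?thesis by blast
      qed
      then have "Z - {z} \<in> F" using \<open>Z \<subseteq> J\<close> by (auto simp: F_def)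
      with Z(2)[of "Z - {z}"] z show False by auto
    qed
    then show ?thesis by (auto simp: F_def)
  qed
  have ZJ: "Z \<subseteq> J" using Z(1) by (simp add: F_def)
  have c: "card J = card Z + card (J - Z)"
    using ZJ assms(1) by (metis card_Diff_subset card_mono finite_subset le_add_diff_inverse)
  have dd: "J - (J - Z) = Z" using ZJ by auto
  show ?thesis
  proof (cases "card Z \<le> card (J - Z)")
    case True
    then show ?thesis using Z(1) c by (intro exI[of _ Z]) (auto simp: F_def)
  next
    case False
    then show ?thesis using compl c unfolding F_def by (intro exI[of _ "J - Z"]) (auto simp: dd)
  qed
qed

text \<open>In-degrees of a functional graph average at most one, so some \<open>i\<close> has at
  most one preimage. It is selected, and only \<open>i\<close>, \<open>f i\<close> and that preimage
  have to be discarded, which explains the factor 3.\<close>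

lemma functional_independent:
  assumes "finite J" "\<And>i. i \<in> J \<Longrightarrow> f i \<noteq> i"
  shows "\<exists>J'\<subseteq>J. (\<forall>i\<in>J'. f i \<notin> J') \<and> card J \<le> 3 * card J'"
  using assms
proof (induction "card J" arbitrary: J rule: less_induct)
  case less
  show ?case
  proof (cases "J = {}")
    case True
    then show ?thesis by auto
  next
    case False
    have "\<exists>i\<in>J. card {k \<in> J. f k = i} \<le> 1"
    proof (rule ccontr)
      assume "\<not> ?thesis"
      then have "(\<Sum>i\<in>J. 2) \<le> (\<Sum>i\<in>J. card {k \<in> J. f k = i})"
        by (intro sum_mono) auto
      also have "\<dots> = card (\<Union>i\<in>J. {k \<in> J. f k = i})"
        using less.prems(1) by (intro card_UN_disjoint[symmetric]) auto
      also have "\<dots> \<le> card J" using less.prems(1) by (intro card_mono) auto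
      finally show False using False less.prems(1) by (simp add: card_gt_0_iff)
    qed
    then obtain i where i: "i \<in> J" "card {k \<in> J. f k = i} \<le> 1" by blast
    define K where "K = insert i (insert (f i) {k \<in> J. f k = i})"
    have K: "finite K" "card K \<le> 3"
      using less.prems(1) i(2) card_insert_le_m1[of 2 "{k \<in> J. f k = i}" "f i"]
        card_insert_le_m1[of 3 "insert (f i) {k \<in> J. f k = i}" i] by (auto simp: K_def)
    have lt: "card (J - K) < card J"
      using i(1) less.prems(1) by (intro psubset_card_mono) (auto simp: K_def)
    have "card J \<le> card (J - K) + 3"
      using K card_Un_le[of "J - K" K] card_mono[of "(J - K) \<union> K" J] less.prems(1) by auto
    moreover obtain J' where J': "J' \<subseteq> J - K" "\<forall>i\<in>J'. f i \<notin> J'" "card (J - K) \<le> 3 * card J'"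
      using less.hyps[OF lt] less.prems by blast
    moreover have "finite J'" "i \<notin> J'"
      using J'(1) less.prems(1) finite_subset by (auto simp: K_def)
    ultimately have "card J \<le> 3 * card (insert i J')" by simp
    moreover have "insert i J' \<subseteq> J" using J'(1) i(1) by auto
    moreover have "\<forall>k\<in>insert i J'. f k \<notin> insert i J'"
      using J'(1,2) less.prems(2)[OF i(1)] by (auto simp: K_def)
    ultimately show ?thesis by (metis (no_types, lifting))
  qed
qed

context hub_free
begin

lemma t_pos: "v \<in> V \<Longrightarrow> 0 < t"
  using no_hub[of "{v}" "{}" undefined undefined] by (auto simp: indm_def)

text \<open>Call two terminals \<open>x i\<close>, \<open>x j\<close> related if a component of \<open>C\<close> without the terminals touches both. At most
  half of the terminals dominate this relation; together with \<open>v\<close>, their partners \<open>b i\<close> and the connecting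
  components they form a hub for the remaining edges \<open>b i, x i\<close>.\<close>

lemma terminals_bound:
  assumes J: "finite J" "indm J b x" and v: "v \<in> V" "\<And>i. i \<in> J \<Longrightarrow> adj v (b i)"
    and C: "conn C" "C \<subseteq> V" "v \<notin> C" "\<And>i. i \<in> J \<Longrightarrow> b i \<notin> C" "\<And>i. i \<in> J \<Longrightarrow> x i \<in> C"
  shows "card J < 2 * t"
proof (cases "card J \<le> 1")
  case True
  then show ?thesis using t_pos[OF v(1)] by simp
next
  case False
  define Rst where "Rst = C - x ` J"
  define R where "R i j \<longleftrightarrow> (\<exists>Q. conn Q \<and> Q \<subseteq> Rst \<and> touch Q {x i} \<and> touch Q {x j})" for i j
  have nonadj: "\<not> adj (x i) (x j)" if "i \<in> J" "j \<in> J" for i j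
    using J(2) that adj_irrefl unfolding indm_def by metis
  have iso: "\<exists>j\<in>J. j \<noteq> i \<and> R i j" if i: "i \<in> J" for i
  proof -
    \<comment> \<open>\<open>x i\<close> with all terminal-free components next to it. An edge
      leaving \<open>Y\<close> inside \<open>C\<close> can only end in another terminal, which is
      then related to \<open>x i\<close>.\<close>
    define Y where "Y = insert (x i) (\<Union>y\<in>{y \<in> Rst. adj (x i) y}. comp Rst y)"
    have "\<exists>j\<in>J. j \<noteq> i" using False i by (metis card_le_Suc0_iff_eq One_nat_def J(1))
    then obtain j where j: "j \<in> J" "j \<noteq> i" by blast
    then have "x j \<notin> Y"
      using comp_subset[of Rst] indm_distinct(3)[OF J(2) i j(1)] by (auto simp: Y_def Rst_def)
    moreover have "Y \<subseteq> C" using comp_subset[of Rst] C(5)[OF i] by (auto simp: Y_def Rst_def)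
    moreover have "Y \<noteq> {}" by (simp add: Y_def)
    ultimately obtain p q where pq: "p \<in> Y" "q \<in> C - Y" "adj p q"
      using conn_leave[OF C(1), of Y] C(5)[OF j(1)] by metis
    have q: "q \<in> x ` J"
    proof (rule ccontr)
      assume "q \<notin> x ` J"
      then have "q \<in> Rst" using pq by (auto simp: Rst_def)
      with pq show False
        by (auto simp: Y_def comp_self dest: comp_closed)
    qed
    then obtain l where l: "l \<in> J" "q = x l" by blast
    have "p \<noteq> x i" using pq nonadj i l by auto
    then obtain y where y: "y \<in> Rst" "adj (x i) y" "p \<in> comp Rst y" using pq(1) by (auto simp: Y_def)
    have "R i l"
      unfolding R_def
    proof (intro exI[of _ "comp Rst y"] conjI)
      show "conn (comp Rst y)" "comp Rst y \<subseteq> Rst" by (rule comp_conn[OF y(1)]) (rule comp_subset)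
      show "touch (comp Rst y) {x i}"
        unfolding touch_def using comp_self[OF y(1)] adj_sym[OF y(2)] by blast
      show "touch (comp Rst y) {x l}" unfolding touch_def using y(3) pq(3) l(2) by blast
    qed
    moreover have "l \<noteq> i" using pq l by (auto simp: Y_def)
    ultimately show ?thesis using l by blast
  qed
  obtain Z where Z: "Z \<subseteq> J" "\<And>i. i \<in> J - Z \<Longrightarrow> \<exists>l\<in>Z. R i l" "card J \<le> 2 * card (J - Z)"
  proof -
    have "R j i" if "R i j" for i j using that unfolding R_def by blast
    with ore_domination[of J R, OF J(1) iso] show ?thesis using that by blast
  qed
  have "\<forall>i\<in>J - Z. \<exists>l Q. l \<in> Z \<and> conn Q \<and> Q \<subseteq> Rst \<and> touch Q {x i} \<and> touch Q {x l}"
    using Z(2) unfolding R_def by blast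
  then obtain l Q where lQ: "\<And>i. i \<in> J - Z \<Longrightarrow>
      l i \<in> Z \<and> conn (Q i) \<and> Q i \<subseteq> Rst \<and> touch (Q i) {x i} \<and> touch (Q i) {x (l i)}"
    by metis
  define S0 where "S0 = {v} \<union> (\<Union>l\<in>Z. {b l, x l})"
  define S where "S = S0 \<union> (\<Union>i\<in>J - Z. Q i)"
  have bx: "adj (b i) (x i)" if "i \<in> J" for i using J(2) that by (auto simp: indm_def)
  have S0: "conn S0"
    unfolding S0_def
  proof (rule conn_UN)
    fix i assume "i \<in> Z"
    then have i: "i \<in> J" using Z(1) by auto
    show "conn {b i, x i}"
      using conn_insert[of "{x i}" "x i" "b i"] bx[OF i] adj_sym by auto
    show "touch {v} {b i, x i}" using v(2)[OF i] by (auto simp: touch_def)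
  qed simp
  have S: "conn S"
    unfolding S_def
  proof (rule conn_UN[OF S0])
    fix i assume i: "i \<in> J - Z"
    show "conn (Q i)" using lQ[OF i] by simp
    obtain q where "q \<in> Q i" "adj q (x (l i)) \<or> q = x (l i)" "l i \<in> Z"
      using lQ[OF i] by (auto simp: touch_def)
    then have "q \<in> Q i" "adj (x (l i)) q \<or> x (l i) = q" "x (l i) \<in> S0"
      using adj_sym by (auto simp: S0_def)
    then show "touch S0 (Q i)" unfolding touch_def by blast
  qed
  have SV: "S \<subseteq> V"
    using v bx lQ Z(1) C(2) adj_V adj_sym unfolding S_def S0_def Rst_def by blast
  have "card (J - Z) < t"
  proof (rule no_hub[OF S SV])
    show "finite (J - Z)" using J(1) by simp
    show "indm (J - Z) b x" using J(2) by (rule indm_subset) auto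
    fix i assume i: "i \<in> J - Z"
    have "b i \<noteq> v" "x i \<noteq> v" using v(2)[of i] adj_irrefl C i by auto
    moreover have "b i \<noteq> b l" "b i \<noteq> x l" "x i \<noteq> b l" "x i \<noteq> x l" if "l \<in> Z" for l
    proof -
      have l: "l \<in> J" "l \<noteq> i" using that Z(1) i by auto
      then show "b i \<noteq> b l" "b i \<noteq> x l" "x i \<noteq> b l" "x i \<noteq> x l"
        using indm_distinct[OF J(2), of i l] indm_distinct[OF J(2), of l i] i by auto
    qed
    moreover have "b i \<notin> Rst" "x i \<notin> Rst" using C(4)[of i] i by (auto simp: Rst_def)
    ultimately have "b i \<notin> S" "x i \<notin> S" using lQ unfolding S_def S0_def by blast+
    moreover have "\<exists>s\<in>S. adj s (b i)" using v(2)[of i] i by (auto simp: S_def S0_def)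
    moreover have "\<exists>s\<in>S. adj s (x i)"
    proof -
      obtain q where q: "q \<in> Q i" "adj q (x i) \<or> q = x i" using lQ[OF i] by (auto simp: touch_def)
      with lQ[OF i] \<open>x i \<notin> Rst\<close> have "adj q (x i)" by auto
      with q i show ?thesis by (auto simp: S_def)
    qed
    ultimately show "b i \<notin> S \<and> x i \<notin> S \<and> (\<exists>s\<in>S. adj s (b i)) \<and> (\<exists>s\<in>S. adj s (x i))" by blast
  qed
  with Z(3) show ?thesis by simp
qed

text \<open>Of \<open>X i\<close> only the component \<open>Q i\<close> of
  \<open>X i - {x i}\<close> that contains the neighbour of \<open>S0\<close> joins the hub.
  Connectivity of \<open>X i\<close> forces an edge from \<open>Q i\<close> to \<open>x i\<close>,
  while \<open>b i\<close> sees the hub through \<open>v\<close>.\<close>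

lemma attach_bound:
  assumes J: "finite J" "indm J b x" and S0: "conn S0" "S0 \<subseteq> V" "v \<in> S0" "\<And>i. i \<in> J \<Longrightarrow> adj v (b i)"
    and X: "\<And>i. i \<in> J \<Longrightarrow> conn (X i) \<and> X i \<subseteq> V \<and> x i \<in> X i \<and> S0 \<inter> X i = {} \<and> b i \<notin> S0"
    and disj: "\<And>i j. i \<in> J \<Longrightarrow> j \<in> J \<Longrightarrow> i \<noteq> j \<Longrightarrow> X i \<inter> X j = {}"
    and b: "\<And>i j. i \<in> J \<Longrightarrow> j \<in> J \<Longrightarrow> b i \<notin> X j"
    and y: "\<And>i. i \<in> J \<Longrightarrow> \<exists>y\<in>X i. y \<noteq> x i \<and> (\<exists>s\<in>S0. adj s y)"
  shows "card J < t"
proof -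
  obtain y where y: "\<And>i. i \<in> J \<Longrightarrow> y i \<in> X i \<and> y i \<noteq> x i \<and> (\<exists>s\<in>S0. adj s (y i))"
    using y by metis
  define Q where "Q i = comp (X i - {x i}) (y i)" for i
  define S where "S = S0 \<union> (\<Union>i\<in>J. Q i)"
  have Q: "conn (Q i)" "Q i \<subseteq> X i - {x i}" "y i \<in> Q i" if "i \<in> J" for i
    using y[OF that] comp_conn[of "y i" "X i - {x i}"] comp_subset[of "X i - {x i}" "y i"]
      comp_self[of "y i" "X i - {x i}"] by (auto simp: Q_def)
  have S: "conn S"
    unfolding S_def
  proof (rule conn_UN[OF S0(1)])
    fix i assume i: "i \<in> J"
    show "conn (Q i)" by (rule Q(1)[OF i])
    show "touch S0 (Q i)" using y[OF i] Q(3)[OF i] by (auto simp: touch_def)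
  qed
  have SV: "S \<subseteq> V" using S0(2) Q(2) X unfolding S_def by blast
  show ?thesis
  proof (rule no_hub[OF S SV J])
    fix i assume i: "i \<in> J"
    have "b i \<notin> S" using X[OF i] b[OF i] Q(2) unfolding S_def by blast
    moreover have "x i \<notin> S"
    proof
      assume "x i \<in> S"
      then obtain j where "j \<in> J" "x i \<in> Q j" using X[OF i] by (auto simp: S_def)
      then show False using X[OF i] Q(2)[of j] disj[OF i, of j] by (cases "i = j") auto
    qed
    moreover have "\<exists>s\<in>S. adj s (b i)" using S0(3,4) i by (auto simp: S_def)
    moreover have "\<exists>s\<in>S. adj s (x i)"
    proof -
      have "Q i \<subseteq> X i" "Q i \<noteq> {}" "Q i \<noteq> X i" using Q[OF i] X[OF i] by auto
      then obtain p q where pq: "p \<in> Q i" "q \<in> X i - Q i" "adj p q"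
        using conn_leave X[OF i] by metis
      have "q = x i"
        using pq comp_closed[of p "X i - {x i}" "y i" q] unfolding Q_def by blast
      then show ?thesis using pq i by (auto simp: S_def)
    qed
    ultimately show "b i \<notin> S \<and> x i \<notin> S \<and> (\<exists>s\<in>S. adj s (b i)) \<and> (\<exists>s\<in>S. adj s (x i))" by blast
  qed
qed

text \<open>Take a maximal connected set \<open>Q\<close> containing \<open>b\<close> that misses some edge of \<open>X\<close>: all the missed edges
  meet in a neighbour of \<open>Q\<close>, so their other ends, having degree at least 2, are neighbours of \<open>Q\<close> too.\<close>

lemma pendant_edge:
  assumes X: "conn X" "finite X" "b \<notin> X" "x \<in> X" "adj b x"
    and closed: "\<And>p q. p \<in> X \<Longrightarrow> adj p q \<Longrightarrow> q \<in> insert b X"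
    and deg: "\<And>p. p \<in> X \<Longrightarrow> \<exists>q r. q \<noteq> r \<and> adj p q \<and> adj p r"
  shows "\<exists>Q p q. b \<in> Q \<and> Q \<subseteq> insert b X \<and> conn Q \<and> p \<in> X - Q \<and> q \<in> X - Q \<and> adj p q \<and>
    (\<exists>s\<in>Q. adj s p) \<and> (\<exists>s\<in>Q. adj s q)"
proof -
  let ?Y = "insert b X"
  define F where "F = {Q. b \<in> Q \<and> Q \<subseteq> ?Y \<and> conn Q \<and> (\<exists>p q. p \<in> X - Q \<and> q \<in> X - Q \<and> adj p q)}"
  have "finite F" using X(2) by (auto simp: F_def intro: finite_subset[of _ "Pow ?Y"])
  \<comment> \<open>Degree two gives \<open>x\<close> a neighbour other than \<open>b\<close>; it
    lies in \<open>X\<close>, so \<open>{b}\<close> misses an edge of \<open>X\<close>.\<close>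
  moreover have "{b} \<in> F"
  proof -
    obtain q r where "q \<noteq> r" "adj x q" "adj x r" using deg[OF X(4)] by blast
    then obtain q where "adj x q" "q \<noteq> b" by metis
    with closed[OF X(4)] X(3,4) show ?thesis by (auto simp: F_def)
  qed
  ultimately obtain Q where Q: "Q \<in> F" "\<And>Q'. Q' \<in> F \<Longrightarrow> Q \<subseteq> Q' \<Longrightarrow> Q = Q'"
    using finite_has_maximal2[of F "{b}"] by metis
  have Y: "conn ?Y" using conn_insert[OF X(1,4)] X(5) adj_sym by blast
  from Q(1) have Q1: "b \<in> Q" "Q \<subseteq> ?Y" "conn Q" by (auto simp: F_def)
  obtain p q where pq: "p \<in> X - Q" "q \<in> X - Q" "adj p q" using Q(1) by (auto simp: F_def)
  have "Q \<noteq> ?Y" using pq by auto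
  then obtain s r where sr: "s \<in> Q" "r \<in> ?Y - Q" "adj s r"
    using conn_leave[OF Y Q1(2)] Q1(1) by blast
  then have r: "r \<in> X - Q" using Q1(1) by auto
  have star: "p' = r \<or> q' = r" if "p' \<in> X - Q" "q' \<in> X - Q" "adj p' q'" for p' q'
  proof (rule ccontr)
    assume "\<not> ?thesis"
    moreover have "conn (insert r Q)" using conn_insert[OF Q1(3) sr(1,3)] .
    ultimately have "insert r Q \<in> F" using Q1 r that by (auto simp: F_def)
    with Q(2)[of "insert r Q"] r show False by auto
  qed
  obtain p' where p': "p' \<in> X - Q" "adj p' r"
    using star[OF pq] pq adj_sym by blast
  obtain q1 q2 where "q1 \<noteq> q2" "adj p' q1" "adj p' q2" using deg[of p'] p' by blast
  then obtain q' where q': "q' \<noteq> r" "adj p' q'" by metis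
  have "q' \<in> Q"
  proof (rule ccontr)
    assume "q' \<notin> Q"
    moreover have "q' \<in> ?Y" using closed[of p' q'] p' q' by auto
    ultimately have "q' \<in> X - Q" using Q1(1) by auto
    then have "p' = r" using star[of p' q'] p' q' by auto
    then show False using p' adj_irrefl by auto
  qed
  then have "\<exists>s\<in>Q. adj s p'" using q' adj_sym by blast
  with p' r sr Q1 show ?thesis by blast
qed

text \<open>Each component \<open>X i\<close> of \<open>V - {v} - b ` J\<close> contains fewer than \<open>2 t\<close> of the \<open>x i\<close>. Keep one per component.
  If \<open>X i\<close> touches \<open>v\<close> or some \<open>b j\<close> with \<open>j \<noteq> i\<close>, a part of \<open>X i\<close> can be added to a hub for \<open>b i, x i\<close>; otherwise
  \<open>X i\<close> hangs at \<open>b i\<close> alone and itself contains an edge next to a hub through \<open>b i\<close>.\<close>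

lemma touch_bound_aux:
  assumes deg: "\<And>p. p \<in> V \<Longrightarrow> \<exists>q r. q \<noteq> r \<and> adj p q \<and> adj p r"
    and v: "v \<in> V" and J: "finite J" "indm J b x"
    and vb: "\<And>i. i \<in> J \<Longrightarrow> adj v (b i) \<and> x i \<noteq> v \<and> \<not> adj v (x i)"
  shows "card J \<le> 10 * t * t"
proof -
  define H where "H = V - {v} - b ` J"
  define X where "X i = comp H (x i)" for i
  have bx: "adj (b i) (x i)" if "i \<in> J" for i using J(2) that by (auto simp: indm_def)
  have xH: "x i \<in> H" if "i \<in> J" for i
  proof -
    have "x i \<notin> b ` J" using indm_distinct(1)[OF J(2) _ that] by force
    then show ?thesis using vb[OF that] adj_V[OF adj_sym[OF bx[OF that]]] by (simp add: H_def)
  qed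
  have XH: "X i \<subseteq> H" for i unfolding X_def by (rule comp_subset)
  have HV: "H \<subseteq> V" by (auto simp: H_def)
  have conn: "conn (X i)" "x i \<in> X i" if "i \<in> J" for i
    using comp_conn[OF xH[OF that]] comp_self[OF xH[OF that]] by (auto simp: X_def)
  have fib: "card {i \<in> J. X i = C} \<le> 2 * t" for C
  proof (cases "{i \<in> J. X i = C} = {}")
    case False
    then obtain i where i: "i \<in> J" "X i = C" by blast
    have "card {i \<in> J. X i = C} < 2 * t"
    proof (rule terminals_bound[of _ b x v C])
      show "indm {i \<in> J. X i = C} b x" using J(2) by (rule indm_subset) auto
      show "conn C" using conn(1)[OF i(1)] i(2) by simp
      show "C \<subseteq> V" "v \<notin> C" using XH[of i] i(2) by (auto simp: H_def)
      show "b j \<notin> C" if "j \<in> {i \<in> J. X i = C}" for j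
        using XH[of i] i(2) that by (auto simp: H_def)
    qed (use J v vb conn(2) in auto)
    then show ?thesis by simp
  next
    case True
    then show ?thesis by (simp only: card.empty)
  qed
  \<comment> \<open>One representative index per component; since fibres have at most
    \<open>2 * t\<close> elements, this costs a factor \<open>2 * t\<close>.\<close>
  obtain r where r: "\<And>C. C \<in> X ` J \<Longrightarrow> r C \<in> J \<and> X (r C) = C"
  proof -
    have "\<forall>C\<in>X ` J. \<exists>i. i \<in> J \<and> X i = C" by auto
    from bchoice[OF this] show ?thesis using that by blast
  qed
  define J1 where "J1 = r ` X ` J"
  have J1: "J1 \<subseteq> J" "finite J1" using r J(1) by (auto simp: J1_def)
  have cJ1: "card J \<le> 2 * t * card J1"
  proof -
    have "J = (\<Union>C\<in>X ` J. {i \<in> J. X i = C})" by auto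
    then have "card J \<le> (\<Sum>C\<in>X ` J. card {i \<in> J. X i = C})"
      using card_UN_le[of "X ` J" "\<lambda>C. {i \<in> J. X i = C}"] J(1) by simp
    also have "\<dots> \<le> (\<Sum>C\<in>X ` J. 2 * t)" by (intro sum_mono fib)
    also have "\<dots> = 2 * t * card (X ` J)" by simp
    also have "card (X ` J) = card J1"
      unfolding J1_def by (rule card_image[symmetric]) (metis inj_onI r)
    finally show ?thesis .
  qed
  have dist: "X i \<inter> X j = {}" if "i \<in> J1" "j \<in> J1" "i \<noteq> j" for i j
  proof (rule ccontr)
    assume "X i \<inter> X j \<noteq> {}"
    then obtain z where "z \<in> X i" "z \<in> X j" by blast
    then have "X i = X j" using comp_eq unfolding X_def by metis
    then show False using that r by (auto simp: J1_def)
  qed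
  have cl: "q \<in> X i" if "p \<in> X i" "adj p q" "q \<in> H" for p q i
    using that comp_closed unfolding X_def by blast
  define Jc where "Jc = {i \<in> J1. \<exists>y\<in>X i. adj v y}"
  define Jd where "Jd = {i \<in> J1. \<exists>j\<in>J. j \<noteq> i \<and> (\<exists>y\<in>X i. adj (b j) y)}"
  define Je where "Je = {i \<in> J1. \<forall>p\<in>X i. \<forall>q. adj p q \<longrightarrow> q \<in> insert (b i) (X i)}"
  have cover: "J1 \<subseteq> Jc \<union> Jd \<union> Je"
  proof
    fix i assume i: "i \<in> J1"
    show "i \<in> Jc \<union> Jd \<union> Je"
    proof (rule ccontr)
      assume n: "i \<notin> Jc \<union> Jd \<union> Je"
      then obtain p q where pq: "p \<in> X i" "adj p q" "q \<notin> insert (b i) (X i)" using i by (auto simp: Je_def)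
      have "q \<notin> H" using cl[OF pq(1,2)] pq(3) by auto
      then have "q = v \<or> q \<in> b ` J" using adj_V[OF adj_sym[OF pq(2)]] by (auto simp: H_def)
      then show False
      proof
        assume "q = v"
        then show False using n i pq(1) adj_sym[OF pq(2)] by (auto simp: Jc_def)
      next
        assume "q \<in> b ` J"
        then obtain j where j: "j \<in> J" "q = b j" by auto
        then have "j \<noteq> i" using pq(3) by auto
        with j have "i \<in> Jd" using i pq(1) adj_sym[OF pq(2)] by (auto simp: Jd_def)
        then show False using n by simp
      qed
    qed
  qed
  have sub: "Jc \<subseteq> J" "Jd \<subseteq> J" "Je \<subseteq> J" "finite Jc" "finite Jd" "finite Je"
    using J1 by (auto simp: Jc_def Jd_def Je_def)
  have bX: "b i \<notin> X j" "v \<notin> X j" if "i \<in> J" for i j using XH[of j] that by (auto simp: H_def)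
  have bv: "b i \<noteq> v" if "i \<in> J" for i using vb[OF that] adj_irrefl by auto
  have c: "card Jc < t"
  proof (rule attach_bound[of Jc b x "{v}" v X])
    show "indm Jc b x" using J(2) sub(1) by (rule indm_subset)
    show "X i \<inter> X j = {}" if "i \<in> Jc" "j \<in> Jc" "i \<noteq> j" for i j
      using that dist by (auto simp: Jc_def)
    show "\<exists>y\<in>X i. y \<noteq> x i \<and> (\<exists>s\<in>{v}. adj s y)" if i: "i \<in> Jc" for i
    proof -
      obtain y where y: "y \<in> X i" "adj v y" using i by (auto simp: Jc_def)
      moreover have "\<not> adj v (x i)" using vb[of i] sub(1) i by blast
      ultimately have "y \<noteq> x i" by auto
      with y show ?thesis by auto
    qed
    show "conn (X i) \<and> X i \<subseteq> V \<and> x i \<in> X i \<and> {v} \<inter> X i = {} \<and> b i \<notin> {v}" if "i \<in> Jc" for i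
    proof -
      have "i \<in> J" using that sub by auto
      then show ?thesis using conn[of i] XH[of i] HV bX[of i i] bv[of i] by auto
    qed
    show "b i \<notin> X j" if "i \<in> Jc" "j \<in> Jc" for i j using bX sub(1) that by blast
  qed (use sub v vb in auto)
  have d: "card Jd \<le> 3 * t"
  proof -
    obtain f where f: "\<And>i. i \<in> Jd \<Longrightarrow> f i \<in> J \<and> f i \<noteq> i \<and> (\<exists>y\<in>X i. adj (b (f i)) y)"
    proof -
      have "\<forall>i\<in>Jd. \<exists>j. j \<in> J \<and> j \<noteq> i \<and> (\<exists>y\<in>X i. adj (b j) y)" unfolding Jd_def by blast
      from bchoice[OF this] show ?thesis using that by blast
    qed
    \<comment> \<open>The vertices \<open>b (f i)\<close> are to join the hub, so none of them may
      be an end of a surviving edge; this is the independence asked of \<open>J'\<close>.\<close>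
    obtain J' where J': "J' \<subseteq> Jd" "\<forall>i\<in>J'. f i \<notin> J'" "card Jd \<le> 3 * card J'"
      using functional_independent[OF sub(5), of f] f by blast
    let ?S = "{v} \<union> (\<Union>i\<in>J'. {b (f i)})"
    have J'J: "J' \<subseteq> J" using J'(1) sub by auto
    have "card J' < t"
    proof (rule attach_bound[of J' b x ?S v X])
      show "indm J' b x" using J(2) J'J by (rule indm_subset)
      show "conn ?S"
        by (rule conn_UN) (use f J'(1) vb in \<open>auto simp: touch_def\<close>)
      show "X i \<inter> X j = {}" if "i \<in> J'" "j \<in> J'" "i \<noteq> j" for i j
        using that dist J'(1) by (auto simp: Jd_def)
      show "?S \<subseteq> V" using v f J'(1) bx[THEN adj_V] by auto
      show "conn (X i) \<and> X i \<subseteq> V \<and> x i \<in> X i \<and> ?S \<inter> X i = {} \<and> b i \<notin> ?S" if i: "i \<in> J'" for i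
      proof -
        have iJ: "i \<in> J" using i J'J by auto
        have "b i \<noteq> b (f k)" if "k \<in> J'" for k
        proof
          assume "b i = b (f k)"
          then have "i = f k" using indm_distinct(2)[OF J(2) iJ] f[of k] that J'(1) by blast
          then show False using J'(2) i that by auto
        qed
        moreover have "b (f k) \<notin> X i" if "k \<in> J'" for k
          using bX f that J'(1) by blast
        ultimately show ?thesis using conn[OF iJ] XH[of i] HV bX(2)[OF iJ] bv[OF iJ] by auto
      qed
      show "\<exists>y\<in>X i. y \<noteq> x i \<and> (\<exists>s\<in>?S. adj s y)" if i: "i \<in> J'" for i
      proof -
        obtain y where y: "y \<in> X i" "adj (b (f i)) y" using f[of i] i J'(1) by blast
        moreover have "\<not> adj (b (f i)) (x i)"
          using J(2) f[of i] i J'(1) J'J unfolding indm_def by blast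
        ultimately have "y \<noteq> x i" by auto
        with y i show ?thesis by auto
      qed
      show "b i \<notin> X j" if "i \<in> J'" "j \<in> J'" for i j using bX J'J that by blast
      show "finite J'" using J'J J(1) finite_subset by blast
    qed (use vb J'J in auto)
    with J'(3) show ?thesis by simp
  qed
  have e: "card Je < t"
  proof -
    have "\<exists>Q p q. b i \<in> Q \<and> Q \<subseteq> insert (b i) (X i) \<and> conn Q \<and> p \<in> X i - Q \<and> q \<in> X i - Q \<and> adj p q \<and>
        (\<exists>s\<in>Q. adj s p) \<and> (\<exists>s\<in>Q. adj s q)" if i: "i \<in> Je" for i
    proof (rule pendant_edge[of "X i" "b i" "x i"])
      have iJ: "i \<in> J" using i sub by auto
      show "conn (X i)" "x i \<in> X i" "adj (b i) (x i)" "b i \<notin> X i" using conn[OF iJ] bx[OF iJ] bX[OF iJ] by auto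
      show "finite (X i)" using XH[of i] HV fin_V by (meson finite_subset)
      show "q \<in> insert (b i) (X i)" if "p \<in> X i" "adj p q" for p q
        using i that by (auto simp: Je_def)
      show "\<exists>q r. q \<noteq> r \<and> adj p q \<and> adj p r" if "p \<in> X i" for p
        using deg that XH[of i] HV by auto
    qed
    then have "\<forall>i\<in>Je. \<exists>Q p q. b i \<in> Q \<and> Q \<subseteq> insert (b i) (X i) \<and> conn Q \<and> p \<in> X i - Q \<and>
        q \<in> X i - Q \<and> adj p q \<and> (\<exists>s\<in>Q. adj s p) \<and> (\<exists>s\<in>Q. adj s q)" by blast
    then obtain Q p q where Q: "\<And>i. i \<in> Je \<Longrightarrow> b i \<in> Q i \<and> Q i \<subseteq> insert (b i) (X i) \<and> conn (Q i) \<and>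
        p i \<in> X i - Q i \<and> q i \<in> X i - Q i \<and> adj (p i) (q i) \<and> (\<exists>s\<in>Q i. adj s (p i)) \<and> (\<exists>s\<in>Q i. adj s (q i))"
      unfolding bchoice_iff by blast
    define S where "S = {v} \<union> (\<Union>i\<in>Je. Q i)"
    have S: "conn S"
      unfolding S_def
    proof (rule conn_UN)
      fix i assume i: "i \<in> Je"
      show "conn (Q i)" using Q[OF i] by simp
      show "touch {v} (Q i)" using Q[OF i] vb[of i] i sub(3) by (auto simp: touch_def)
    qed simp
    have SV: "S \<subseteq> V"
    proof -
      have "Q i \<subseteq> V" if "i \<in> Je" for i
        using Q[OF that] XH[of i] HV adj_V[OF bx[of i]] that sub(3) by blast
      then show ?thesis using v by (auto simp: S_def)
    qed
    have anti: "\<not> adj y z" if "i \<in> Je" "j \<in> Je" "i \<noteq> j" "y \<in> X i" "z \<in> X j" for i j y z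
    proof
      assume "adj y z"
      then have "z \<in> X i" using cl[OF that(4)] XH[of j] that(5) by blast
      then show False using dist[of i j] that by (auto simp: Je_def)
    qed
    have notS: "y \<notin> S" if iy: "i \<in> Je" "y \<in> X i - Q i" for i y
    proof
      assume "y \<in> S"
      moreover have iJ: "i \<in> J" using iy sub by auto
      moreover have "y \<noteq> v" using iy bX(2)[OF iJ] by auto
      ultimately obtain j where j: "j \<in> Je" "y \<in> Q j" by (auto simp: S_def)
      have "j \<in> J" using j sub(3) by auto
      then have "y \<noteq> b j" using bX(1)[of j i] iy by auto
      then have "y \<in> X j" using Q[OF j(1)] j(2) by blast
      moreover have "i \<noteq> j" using j iy by auto
      ultimately show False using dist[of i j] iy j by (auto simp: Je_def)
    qed
    show ?thesis
    proof (rule no_hub[OF S SV sub(6)])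
      show "indm Je p q"
        unfolding indm_def using Q anti by (meson DiffD1)
      fix i assume i: "i \<in> Je"
      show "p i \<notin> S \<and> q i \<notin> S \<and> (\<exists>s\<in>S. adj s (p i)) \<and> (\<exists>s\<in>S. adj s (q i))"
        using Q[OF i] notS[OF i] i unfolding S_def by blast
    qed
  qed
  have "card J1 \<le> card Jc + card Jd + card Je"
    using card_mono[OF _ cover] sub card_Un_le[of "Jc \<union> Jd" Je] card_Un_le[of Jc Jd] by simp
  \<comment> \<open>The three cases give \<open>t\<close>, \<open>3 * t\<close> and
    \<open>t\<close>; multiplied by the fibre bound \<open>2 * t\<close> this is
    \<open>10 * t * t\<close>.\<close>
  with c d e have "card J1 \<le> 5 * t" by simp
  then have "2 * t * card J1 \<le> 2 * t * (5 * t)" by (rule mult_le_mono2)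
  with cJ1 have "card J \<le> 2 * t * (5 * t)" by (rule order_trans)
  then show ?thesis by (simp add: mult.assoc mult.left_commute)
qed

text \<open>Edges that the preceding lemma excludes: at most one has \<open>b i = v\<close>, at most
  one has \<open>x i = v\<close>, and fewer than \<open>t\<close> form a triangle with
  \<open>v\<close>, as \<open>{v}\<close> would be a hub for them. Finally
  \<open>1 + 1 + t + 10 t^2\<close> is at most \<open>13 t^2\<close>.\<close>

lemma touch_bound_vertex:
  assumes deg: "\<And>p. p \<in> V \<Longrightarrow> \<exists>q r. q \<noteq> r \<and> adj p q \<and> adj p r"
    and v: "v \<in> V" and J: "finite J" "indm J b x"
    and vb: "\<And>i. i \<in> J \<Longrightarrow> b i \<in> cnbr {v}"
  shows "card J \<le> 13 * t * t"
proof -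
  define J1 where "J1 = {i \<in> J. b i = v}"
  define J2 where "J2 = {i \<in> J. x i = v}"
  define J3 where "J3 = {i \<in> J. adj v (b i) \<and> adj v (x i)}"
  define J4 where "J4 = {i \<in> J. adj v (b i) \<and> x i \<noteq> v \<and> \<not> adj v (x i)}"
  have "J \<subseteq> J1 \<union> J2 \<union> J3 \<union> J4" using vb by (auto simp: J1_def J2_def J3_def J4_def cnbr_def)
  moreover have fin: "finite J1" "finite J2" "finite J3" "finite J4"
    using J(1) by (auto simp: J1_def J2_def J3_def J4_def)
  ultimately have le: "card J \<le> card J1 + card J2 + card J3 + card J4"
    using card_mono[of "J1 \<union> J2 \<union> J3 \<union> J4" J] card_Un_le[of "J1 \<union> J2 \<union> J3" J4]
      card_Un_le[of "J1 \<union> J2" J3] card_Un_le[of J1 J2] by simp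
  have "card J1 \<le> 1" "card J2 \<le> 1"
    using fin indm_distinct[OF J(2)] unfolding J1_def J2_def One_nat_def
    by (auto simp: card_le_Suc0_iff_eq)
  moreover have "card J3 < t"
    by (rule no_hub[of "{v}" J3 b x])
      (use v fin indm_subset[OF J(2), of J3] adj_irrefl in \<open>auto simp: J3_def\<close>)
  moreover have "card J4 \<le> 10 * t * t"
    by (rule touch_bound_aux[OF deg v fin(4) indm_subset[OF J(2)]]) (auto simp: J4_def)
  moreover have "t \<le> t * t" "1 \<le> t * t" using t_pos[OF v] by (auto simp: Suc_le_eq)
  ultimately show ?thesis using le by linarith
qed

lemma touch_bound:
  assumes deg: "\<And>p. p \<in> V \<Longrightarrow> \<exists>q r. q \<noteq> r \<and> adj p q \<and> adj p r"
    and X: "X \<subseteq> V" and J: "finite J" "indm J b x"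
    and vb: "\<And>i. i \<in> J \<Longrightarrow> b i \<in> cnbr X"
  shows "card J \<le> card X * (13 * t * t)"
proof -
  have finX: "finite X" using X fin_V finite_subset by blast
  have "J \<subseteq> (\<Union>v\<in>X. {i \<in> J. b i \<in> cnbr {v}})" using vb by (fastforce simp: cnbr_def)
  then have "card J \<le> card (\<Union>v\<in>X. {i \<in> J. b i \<in> cnbr {v}})"
    using J(1) finX by (intro card_mono) auto
  also have "\<dots> \<le> (\<Sum>v\<in>X. card {i \<in> J. b i \<in> cnbr {v}})" by (rule card_UN_le[OF finX])
  also have "\<dots> \<le> (\<Sum>v\<in>X. 13 * t * t)"
  proof (rule sum_mono)
    fix v assume "v \<in> X"
    then show "card {i \<in> J. b i \<in> cnbr {v}} \<le> 13 * t * t"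
      using X J by (intro touch_bound_vertex[OF deg, of v _ b x]) (auto intro: indm_subset)
  qed
  finally show ?thesis by simp
qed

end

section \<open>Encoding the trace of an independent set by an induced matching\<close>

section \<open>Traces of maximal independent sets\<close>

text \<open>The vertices outside \<open>B\<close> count as larger than those of \<open>B\<close>. Decreasing elimination of the
  vertices records a pair \<open>(u, v)\<close> whenever the eliminated vertex \<open>v \<in> I\<close> is the only neighbour in
  \<open>I\<close> of some remaining \<open>u \<in> B\<close>; the trace of \<open>I\<close> on \<open>B\<close> is recovered from the pairs by a first-fit rule.\<close>

definition (in adjacency) matching_list :: "('a \<times> 'a) list \<Rightarrow> bool" where
  "matching_list M \<longleftrightarrow> (\<forall>(u, v)\<in>set M. adj u v) \<and>
     sorted_wrt (\<lambda>(u, v) (u', v'). \<not> adj u u' \<and> \<not> adj u v' \<and> \<not> adj v u' \<and> \<not> adj v v') M"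

lemma (in adjacency) matching_list_indm:
  assumes "matching_list M"
  shows "indm {..<length M} (\<lambda>i. fst (M ! i)) (\<lambda>i. snd (M ! i))"
proof -
  have lt: "\<not> adj (fst (M ! i)) (fst (M ! j)) \<and> \<not> adj (fst (M ! i)) (snd (M ! j)) \<and>
      \<not> adj (snd (M ! i)) (fst (M ! j)) \<and> \<not> adj (snd (M ! i)) (snd (M ! j))"
    if "i < j" "j < length M" for i j
    using assms that unfolding matching_list_def sorted_wrt_iff_nth_less by (auto simp: case_prod_beta)
  have "adj (fst (M ! i)) (snd (M ! i))" if "i < length M" for i
    using assms that nth_mem[OF that] unfolding matching_list_def by (auto simp: case_prod_beta)
  moreover have "\<not> adj (fst (M ! i)) (fst (M ! j)) \<and> \<not> adj (fst (M ! i)) (snd (M ! j)) \<and>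
      \<not> adj (snd (M ! i)) (snd (M ! j))" if "i < length M" "j < length M" "i \<noteq> j" for i j
    using lt[of i j] lt[of j i] that adj_commute by (metis linorder_neqE_nat)
  ultimately show ?thesis by (auto simp: indm_def)
qed

locale ordered_adjacency = adjacency adj for adj :: "'a::linorder \<Rightarrow> 'a \<Rightarrow> bool"

text \<open>A pair is tested against \<open>w\<close> only if its second entry counts as larger than
  \<open>w\<close>, that is, only if it was recorded before \<open>w\<close> itself would be
  eliminated.\<close>

definition (in ordered_adjacency) kept :: "'a set \<Rightarrow> ('a \<times> 'a) list \<Rightarrow> 'a \<Rightarrow> bool" where
  "kept B M w \<longleftrightarrow> (\<forall>(u, v)\<in>set M. v \<notin> B \<or> w < v \<longrightarrow> \<not> adj u w \<and> \<not> adj v w)"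

text \<open>Recording \<open>(u, v)\<close> also removes all neighbours of \<open>u\<close> and
  \<open>v\<close>; later pairs are therefore anticomplete to it, while \<open>v\<close> is the only
  vertex of \<open>I\<close> lost. If nothing is recorded, every remaining vertex of
  \<open>B - I\<close> still has a neighbour in \<open>I\<close> after \<open>v\<close> is gone.
  This invariant makes first fit correct: when a vertex of \<open>B - I\<close> has become the
  largest one, all remaining vertices lie in \<open>B\<close>, so its neighbour in \<open>I\<close>
  is a smaller member of the trace.\<close>

lemma (in ordered_adjacency) trace_exists:
  assumes "finite H" and I: "\<And>x y. x \<in> I \<Longrightarrow> y \<in> I \<Longrightarrow> \<not> adj x y"
    and "\<And>b. b \<in> B \<inter> H - I \<Longrightarrow> \<exists>y\<in>I \<inter> H. adj b y"
  shows "\<exists>M. set M \<subseteq> (B \<inter> H) \<times> H \<and> matching_list M \<and>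
    (\<forall>w\<in>B \<inter> H. w \<in> I \<longleftrightarrow> kept B M w \<and> (\<forall>w'\<in>I \<inter> B \<inter> H. w' < w \<longrightarrow> \<not> adj w' w))"
  using assms(1,3)
proof (induction "card H" arbitrary: H rule: less_induct)
  case less
  show ?case
  proof (cases "H = {}")
    case True
    then show ?thesis by (intro exI[of _ "[]"]) (auto simp: matching_list_def)
  next
    case False
    \<comment> \<open>Vertices outside \<open>B\<close> go first, in any order; once only vertices
      of \<open>B\<close> are left, the maximum is eliminated.\<close>
    obtain v where v: "v \<in> H" and top: "v \<in> B \<Longrightarrow> H \<subseteq> B \<and> (\<forall>w\<in>H. w \<le> v)"
    proof (cases "H \<subseteq> B")
      case True
      show ?thesis
        by (rule that[of "Max H"]) (use True False less.prems(1) in auto)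
    next
      case False
      then show ?thesis using that by blast
    qed
    have top2: "v \<in> B \<Longrightarrow> w \<in> H \<Longrightarrow> \<not> v < w" for w using top by (auto simp: not_less)
    show ?thesis
    proof (cases "v \<in> I \<and> (\<exists>u\<in>B \<inter> H. adj u v \<and> (\<forall>y\<in>I \<inter> H. adj u y \<longrightarrow> y = v))")
      case True
      then obtain u where vI: "v \<in> I" and u: "u \<in> B \<inter> H" "adj u v" "\<And>y. y \<in> I \<inter> H \<Longrightarrow> adj u y \<Longrightarrow> y = v"
        by blast
      define H' where "H' = {w \<in> H. w \<noteq> v \<and> \<not> adj v w \<and> \<not> adj u w}"
      have sub: "H' \<subseteq> H" by (auto simp: H'_def)
      have "card H' < card H" using v less.prems(1) by (intro psubset_card_mono) (auto simp: H'_def)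
      moreover have "finite H'" using less.prems(1) sub finite_subset by blast
      moreover have "\<exists>y\<in>I \<inter> H'. adj b y" if b: "b \<in> B \<inter> H' - I" for b
      proof -
        obtain y where y: "y \<in> I \<inter> H" "adj b y" using less.prems(2)[of b] b sub by auto
        have "y \<noteq> v" using b y(2) adj_sym by (auto simp: H'_def)
        then show ?thesis using y u(3)[of y] I[OF vI, of y] by (auto simp: H'_def)
      qed
      ultimately obtain M where M: "set M \<subseteq> (B \<inter> H') \<times> H'" "matching_list M"
        "\<And>w. w \<in> B \<inter> H' \<Longrightarrow> w \<in> I \<longleftrightarrow> kept B M w \<and> (\<forall>w'\<in>I \<inter> B \<inter> H'. w' < w \<longrightarrow> \<not> adj w' w)"
        using less.hyps[of H'] by blast
      have IH: "w \<in> H' \<or> w = v" if "w \<in> I \<inter> H" for w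
        using that u(3)[of w] I[OF vI, of w] by (auto simp: H'_def)
      have "w \<in> I \<longleftrightarrow> kept B ((u, v) # M) w \<and> (\<forall>w'\<in>I \<inter> B \<inter> H. w' < w \<longrightarrow> \<not> adj w' w)"
        if w: "w \<in> B \<inter> H" for w
      proof -
        consider "w = v" | "w \<noteq> v" "adj v w \<or> adj u w" | "w \<in> H'" using w by (auto simp: H'_def)
        then show ?thesis
        proof cases
          case 1
          have top': "H \<subseteq> B" "\<And>x. x \<in> H \<Longrightarrow> \<not> w < x" using 1 w top by (auto simp: not_less)
          have "snd m \<in> B \<and> \<not> w < snd m" if "m \<in> set ((u, v) # M)" for m
          proof -
            have "snd ` set M \<subseteq> H" using M(1) sub by force
            then have "snd m \<in> H" using that v by auto
            then show ?thesis using top' by blast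
          qed
          then have "kept B ((u, v) # M) w" unfolding kept_def by (metis (no_types, lifting) case_prodI2 snd_conv)
          then show ?thesis using 1 vI I by blast
        next
          case 2
          have "w \<notin> I" using 2 I[OF vI, of w] u(3)[of w] w by auto
          moreover have "\<not> kept B ((u, v) # M) w"
          proof -
            have "v \<notin> B \<or> w < v" using 2(1) top w by (auto simp: order.strict_iff_order)
            then show ?thesis using 2(2) unfolding kept_def by auto
          qed
          ultimately show ?thesis by simp
        next
          case 3
          then have "kept B ((u, v) # M) w \<longleftrightarrow> kept B M w" by (auto simp: kept_def H'_def)
          moreover have "(\<forall>w'\<in>I \<inter> B \<inter> H. w' < w \<longrightarrow> \<not> adj w' w) \<longleftrightarrow>
              (\<forall>w'\<in>I \<inter> B \<inter> H'. w' < w \<longrightarrow> \<not> adj w' w)"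
          proof -
            have "w' \<in> H'" if "w' \<in> I \<inter> B \<inter> H" "w' < w" for w'
              using IH[of w'] that top2[of w] w by auto
            then show ?thesis using sub by blast
          qed
          ultimately show ?thesis using M(3)[of w] 3 w by simp
        qed
      qed
      moreover have "matching_list ((u, v) # M)"
      proof -
        have "\<not> adj u a \<and> \<not> adj u c \<and> \<not> adj v a \<and> \<not> adj v c" if "(a, c) \<in> set M" for a c
          using that M(1) by (auto simp: H'_def)
        then show ?thesis using M(2) u(2) unfolding matching_list_def by auto
      qed
      moreover have "set ((u, v) # M) \<subseteq> (B \<inter> H) \<times> H" using M(1) sub u v by auto
      ultimately show ?thesis by blast
    next
      case False
      define H' where "H' = H - {v}"
      have sub: "H' \<subseteq> H" by (auto simp: H'_def)
      have "card H' < card H" using v less.prems(1) by (intro psubset_card_mono) (auto simp: H'_def)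
      moreover have "finite H'" using less.prems(1) sub finite_subset by blast
      moreover have "\<exists>y\<in>I \<inter> H'. adj b y" if b: "b \<in> B \<inter> H' - I" for b
      proof -
        obtain y where y: "y \<in> I \<inter> H" "adj b y" using less.prems(2)[of b] b sub by auto
        show ?thesis
        proof (cases "y = v")
          case True
          then obtain y' where "y' \<in> I \<inter> H" "adj b y'" "y' \<noteq> v" using False y b sub by blast
          then show ?thesis by (auto simp: H'_def)
        next
          case False
          then show ?thesis using y by (auto simp: H'_def)
        qed
      qed
      ultimately obtain M where M: "set M \<subseteq> (B \<inter> H') \<times> H'" "matching_list M"
        "\<And>w. w \<in> B \<inter> H' \<Longrightarrow> w \<in> I \<longleftrightarrow> kept B M w \<and> (\<forall>w'\<in>I \<inter> B \<inter> H'. w' < w \<longrightarrow> \<not> adj w' w)"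
        using less.hyps[of H'] by blast
      have "w \<in> I \<longleftrightarrow> kept B M w \<and> (\<forall>w'\<in>I \<inter> B \<inter> H. w' < w \<longrightarrow> \<not> adj w' w)"
        if w: "w \<in> B \<inter> H" for w
      proof (cases "w = v")
        case True
        then have le: "\<And>x. x \<in> H \<Longrightarrow> x \<le> w" and HB: "H \<subseteq> B" using top w by auto
        have "snd m \<in> B \<and> \<not> w < snd m" if "m \<in> set M" for m
        proof -
          have "snd ` set M \<subseteq> H" using M(1) sub by force
          then have "snd m \<in> H" using that by auto
          then show ?thesis using le HB by (auto simp: not_less)
        qed
        then have "kept B M w" unfolding kept_def by (metis (no_types, lifting) case_prodI2 snd_conv)
        moreover have "w \<in> I \<longleftrightarrow> (\<forall>w'\<in>I \<inter> B \<inter> H. w' < w \<longrightarrow> \<not> adj w' w)"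
        proof
          assume "\<forall>w'\<in>I \<inter> B \<inter> H. w' < w \<longrightarrow> \<not> adj w' w"
          then show "w \<in> I"
          proof (rule_tac ccontr)
            assume all: "\<forall>w'\<in>I \<inter> B \<inter> H. w' < w \<longrightarrow> \<not> adj w' w" and "w \<notin> I"
            then obtain y where y: "y \<in> I \<inter> H" "adj w y" using less.prems(2)[of w] w by auto
            then have "y < w" using le[of y] adj_irrefl by (metis Int_iff order_le_imp_less_or_eq)
            then show False using all y HB adj_sym by blast
          qed
        qed (use I in blast)
        ultimately show ?thesis by simp
      next
        case False
        then have w': "w \<in> B \<inter> H'" using w by (auto simp: H'_def)
        have "(\<forall>w'\<in>I \<inter> B \<inter> H. w' < w \<longrightarrow> \<not> adj w' w) \<longleftrightarrow>
            (\<forall>w'\<in>I \<inter> B \<inter> H'. w' < w \<longrightarrow> \<not> adj w' w)"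
        proof -
          have "w' \<in> H'" if "w' \<in> I \<inter> B \<inter> H" "w' < w" for w'
            using that top2[of w] w by (auto simp: H'_def)
          then show ?thesis using sub by blast
        qed
        then show ?thesis using M(3)[OF w'] by simp
      qed
      moreover have "set M \<subseteq> (B \<inter> H) \<times> H" using M(1) sub by auto
      ultimately show ?thesis using M(2) by blast
    qed
  qed
qed

section \<open>Soundness and completeness of the dynamic program on vertex sets\<close>

section \<open>Dynamic programming over dominated separators\<close>

text \<open>Written as the fold that the machine performs. The strict comparison, starting from the
  empty set, makes empty entries in the list harmless.\<close>

definition best :: "'a set list \<Rightarrow> 'a set \<Rightarrow> 'a set" where
  "best L T = foldl (\<lambda>b S. if S \<subseteq> T \<and> card b < card S then S else b) {} L"

lemma best_snoc: "best (L @ [S]) T = (if S \<subseteq> T \<and> card (best L T) < card S then S else best L T)"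
  by (simp add: best_def)

lemma best_Nil: "best [] T = {}"
  by (simp add: best_def)

lemma best_in: "best L T \<in> insert {} (set L)" and best_subset: "best L T \<subseteq> T"
  by (induction L rule: rev_induct) (auto simp: best_snoc best_Nil)

lemma best_max: "S \<in> set L \<Longrightarrow> S \<subseteq> T \<Longrightarrow> card S \<le> card (best L T)"
  by (induction L rule: rev_induct) (auto simp: best_snoc)

text \<open>A code consists of the separator vertices \<open>X\<close>, the next path vertex \<open>p\<close>, a vertex \<open>c\<close> of the
  current component, and the pairs \<open>M\<close> of the trace; \<open>None\<close> for \<open>c\<close> stands for the whole graph.\<close>

type_synonym code = "nat list \<times> nat \<times> nat option \<times> (nat \<times> nat) list"

locale dp = ordered_adjacency adj for adj :: "nat \<Rightarrow> nat \<Rightarrow> bool" +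
  fixes V :: "nat set"
  assumes finite_V: "finite V" and adj_in_V: "adj x y \<Longrightarrow> x \<in> V"
begin

definition indep_in :: "nat set \<Rightarrow> bool" where
  "indep_in S \<longleftrightarrow> S \<subseteq> V \<and> (\<forall>x\<in>S. \<forall>y\<in>S. \<not> adj x y)"

definition bag :: "nat set \<Rightarrow> nat set" where
  "bag X = V \<inter> cnbr X"

definition away :: "nat set \<Rightarrow> nat set" where
  "away S = {v. \<forall>u\<in>S. \<not> adj u v}"

text \<open>Membership of \<open>w\<close> refers only to smaller members, so this equation is a
  recursion and has at most one solution.\<close>

definition is_trace :: "nat set \<Rightarrow> (nat \<times> nat) list \<Rightarrow> nat set \<Rightarrow> bool" where
  "is_trace B M S \<longleftrightarrow>
     (\<forall>w. w \<in> S \<longleftrightarrow> w \<in> B \<and> kept B M w \<and> (\<forall>w'\<in>S. w' < w \<longrightarrow> \<not> adj w' w))"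

lemma is_trace_unique:
  assumes "is_trace B M S" "is_trace B M S'"
  shows "S = S'"
proof -
  have "w \<in> S \<longleftrightarrow> w \<in> S'" for w
  proof (induction w rule: less_induct)
    case (less w)
    then show ?case using assms unfolding is_trace_def by blast
  qed
  then show ?thesis by blast
qed

definition region :: "nat set \<Rightarrow> nat option \<Rightarrow> nat set" where
  "region X c = (case c of None \<Rightarrow> V - bag X | Some c \<Rightarrow> comp (V - bag X) c)"

text \<open>The union runs over vertices instead of components, which spares a choice of
  representatives: vertices of one component contribute the same listed set.\<close>

definition assemble :: "nat set list \<Rightarrow> nat set \<Rightarrow> nat \<Rightarrow> nat option \<Rightarrow> nat set \<Rightarrow> nat set" where
  "assemble L X p c S =
     (let B = bag (insert p X); W = region X c \<inter> away (S \<inter> bag X)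
      in (S \<inter> W) \<union> (\<Union>c'\<in>W - B. best L (comp (V - B) c' \<inter> away S)))"

definition step :: "nat set list \<Rightarrow> code \<Rightarrow> nat set" where
  "step L = (\<lambda>(X, p, c, M). assemble L (set X) p c (THE S. is_trace (bag (insert p (set X))) M S))"

lemma step_eq:
  assumes "is_trace (bag (insert p (set X))) M S"
  shows "step L (X, p, c, M) = assemble L (set X) p c S"
proof -
  have "(THE S. is_trace (bag (insert p (set X))) M S) = S"
    by (rule the_equality[where P = "is_trace (bag (insert p (set X))) M"]) (use assms is_trace_unique in blast)+
  then show ?thesis by (simp add: step_def)
qed

lemma trace_indep: "is_trace B M S \<Longrightarrow> B \<subseteq> V \<Longrightarrow> indep_in S"
proof -
  assume S: "is_trace B M S" and "B \<subseteq> V"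
  have "S \<subseteq> V" using S \<open>B \<subseteq> V\<close> unfolding is_trace_def by auto
  moreover have lt: "\<not> adj x y" if "x \<in> S" "y \<in> S" "x < y" for x y
    using S that unfolding is_trace_def by blast
  have "\<not> adj x y" if "x \<in> S" "y \<in> S" for x y
    using lt[of x y] lt[of y x] that adj_irrefl[of x] adj_commute[of x y] by (cases x y rule: linorder_cases) auto
  ultimately show ?thesis unfolding indep_in_def by auto
qed

text \<open>Soundness asks nothing of the code beyond a trace. Two chosen sets joined by an edge
  come from the same component, hence are the same independent set, and every chosen set avoids the
  neighbours of \<open>S\<close>.\<close>

lemma assemble_indep:
  assumes S: "indep_in S" "S \<subseteq> bag (insert p X)" and L: "\<And>U. U \<in> set L \<Longrightarrow> indep_in U"
  shows "indep_in (assemble L X p c S)"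
proof -
  define B where "B = bag (insert p X)"
  define W where "W = region X c \<inter> away (S \<inter> bag X)"
  define T where "T c' = best L (comp (V - B) c' \<inter> away S)" for c'
  have eq: "assemble L X p c S = (S \<inter> W) \<union> (\<Union>c'\<in>W - B. T c')"
    by (simp add: assemble_def B_def W_def T_def Let_def)
  have T: "T c' \<subseteq> comp (V - B) c'" "T c' \<subseteq> away S" "indep_in (T c')" for c'
  proof -
    have "T c' \<subseteq> comp (V - B) c' \<inter> away S" unfolding T_def by (rule best_subset)
    then show "T c' \<subseteq> comp (V - B) c'" "T c' \<subseteq> away S" by auto
    have "T c' = {} \<or> T c' \<in> set L" unfolding T_def using best_in[of L "comp (V - B) c' \<inter> away S"] by auto
    then show "indep_in (T c')" using L by (auto simp: indep_in_def)
  qed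
  have TT: "\<not> adj x y" if xy: "x \<in> T a" "y \<in> T b" for a b x y
  proof
    assume "adj x y"
    moreover have "x \<in> comp (V - B) a" "y \<in> comp (V - B) b" using T(1) xy by auto
    moreover from this have "y \<in> V - B" using comp_subset by blast
    ultimately have "y \<in> comp (V - B) a" using comp_closed by blast
    then have "comp (V - B) a = comp (V - B) b"
      using comp_eq \<open>y \<in> comp (V - B) b\<close> by metis
    then have "T a = T b" by (simp add: T_def)
    then show False using T(3)[of b] xy \<open>adj x y\<close> by (auto simp: indep_in_def)
  qed
  have ST: "\<not> adj x y \<and> \<not> adj y x" if "x \<in> S" "y \<in> T b" for x y b
    using T(2)[of b] that adj_sym unfolding away_def by blast
  show ?thesis
    unfolding indep_in_def
  proof (intro conjI ballI)
    show "assemble L X p c S \<subseteq> V" using S(1) T(3) unfolding eq indep_in_def by blast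
    fix x y assume "x \<in> assemble L X p c S" "y \<in> assemble L X p c S"
    then have "x \<in> S \<or> (\<exists>a. x \<in> T a)" "y \<in> S \<or> (\<exists>b. y \<in> T b)" unfolding eq by auto
    then show "\<not> adj x y" using S(1) TT ST unfolding indep_in_def by auto
  qed
qed

lemma step_indep:
  assumes "is_trace (bag (insert p (set X))) M S" "\<And>U. U \<in> set L \<Longrightarrow> indep_in U"
  shows "indep_in (step L (X, p, c, M))"
proof -
  have "S \<subseteq> bag (insert p (set X))" using assms(1) by (auto simp: is_trace_def)
  moreover have "indep_in S" by (rule trace_indep[OF assms(1)]) (auto simp: bag_def)
  ultimately show ?thesis unfolding step_eq[OF assms(1)] using assms(2) by (blast intro: assemble_indep)
qed

definition run :: "nat set list \<Rightarrow> code list \<Rightarrow> nat set list" where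
  "run L cs = foldl (\<lambda>L g. L @ [step L g]) L cs"

lemma run_simps [simp]: "run L [] = L" "run L (cs @ cs') = run (run L cs) cs'"
  "run L (g # cs) = run (L @ [step L g]) cs"
  by (simp_all add: run_def)

lemma run_mono: "set L \<subseteq> set (run L cs)"
proof (induction cs arbitrary: L)
  case (Cons g cs)
  have "set L \<subseteq> set (L @ [step L g])" by auto
  also have "\<dots> \<subseteq> set (run (L @ [step L g]) cs)" by (rule Cons.IH)
  finally show ?case by simp
qed simp

text \<open>Other codes may extend the list before the turn of \<open>g\<close>; claims about steps
  are therefore made for all longer lists.\<close>

lemma run_step:
  assumes "g \<in> set cs"
  shows "\<exists>L'. set L \<subseteq> set L' \<and> step L' g \<in> set (run L cs)"
proof -
  obtain cs1 cs2 where cs: "cs = cs1 @ g # cs2" using assms by (metis split_list)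
  have "step (run L cs1) g \<in> set (run L cs)"
    unfolding cs using run_mono[of "run L cs1 @ [step (run L cs1) g]" cs2] by auto
  then show ?thesis using run_mono by blast
qed

text \<open>Exchange argument: inside each component of \<open>V - B\<close> the part of
  \<open>I\<close> is replaced by a set that is no smaller, and disjointness lets the sizes add up.
  \<open>f\<close> is abstract so that it covers both the steps below a walk and the final step with
  \<open>B = {}\<close>.\<close>

lemma card_assemble:
  assumes I: "I \<subseteq> V" and T: "T \<subseteq> V" "\<And>c. c \<in> T - B \<Longrightarrow> comp (V - B) c \<subseteq> T"
    and f: "\<And>c. c \<in> I \<inter> T - B \<Longrightarrow> card (I \<inter> comp (V - B) c) \<le> card (f (comp (V - B) c)) \<and>
      f (comp (V - B) c) \<subseteq> comp (V - B) c"
    and U: "finite U" "I \<inter> T \<inter> B \<subseteq> U" "\<And>c. c \<in> I \<inter> T - B \<Longrightarrow> f (comp (V - B) c) \<subseteq> U"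
  shows "card (I \<inter> T) \<le> card U"
proof -
  define \<D> where "\<D> = comp (V - B) ` (I \<inter> T - B)"
  have "finite I" using I finite_V finite_subset by blast
  then have fin: "finite (I \<inter> T)" "finite \<D>" by (auto simp: \<D>_def)
  have disj: "D1 \<inter> D2 = {}" if "D1 \<in> \<D>" "D2 \<in> \<D>" "D1 \<noteq> D2" for D1 D2
    using that comp_eq unfolding \<D>_def by (metis (no_types, lifting) disjoint_iff imageE)
  have DB: "D \<inter> B = {}" "D \<subseteq> V" "finite D" if "D \<in> \<D>" for D
  proof -
    show "D \<inter> B = {}" "D \<subseteq> V" using that comp_subset[of "V - B"] by (auto simp: \<D>_def)
    then show "finite D" using finite_V finite_subset by blast
  qed
  have fD: "f D \<subseteq> D" "card (I \<inter> D) \<le> card (f D)" "f D \<subseteq> U" if "D \<in> \<D>" for D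
    using that f U(3) by (auto simp: \<D>_def)
  have IT: "I \<inter> T = (I \<inter> T \<inter> B) \<union> (\<Union>D\<in>\<D>. I \<inter> D)"
  proof
    show "I \<inter> T \<subseteq> (I \<inter> T \<inter> B) \<union> (\<Union>D\<in>\<D>. I \<inter> D)"
      using comp_self[of _ "V - B"] I by (auto simp: \<D>_def)
    show "(I \<inter> T \<inter> B) \<union> (\<Union>D\<in>\<D>. I \<inter> D) \<subseteq> I \<inter> T" using T(2) by (auto simp: \<D>_def)
  qed
  have "card (I \<inter> T) \<le> card (I \<inter> T \<inter> B) + card (\<Union>D\<in>\<D>. I \<inter> D)"
    by (subst IT) (rule card_Un_le)
  also have "card (\<Union>D\<in>\<D>. I \<inter> D) = (\<Sum>D\<in>\<D>. card (I \<inter> D))"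
    using fin(2) disj DB(3) by (intro card_UN_disjoint) auto
  also have "\<dots> \<le> (\<Sum>D\<in>\<D>. card (f D))" by (intro sum_mono fD)
  also have "\<dots> = card (\<Union>D\<in>\<D>. f D)"
  proof (rule card_UN_disjoint[symmetric])
    show "\<forall>D\<in>\<D>. finite (f D)" using fD(1) DB(3) finite_subset by blast
    show "\<forall>D1\<in>\<D>. \<forall>D2\<in>\<D>. D1 \<noteq> D2 \<longrightarrow> f D1 \<inter> f D2 = {}"
      using disj fD(1) by blast
  qed fact
  also have "card (I \<inter> T \<inter> B) + card (\<Union>D\<in>\<D>. f D) = card ((I \<inter> T \<inter> B) \<union> (\<Union>D\<in>\<D>. f D))"
  proof (rule card_Un_disjoint[symmetric])
    show "finite (I \<inter> T \<inter> B)" using fin by auto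
    show "finite (\<Union>D\<in>\<D>. f D)" using fin(2) fD(1) DB(3) finite_subset by blast
    show "I \<inter> T \<inter> B \<inter> (\<Union>D\<in>\<D>. f D) = {}" using fD(1) DB(1) by blast
  qed
  also have "\<dots> \<le> card U" using U(1,2) fD(3) by (intro card_mono) auto
  finally show ?thesis by simp
qed

end

text \<open>\<open>I\<close> is the independent set that the program has to match in size; it picks
  the codes used in the completeness proof. \<open>none\<close> is an isolated padding
  value.\<close>

locale dp_free = dp adj V + hub_free adj V t for adj :: "nat \<Rightarrow> nat \<Rightarrow> bool" and V t +
  fixes I :: "nat set" and none :: nat
  assumes deg: "p \<in> V \<Longrightarrow> \<exists>q r. q \<noteq> r \<and> adj p q \<and> adj p r"
    and I_indep: "indep_in I" and I_max: "b \<in> V - I \<Longrightarrow> \<exists>y\<in>I. adj b y"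
    and none_notin: "none \<notin> V"
begin

text \<open>The last clause provides a boundary vertex of \<open>D\<close> that sees only the end of
  the path, so that the path can be prolonged towards \<open>D\<close> and stays induced.\<close>

definition walk :: "(nat \<Rightarrow> nat) \<Rightarrow> nat \<Rightarrow> nat set \<Rightarrow> bool" where
  "walk p m D \<longleftrightarrow> induced_path p m \<and> conn D \<and> D \<subseteq> V \<and>
     (\<forall>i<m. \<forall>x\<in>D. p i \<noteq> x \<and> \<not> adj (p i) x) \<and> nbr D \<subseteq> cnbr (p ` {..<m}) \<and>
     (0 < m \<longrightarrow> (\<exists>z\<in>nbr D. \<forall>i<m. adj (p i) z \<longleftrightarrow> Suc i = m))"

definition contacts :: "(nat \<Rightarrow> nat) \<Rightarrow> nat \<Rightarrow> nat set \<Rightarrow> nat set" where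
  "contacts p m D = {x \<in> p ` {..<m}. \<exists>z\<in>nbr D. adj x z}"

lemma walk_contacts:
  assumes "walk p m D"
  shows "nbr D \<subseteq> cnbr (contacts p m D)" "D \<inter> cnbr (contacts p m D) = {}" "contacts p m D \<subseteq> V"
    "card (contacts p m D) \<le> 3 * t"
proof -
  show "nbr D \<subseteq> cnbr (contacts p m D)"
  proof
    fix z assume z: "z \<in> nbr D"
    then obtain d where d: "d \<in> D" "adj d z" by (auto simp: nbr_def)
    have "z \<noteq> p i" if "i < m" for i
      using assms that d adj_sym unfolding walk_def by blast
    moreover have "z \<in> cnbr (p ` {..<m})" using assms z unfolding walk_def by blast
    ultimately obtain i where "i < m" "adj (p i) z" unfolding cnbr_def by auto
    then show "z \<in> cnbr (contacts p m D)" using z by (auto simp: cnbr_def contacts_def)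
  qed
  show "D \<inter> cnbr (contacts p m D) = {}"
    using assms unfolding walk_def cnbr_def contacts_def by blast
  show "contacts p m D \<subseteq> V"
    using assms unfolding walk_def contacts_def induced_path_def by auto
  show "card (contacts p m D) \<le> 3 * t"
    unfolding contacts_def by (rule contacts_bound) (use assms in \<open>auto simp: walk_def\<close>)
qed

text \<open>A state is thus determined by few vertices: the contacts separate \<open>D\<close> from
  the rest, and any vertex of \<open>D\<close> names it. This is why codes can be
  enumerated.\<close>

lemma walk_comp:
  assumes "walk p m D" "c \<in> D"
  shows "comp (V - bag (contacts p m D)) c = D"
proof (rule comp_eqI)
  note w = walk_contacts[OF assms(1)]
  show "conn D" "c \<in> D" using assms by (auto simp: walk_def)
  show "D \<subseteq> V - bag (contacts p m D)"
    using w(2) assms(1) by (auto simp: bag_def walk_def)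
  show "y \<in> D" if "x \<in> D" "adj x y" "y \<in> V - bag (contacts p m D)" for x y
    using that w(1) unfolding bag_def nbr_def by blast
qed

text \<open>\<open>z\<close> is the boundary vertex promised by \<open>walk\<close>, or any vertex
  of \<open>D\<close> while the path is empty. Since \<open>z\<close> dominates some vertex of
  \<open>D\<close>, the components left over are strictly smaller; since \<open>bag X\<close>
  separates \<open>D\<close>, they stay inside it.\<close>

lemma walk_next:
  assumes w: "walk p m D"
  obtains z where "z \<in> V"
    "\<And>c. c \<in> D - bag (insert z (contacts p m D)) \<Longrightarrow>
      walk (p(m := z)) (Suc m) (comp (V - bag (insert z (contacts p m D))) c) \<and>
      comp (V - bag (insert z (contacts p m D))) c \<subset> D"
proof -
  define X where "X = contacts p m D"
  note wc = walk_contacts[OF w, folded X_def]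
  have path: "induced_path p m" and conn: "conn D" and DV: "D \<subseteq> V"
    and ap: "\<And>i x. i < m \<Longrightarrow> x \<in> D \<Longrightarrow> p i \<noteq> x \<and> \<not> adj (p i) x"
    using w by (auto simp: walk_def)
  have "\<exists>z\<in>V. D \<inter> cnbr {z} \<noteq> {} \<and> (\<forall>i<m. z \<noteq> p i \<and> (adj (p i) z \<longleftrightarrow> Suc i = m))"
  proof (cases "m = 0")
    case True
    have "D \<noteq> {}" using conn by (simp add: conn_def)
    then show ?thesis using True DV by (auto simp: cnbr_def)
  next
    case False
    then obtain z where z: "z \<in> nbr D" "\<forall>i<m. adj (p i) z \<longleftrightarrow> Suc i = m" using w by (auto simp: walk_def)
    then obtain d where d: "d \<in> D" "adj d z" by (auto simp: nbr_def)
    have "z \<in> V" using d adj_sym adj_in_V by blast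
    moreover have "d \<in> D \<inter> cnbr {z}" using d adj_sym by (auto simp: cnbr_def)
    moreover have "z \<noteq> p i" if "i < m" for i using ap[OF that d(1)] d(2) adj_sym by blast
    ultimately show ?thesis using z(2) by blast
  qed
  then obtain z where z: "z \<in> V" "D \<inter> cnbr {z} \<noteq> {}" "\<And>i. i < m \<Longrightarrow> z \<noteq> p i \<and> (adj (p i) z \<longleftrightarrow> Suc i = m)"
    by blast
  define B where "B = bag (insert z X)"
  have BX: "bag X \<subseteq> B" by (auto simp: B_def bag_def cnbr_def)
  have path': "induced_path (p(m := z)) (Suc m)"
    unfolding induced_path_def
  proof (intro conjI allI impI)
    show "(p(m := z)) ` {..<Suc m} \<subseteq> V" using path z(1) by (auto simp: induced_path_def less_Suc_eq)
    fix i j assume ij: "i < Suc m" "j < Suc m"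
    have old: "(p i = p j \<longleftrightarrow> i = j) \<and> (adj (p i) (p j) \<longleftrightarrow> i = Suc j \<or> j = Suc i)" if "i < m" "j < m"
      using path that unfolding induced_path_def by blast
    have "((p(m := z)) i = (p(m := z)) j \<longleftrightarrow> i = j) \<and>
        (adj ((p(m := z)) i) ((p(m := z)) j) \<longleftrightarrow> i = Suc j \<or> j = Suc i)"
    proof (cases "i = m"; cases "j = m")
      assume "i = m" "j \<noteq> m"
      then show ?thesis using ij z(3)[of j] adj_commute[of z "p j"] by auto
    next
      assume "i \<noteq> m" "j = m"
      then show ?thesis using ij z(3)[of i] by auto
    qed (use ij old adj_irrefl in auto)
    then show "(p(m := z)) i = (p(m := z)) j \<longleftrightarrow> i = j"
      "adj ((p(m := z)) i) ((p(m := z)) j) \<longleftrightarrow> i = Suc j \<or> j = Suc i" by blast+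
  qed
  have "walk (p(m := z)) (Suc m) (comp (V - B) c) \<and> comp (V - B) c \<subset> D" if c: "c \<in> D - B" for c
  proof -
    define D' where "D' = comp (V - B) c"
    have cV: "c \<in> V - B" using c DV by auto
    have D'VB: "D' \<subseteq> V - B" unfolding D'_def by (rule comp_subset)
    have D'D: "D' \<subseteq> D"
    proof -
      have "D' \<subseteq> comp (V - bag X) c"
        using BX reach_mono[of "V - B" c _ "V - bag X"] unfolding D'_def comp_def by auto
      then show ?thesis using walk_comp[OF w, of c] c by (simp add: X_def)
    qed
    have neq: "D' \<noteq> D"
    proof -
      obtain d where d: "d \<in> D" "d \<in> cnbr {z}" using z(2) by blast
      then have "d \<in> B" using DV by (auto simp: B_def bag_def cnbr_def)
      then show ?thesis using d D'VB by auto
    qed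
    have conn': "conn D'" unfolding D'_def by (rule comp_conn[OF cV])
    have cl: "y \<in> B" if "x \<in> D'" "adj x y" "y \<notin> D'" for x y
      using that comp_closed[of x "V - B" c y] adj_in_V adj_sym unfolding D'_def by blast
    have ap': "(p(m := z)) i \<noteq> x \<and> \<not> adj ((p(m := z)) i) x" if "i < Suc m" "x \<in> D'" for i x
    proof (cases "i = m")
      case True
      have "x \<notin> cnbr {z}" using D'VB that by (auto simp: B_def bag_def cnbr_def)
      then show ?thesis using True by (auto simp: cnbr_def)
    next
      case False
      then show ?thesis using ap[of i x] that D'D by auto
    qed
    have img: "insert z X \<subseteq> (p(m := z)) ` {..<Suc m}"
    proof
      fix y assume "y \<in> insert z X"
      then show "y \<in> (p(m := z)) ` {..<Suc m}"
      proof
        assume "y = z"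
        then show ?thesis by (auto intro: image_eqI[of _ _ m])
      next
        assume "y \<in> X"
        then obtain i where "i < m" "y = p i" by (auto simp: X_def contacts_def)
        then show ?thesis by (auto intro: image_eqI[of _ _ i])
      qed
    qed
    have nb: "nbr D' \<subseteq> cnbr ((p(m := z)) ` {..<Suc m})"
    proof
      fix y assume "y \<in> nbr D'"
      then have "y \<in> B" using cl by (auto simp: nbr_def)
      then show "y \<in> cnbr ((p(m := z)) ` {..<Suc m})"
        using img unfolding B_def bag_def cnbr_def by blast
    qed
    \<comment> \<open>An edge leaving \<open>D'\<close> inside \<open>D\<close> ends in a vertex
      \<open>b\<close> that was removed because of \<open>z\<close> alone, as \<open>D\<close>
      avoids \<open>cnbr X\<close>. So \<open>b\<close> sees no older path vertex and can prolong
      the path next.\<close>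
    obtain a b where ab: "a \<in> D'" "b \<in> D - D'" "adj a b"
      using conn_leave[OF conn D'D] neq conn' by (auto simp: conn_def)
    have bB: "b \<in> B" using cl ab by auto
    have "b \<notin> cnbr X" using ab wc(2) by auto
    then have "b = z \<or> adj z b" using bB by (auto simp: B_def bag_def cnbr_def)
    moreover have "b \<noteq> z" using ap'[of m a] ab adj_sym by auto
    ultimately have zb: "adj z b" by auto
    have "b \<in> nbr D' \<and> (\<forall>i<Suc m. adj ((p(m := z)) i) b \<longleftrightarrow> Suc i = Suc m)"
      using ab zb ap[of _ b] by (auto simp: nbr_def less_Suc_eq)
    then have "walk (p(m := z)) (Suc m) D'"
      using path' conn' D'VB ap' nb unfolding walk_def by blast
    then show ?thesis using D'D neq unfolding D'_def by blast
  qed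
  with z(1) that[of z] show ?thesis unfolding B_def X_def by blast
qed

text \<open>The pairs form an induced matching whose first ends lie in \<open>cnbr X\<close>, hence
  \<open>card X\<close> times \<open>13 * t * t\<close> bounds their number. Padding with
  \<open>none\<close>, which is adjacent to nothing, makes all codes equally long.\<close>

lemma trace_code:
  assumes "X \<subseteq> V" "card X \<le> Suc (3 * t)"
  obtains M where "length M = Suc (3 * t) * (13 * t * t)"
    "set M \<subseteq> insert none V \<times> insert none V" "is_trace (bag X) M (I \<inter> bag X)"
proof -
  define B where "B = bag X"
  have BV: "B \<subseteq> V" by (auto simp: B_def bag_def)
  obtain M where M: "set M \<subseteq> (B \<inter> V) \<times> V" "matching_list M"
    "\<And>w. w \<in> B \<inter> V \<Longrightarrow> w \<in> I \<longleftrightarrow> kept B M w \<and> (\<forall>w'\<in>I \<inter> B \<inter> V. w' < w \<longrightarrow> \<not> adj w' w)"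
    using trace_exists[OF finite_V, of I B] I_indep I_max unfolding indep_in_def by blast
  have b: "fst (M ! i) \<in> cnbr X" if "i < length M" for i
    using M(1) nth_mem[OF that] by (cases "M ! i") (auto simp: B_def bag_def)
  have "card {..<length M} \<le> card X * (13 * t * t)"
    by (rule touch_bound[OF deg assms(1) _ matching_list_indm[OF M(2)]]) (use b in auto)
  also have "\<dots> \<le> Suc (3 * t) * (13 * t * t)" by (rule mult_le_mono1[OF assms(2)])
  finally have len: "length M \<le> Suc (3 * t) * (13 * t * t)" by simp
  define M' where "M' = M @ replicate (Suc (3 * t) * (13 * t * t) - length M) (none, none)"
  have "kept B M' w \<longleftrightarrow> kept B M w" for w
    using none_notin adj_in_V unfolding kept_def M'_def by (auto simp: set_replicate_conv_if)
  moreover have "I \<inter> B \<inter> V = I \<inter> B" using BV by auto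
  ultimately have "is_trace B M' (I \<inter> B)" using M(3) BV unfolding is_trace_def by auto
  moreover have "set M' \<subseteq> insert none V \<times> insert none V"
    using M(1) by (auto simp: M'_def set_replicate_conv_if)
  moreover have "length M' = Suc (3 * t) * (13 * t * t)" using len by (simp add: M'_def)
  ultimately show ?thesis using that by (simp add: B_def)
qed

definition valid_code :: "code \<Rightarrow> bool" where
  "valid_code = (\<lambda>(X, p, c, M). length X = 3 * t \<and> set X \<subseteq> insert none V \<and> p \<in> insert none V \<and>
     (case c of None \<Rightarrow> True | Some c \<Rightarrow> c \<in> V) \<and> length M = Suc (3 * t) * (13 * t * t) \<and>
     set M \<subseteq> insert none V \<times> insert none V)"

lemma separator_code:
  assumes "X \<subseteq> V" "card X \<le> 3 * t"
  obtains xs where "length xs = 3 * t" "set xs \<subseteq> insert none V" "X \<subseteq> set xs" "set xs \<subseteq> insert none X"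
proof -
  define xs where "xs = sorted_list_of_set X @ replicate (3 * t - card X) none"
  have "finite X" using assms(1) finite_V finite_subset by blast
  then have "X \<subseteq> set xs" "length xs = 3 * t" using assms(2) by (auto simp: xs_def)
  moreover have "set xs \<subseteq> insert none X" using \<open>finite X\<close> by (auto simp: xs_def)
  ultimately show ?thesis using that[of xs] assms(1) by blast
qed

lemma bag_none:
  assumes "X \<subseteq> Y" "Y \<subseteq> insert none X"
  shows "bag Y = bag X"
proof -
  have "cnbr Y \<inter> V \<subseteq> cnbr X"
    using assms(2) none_notin adj_in_V unfolding cnbr_def by blast
  moreover have "cnbr X \<subseteq> cnbr Y" using assms(1) unfolding cnbr_def by blast
  ultimately show ?thesis unfolding bag_def by blast
qed

text \<open>The code consists of the padded contacts, the next path vertex, any vertex of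
  \<open>D\<close> and the pairs for the trace of \<open>I\<close>. Each new component carries a
  walk with a listed set at least as large as its part of \<open>I\<close>, so \<open>best\<close>
  finds one no smaller.\<close>

lemma walk_round:
  assumes w: "walk p m D" and L: "\<And>p' m' D'. walk p' m' D' \<Longrightarrow> card D' < card D \<Longrightarrow>
      \<exists>U\<in>set L. U \<subseteq> D' \<inter> away (I \<inter> cnbr (contacts p' m' D')) \<and> card (I \<inter> D') \<le> card U"
  shows "\<exists>g. valid_code g \<and> (\<forall>L'. set L \<subseteq> set L' \<longrightarrow>
      step L' g \<subseteq> D \<inter> away (I \<inter> cnbr (contacts p m D)) \<and> card (I \<inter> D) \<le> card (step L' g))"
proof -
  define X where "X = contacts p m D"
  note wc = walk_contacts[OF w, folded X_def]
  have DV: "D \<subseteq> V" using w by (auto simp: walk_def)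
  then have finD: "finite D" using finite_V finite_subset by blast
  have IV: "I \<subseteq> V" and II: "\<And>x y. x \<in> I \<Longrightarrow> y \<in> I \<Longrightarrow> \<not> adj x y" using I_indep by (auto simp: indep_in_def)
  obtain z where z: "z \<in> V" "\<And>c. c \<in> D - bag (insert z X) \<Longrightarrow>
      walk (p(m := z)) (Suc m) (comp (V - bag (insert z X)) c) \<and> comp (V - bag (insert z X)) c \<subset> D"
    using walk_next[OF w] unfolding X_def by blast
  obtain c where c: "c \<in> D" using w by (auto simp: walk_def conn_def)
  obtain xs where xs: "length xs = 3 * t" "set xs \<subseteq> insert none V" "X \<subseteq> set xs" "set xs \<subseteq> insert none X"
    using separator_code[OF wc(3,4)] by blast
  have "finite X" using wc(3) finite_V finite_subset by blast
  then have "card (insert z X) \<le> Suc (3 * t)" using wc(4) by (simp add: card_insert_if)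
  then obtain M where M: "length M = Suc (3 * t) * (13 * t * t)" "set M \<subseteq> insert none V \<times> insert none V"
    "is_trace (bag (insert z X)) M (I \<inter> bag (insert z X))"
    using trace_code[of "insert z X"] wc(3) z(1) by auto
  define B where "B = bag (insert z X)"
  have bagxs: "bag (set xs) = bag X" "bag (insert z (set xs)) = B"
    using bag_none[of X "set xs"] bag_none[of "insert z X" "insert z (set xs)"] xs unfolding B_def by auto
  define g where "g = (xs, z, Some c, M)"
  have "valid_code g" using xs M z(1) c DV by (auto simp: g_def valid_code_def)
  moreover have "step L' g \<subseteq> D \<inter> away (I \<inter> cnbr X) \<and> card (I \<inter> D) \<le> card (step L' g)"
    if LL: "set L \<subseteq> set L'" for L'
  proof -
    define W where "W = D \<inter> away (I \<inter> B \<inter> bag X)"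
    define f where "f D' = best L' (D' \<inter> away (I \<inter> B))" for D'
    have XB: "bag X \<subseteq> B" by (auto simp: B_def bag_def cnbr_def)
    have reg: "region (set xs) (Some c) = D"
      using walk_comp[OF w c] by (simp add: region_def bagxs X_def)
    have "step L' g = assemble L' (set xs) z (Some c) (I \<inter> B)"
      unfolding g_def by (rule step_eq) (use M(3) in \<open>simp add: bagxs(2) B_def\<close>)
    also have "\<dots> = (I \<inter> B \<inter> W) \<union> (\<Union>c'\<in>W - B. f (comp (V - B) c'))"
      unfolding assemble_def by (simp only: reg bagxs Let_def W_def f_def)
    finally have U: "step L' g = (I \<inter> B \<inter> W) \<union> (\<Union>c'\<in>W - B. f (comp (V - B) c'))" .
    have WX: "W = D \<inter> away (I \<inter> cnbr X)"
      using XB IV by (auto simp: W_def away_def bag_def)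
    have IW: "I \<inter> D \<subseteq> W" using II by (auto simp: W_def away_def)
    have fs: "f D' \<subseteq> D' \<inter> away (I \<inter> B)" for D' unfolding f_def by (rule best_subset)
    have sub: "step L' g \<subseteq> W"
    proof -
      have "f (comp (V - B) c') \<subseteq> W" if "c' \<in> W - B" for c'
      proof -
        have "comp (V - B) c' \<subseteq> D" using z(2)[of c'] that by (auto simp: W_def B_def)
        then show ?thesis using fs[of "comp (V - B) c'"] by (auto simp: W_def away_def)
      qed
      then show ?thesis unfolding U by blast
    qed
    have "card (I \<inter> D) \<le> card (step L' g)"
    proof (rule card_assemble[OF IV DV, where B = B and f = f])
      show "comp (V - B) c' \<subseteq> D" if "c' \<in> D - B" for c' using z(2)[of c'] that by (auto simp: B_def)
      show "finite (step L' g)" using sub finD finite_subset by (auto simp: W_def)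
      show "I \<inter> D \<inter> B \<subseteq> step L' g" using IW unfolding U by blast
      show "f (comp (V - B) c') \<subseteq> step L' g" if "c' \<in> I \<inter> D - B" for c'
        using IW that unfolding U by blast
      fix c' assume c': "c' \<in> I \<inter> D - B"
      define D' where "D' = comp (V - B) c'"
      have D': "walk (p(m := z)) (Suc m) D'" "D' \<subset> D"
        using z(2)[of c'] c' unfolding D'_def B_def by auto
      have "card D' < card D" using D'(2) finD by (rule psubset_card_mono[rotated])
      then obtain U' where U': "U' \<in> set L" "card (I \<inter> D') \<le> card U'"
        "U' \<subseteq> D' \<inter> away (I \<inter> cnbr (contacts (p(m := z)) (Suc m) D'))"
        using L[OF D'(1)] by blast
      \<comment> \<open>Here old separator vertices are forgotten: a vertex of \<open>I\<close> in
        \<open>B\<close> next to \<open>D'\<close> lies on the boundary of \<open>D'\<close>, which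
        the new contacts dominate, so avoiding the trace near these contacts is enough.\<close>
      have "U' \<subseteq> D' \<inter> away (I \<inter> B)"
      proof -
        have "\<not> adj u v" if "v \<in> U'" "u \<in> I \<inter> B" for u v
        proof
          assume a: "adj u v"
          have v: "v \<in> D'" using U'(3) that by auto
          have "u \<notin> D'" using that comp_subset[of "V - B" c'] by (auto simp: D'_def)
          then have "u \<in> nbr D'" using v a adj_sym by (auto simp: nbr_def)
          then have "u \<in> cnbr (contacts (p(m := z)) (Suc m) D')" using walk_contacts(1)[OF D'(1)] by blast
          then show False using U'(3) that a by (auto simp: away_def)
        qed
        then show ?thesis using U'(3) by (auto simp: away_def)
      qed
      then have "card U' \<le> card (f D')" unfolding f_def using U'(1) LL by (intro best_max) auto
      then show "card (I \<inter> comp (V - B) c') \<le> card (f (comp (V - B) c')) \<and>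
          f (comp (V - B) c') \<subseteq> comp (V - B) c'"
        using U'(2) fs[of D'] unfolding D'_def by auto
    qed
    then show ?thesis using sub WX by simp
  qed
  ultimately show ?thesis unfolding X_def by blast
qed

definition rounds :: "code list \<Rightarrow> nat \<Rightarrow> nat set list" where
  "rounds cs r = run [] (concat (replicate r cs))"

lemma rounds_Suc: "rounds cs (Suc r) = run (rounds cs r) cs"
proof -
  have "concat (replicate (Suc r) cs) = concat (replicate r cs) @ cs"
    by (induction r) simp_all
  then show ?thesis by (simp add: rounds_def del: replicate_Suc)
qed

text \<open>Components shrink strictly along a walk, so \<open>r\<close> passes reach every
  component of at most \<open>r\<close> vertices, whatever the order of the codes within a
  pass.\<close>

lemma rounds_walk:
  assumes cs: "\<And>g. valid_code g \<Longrightarrow> g \<in> set cs"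
  shows "walk p m D \<Longrightarrow> card D \<le> r \<Longrightarrow>
    \<exists>U\<in>set (rounds cs r). U \<subseteq> D \<inter> away (I \<inter> cnbr (contacts p m D)) \<and> card (I \<inter> D) \<le> card U"
proof (induction r arbitrary: p m D)
  case 0
  have "finite D" using 0 finite_V finite_subset by (auto simp: walk_def)
  then show ?case using 0 by (auto simp: walk_def conn_def)
next
  case (Suc r)
  have "\<exists>U\<in>set (rounds cs r). U \<subseteq> D' \<inter> away (I \<inter> cnbr (contacts p' m' D')) \<and> card (I \<inter> D') \<le> card U"
    if "walk p' m' D'" "card D' < card D" for p' m' D'
    using Suc.IH[OF that(1)] that(2) Suc.prems(2) by simp
  from walk_round[OF Suc.prems(1) this] obtain g where g: "valid_code g"
    "\<And>L'. set (rounds cs r) \<subseteq> set L' \<Longrightarrow> step L' g \<subseteq> D \<inter> away (I \<inter> cnbr (contacts p m D)) \<and>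
      card (I \<inter> D) \<le> card (step L' g)"
    by blast
  obtain L' where "set (rounds cs r) \<subseteq> set L'" "step L' g \<in> set (rounds cs (Suc r))"
    unfolding rounds_Suc using run_step[OF cs[OF g(1)], of "rounds cs r"] by blast
  then show ?case using g(2) by blast
qed

text \<open>After \<open>r\<close> passes every component of the graph has been served, starting
  from the empty path. One more pass contains the code with only padding, whose bag is empty; its
  step joins the best sets of all components.\<close>

theorem rounds_complete:
  assumes cs: "\<And>g. valid_code g \<Longrightarrow> g \<in> set cs" and r: "card V \<le> r"
  shows "card I \<le> card (best (rounds cs (Suc r)) V)"
proof -
  have IV: "I \<subseteq> V" using I_indep by (simp add: indep_in_def)
  define xs where "xs = replicate (3 * t) none"
  define M where "M = replicate (Suc (3 * t) * (13 * t * t)) (none, none)"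
  define g where "g = (xs, none, None :: nat option, M)"
  have "valid_code g" by (auto simp: g_def xs_def M_def valid_code_def set_replicate_conv_if)
  then obtain L where L: "set (rounds cs r) \<subseteq> set L" "step L g \<in> set (rounds cs (Suc r))"
    unfolding rounds_Suc using run_step[OF cs, of g "rounds cs r"] by blast
  have bag: "bag (set xs) = {}" "bag (insert none (set xs)) = {}"
    using bag_none[of "{}" "set xs"] bag_none[of "{}" "insert none (set xs)"]
    by (auto simp: xs_def bag_def cnbr_def set_replicate_conv_if)
  have "step L g = assemble L (set xs) none None {}"
    unfolding g_def by (rule step_eq) (simp add: bag is_trace_def)
  also have "\<dots> = (\<Union>c'\<in>V. best L (comp V c'))"
    by (simp add: assemble_def bag region_def away_def)
  finally have U: "step L g = (\<Union>c'\<in>V. best L (comp V c'))" .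
  have UV: "step L g \<subseteq> V"
    unfolding U using best_subset[of L] comp_subset[of V] by blast
  have "card (I \<inter> V) \<le> card (step L g)"
  proof (rule card_assemble[OF IV, where B = "{}" and f = "best L"])
    show "V \<subseteq> V" "\<And>c. c \<in> V - {} \<Longrightarrow> comp (V - {}) c \<subseteq> V" using comp_subset by auto
    show "finite (step L g)" using UV finite_V finite_subset by blast
    show "I \<inter> V \<inter> {} \<subseteq> step L g" "\<And>c. c \<in> I \<inter> V - {} \<Longrightarrow> best L (comp (V - {}) c) \<subseteq> step L g"
      unfolding U by auto
    fix c assume c: "c \<in> I \<inter> V - {}"
    define D where "D = comp V c"
    have D: "conn D" "D \<subseteq> V" using c comp_conn comp_subset by (auto simp: D_def)
    have "nbr D = {}"
      using comp_closed[of _ V c] adj_in_V adj_sym unfolding nbr_def D_def by blast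
    then have "walk id 0 D" using D by (auto simp: walk_def induced_path_def)
    moreover have "card D \<le> r" using r card_mono[OF finite_V D(2)] by simp
    ultimately obtain U where "U \<in> set (rounds cs r)" "U \<subseteq> D" "card (I \<inter> D) \<le> card U"
      using rounds_walk[OF cs] by blast
    moreover from this have "card U \<le> card (best L D)" using L(1) by (intro best_max) auto
    ultimately show "card (I \<inter> comp (V - {}) c) \<le> card (best L (comp (V - {}) c)) \<and>
        best L (comp (V - {}) c) \<subseteq> comp (V - {}) c"
      using best_subset[of L D] by (simp add: D_def)
  qed
  moreover have "I \<inter> V = I" using IV by auto
  ultimately show ?thesis using best_max[OF L(2) UV] by simp
qed

end

section \<open>A total loop language with a cost-bounded compiler\<close>

section \<open>A loop language compiled to random access machines\<close>

declare One_nat_def [simp del]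

datatype var = G nat | L nat

datatype arr = Raw | AL | S0 | BX | BB | SS | MM | WW | UU | M2 | TT | BST | LL

text \<open>Bounded sums replace multiplication, counting and existential quantifiers. As loops are
  bounded too, every program terminates and its cost can be read off its text.\<close>

datatype ex = V var | C nat | Plus ex ex | Minus ex ex | Rd arr ex | Ite ex ex ex | Sm var ex

datatype com = Nop | Set var ex | Wr arr ex ex | Sq com com | If ex com com | For var com

type_synonym st = "(var \<Rightarrow> nat) \<times> (arr \<Rightarrow> nat \<Rightarrow> nat)"

text \<open>Sums and loops range over \<open>0, \<dots>, n\<close>; the array \<open>Raw\<close> is the input area and has \<open>n\<^sup>2\<close> cells.\<close>

fun ev :: "nat \<Rightarrow> (arr \<Rightarrow> nat \<Rightarrow> nat) \<Rightarrow> (var \<Rightarrow> nat) \<Rightarrow> ex \<Rightarrow> nat" where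
  "ev n \<mu> \<rho> (V x) = \<rho> x"
| "ev n \<mu> \<rho> (C c) = c"
| "ev n \<mu> \<rho> (Plus a b) = ev n \<mu> \<rho> a + ev n \<mu> \<rho> b"
| "ev n \<mu> \<rho> (Minus a b) = ev n \<mu> \<rho> a - ev n \<mu> \<rho> b"
| "ev n \<mu> \<rho> (Rd a e) = \<mu> a (ev n \<mu> \<rho> e)"
| "ev n \<mu> \<rho> (Ite c a b) = (if ev n \<mu> \<rho> c \<noteq> 0 then ev n \<mu> \<rho> a else ev n \<mu> \<rho> b)"
| "ev n \<mu> \<rho> (Sm x e) = (\<Sum>i<Suc n. ev n \<mu> (\<rho>(x := i)) e)"

text \<open>A write to \<open>Raw\<close> behind the input area is dropped, because those cells
  belong to the other arrays.\<close>

fun sem :: "nat \<Rightarrow> com \<Rightarrow> st \<Rightarrow> st" where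
  "sem n Nop \<sigma> = \<sigma>"
| "sem n (Set x e) \<sigma> = ((fst \<sigma>)(x := ev n (snd \<sigma>) (fst \<sigma>) e), snd \<sigma>)"
| "sem n (Wr a e1 e2) \<sigma> =
     (if a = Raw \<and> n * n \<le> ev n (snd \<sigma>) (fst \<sigma>) e1 then \<sigma>
      else (fst \<sigma>, (snd \<sigma>)(a := (snd \<sigma> a)(ev n (snd \<sigma>) (fst \<sigma>) e1 := ev n (snd \<sigma>) (fst \<sigma>) e2))))"
| "sem n (Sq c d) \<sigma> = sem n d (sem n c \<sigma>)"
| "sem n (If e c d) \<sigma> = (if ev n (snd \<sigma>) (fst \<sigma>) e \<noteq> 0 then sem n c \<sigma> else sem n d \<sigma>)"
| "sem n (For x c) \<sigma> = foldl (\<lambda>\<sigma> i. sem n c ((fst \<sigma>)(x := i), snd \<sigma>)) \<sigma> [0..<Suc n]"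

subsection \<open>Compilation\<close>

text \<open>Registers 0, 1 and 2 hold \<open>n\<close>, \<open>n + 1\<close> and
  \<open>n * n\<close>; variables occupy the odd registers from 3 on, temporaries the even ones from
  4 on.\<close>

fun vreg :: "var \<Rightarrow> reg" where
  "vreg (G i) = 4 * i + 3"
| "vreg (L i) = 4 * i + 5"

definition treg :: "nat \<Rightarrow> reg" where
  "treg d = 2 * d + 4"

fun acode :: "arr \<Rightarrow> nat" where
  "acode Raw = 0" | "acode AL = 1" | "acode S0 = 2" | "acode BX = 3" | "acode BB = 4" | "acode SS = 5"
| "acode MM = 6" | "acode WW = 7" | "acode UU = 8" | "acode M2 = 9" | "acode TT = 10" | "acode BST = 11"
| "acode LL = 12"

lemma vreg_inject [simp]: "vreg x = vreg y \<longleftrightarrow> x = y"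
  by (cases x; cases y) (simp_all, presburger+)

lemma treg_inject [simp]: "treg d = treg e \<longleftrightarrow> d = e"
  by (simp add: treg_def)

lemma vreg_treg [simp]: "vreg x \<noteq> treg d" "treg d \<noteq> vreg x"
  by (cases x; simp add: treg_def; presburger)+

lemma vreg_low [simp]: "vreg x \<noteq> 0" "vreg x \<noteq> 1" "vreg x \<noteq> 2" "0 \<noteq> vreg x" "1 \<noteq> vreg x" "2 \<noteq> vreg x"
  by (cases x; simp)+

lemma treg_low [simp]: "treg d \<noteq> 0" "treg d \<noteq> 1" "treg d \<noteq> 2" "0 \<noteq> treg d" "1 \<noteq> treg d" "2 \<noteq> treg d"
  by (auto simp: treg_def)

lemma acode_inject: "acode a = acode b \<longleftrightarrow> a = b"
  by (cases a; cases b) simp_all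

lemma acode_less: "acode a < 16"
  by (cases a) simp_all

fun seq :: "prog list \<Rightarrow> prog" where
  "seq [] = Skip"
| "seq (P # Ps) = Seq P (seq Ps)"

text \<open>Four doublings produce the stride 16, as the machine cannot multiply; then the array
  code and the size of the input area are added.\<close>

definition caddr :: "arr \<Rightarrow> nat \<Rightarrow> prog" where
  "caddr a d = seq [Add (treg d) (treg d) (treg d), Add (treg d) (treg d) (treg d),
     Add (treg d) (treg d) (treg d), Add (treg d) (treg d) (treg d),
     Const (treg (d + 1)) (acode a), Add (treg d) (treg d) (treg (d + 1)), Add (treg d) (treg d) 2]"

text \<open>The result is left in \<open>treg d\<close>, and temporaries below \<open>d\<close>
  survive, so nested expressions use the temporaries as a stack. For \<open>Sm\<close>,
  \<open>treg d\<close> saves the old value of \<open>x\<close>, \<open>treg (d + 1)\<close> holds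
  the partial sum, and \<open>treg (d + 2)\<close> serves in turn as summand, as the constant 1 and
  as the number of remaining rounds.\<close>

fun cex :: "ex \<Rightarrow> nat \<Rightarrow> prog" where
  "cex (V x) d = Copy (treg d) (vreg x)"
| "cex (C c) d = Const (treg d) c"
| "cex (Plus a b) d = Seq (cex a d) (Seq (cex b (d + 1)) (Add (treg d) (treg d) (treg (d + 1))))"
| "cex (Minus a b) d = Seq (cex a d) (Seq (cex b (d + 1)) (Sub (treg d) (treg d) (treg (d + 1))))"
| "cex (Rd a e) d = Seq (cex e d) (if a = Raw
     then Seq (Sub (treg (d + 1)) 2 (treg d)) (IfNZ (treg (d + 1)) (Load (treg d) (treg d)) (Const (treg d) 0))
     else Seq (caddr a d) (Load (treg d) (treg d)))"
| "cex (Ite c a b) d = Seq (cex c d) (IfNZ (treg d) (cex a d) (cex b d))"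
| "cex (Sm x e) d = Seq (seq [Copy (treg d) (vreg x), Const (treg (d + 1)) 0, Const (vreg x) 0,
       Sub (treg (d + 2)) 1 (vreg x)])
     (Seq (WhileNZ (treg (d + 2)) (Seq (cex e (d + 2)) (seq [Add (treg (d + 1)) (treg (d + 1)) (treg (d + 2)),
       Const (treg (d + 2)) 1, Add (vreg x) (vreg x) (treg (d + 2)), Sub (treg (d + 2)) 1 (vreg x)])))
     (seq [Copy (vreg x) (treg d), Copy (treg d) (treg (d + 1))]))"

text \<open>The loop counter is kept in \<open>treg d\<close> and copied to \<open>x\<close> in each
  round, so the body may overwrite \<open>x\<close>.\<close>

fun ccom :: "com \<Rightarrow> nat \<Rightarrow> prog" where
  "ccom Nop d = Skip"
| "ccom (Set x e) d = Seq (cex e d) (Copy (vreg x) (treg d))"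
| "ccom (Wr a e1 e2) d = (if a = Raw
     then Seq (cex e1 d) (Seq (cex e2 (d + 1)) (Seq (Sub (treg (d + 2)) 2 (treg d))
       (IfNZ (treg (d + 2)) (Store (treg d) (treg (d + 1))) Skip)))
     else Seq (cex e1 d) (Seq (caddr a d) (Seq (cex e2 (d + 1)) (Store (treg d) (treg (d + 1))))))"
| "ccom (Sq c1 c2) d = Seq (ccom c1 d) (ccom c2 d)"
| "ccom (If e c1 c2) d = Seq (cex e d) (IfNZ (treg d) (ccom c1 d) (ccom c2 d))"
| "ccom (For x c) d = Seq (seq [Const (treg d) 0, Sub (treg (d + 1)) 1 (treg d)])
     (WhileNZ (treg (d + 1)) (Seq (Copy (vreg x) (treg d)) (Seq (ccom c (d + 1)) (seq [Const (treg (d + 1)) 1,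
       Add (treg d) (treg d) (treg (d + 1)), Sub (treg (d + 1)) 1 (treg d)]))))"

fun ecost :: "nat \<Rightarrow> ex \<Rightarrow> nat" where
  "ecost n (V x) = 1"
| "ecost n (C c) = 1"
| "ecost n (Plus a b) = ecost n a + ecost n b + 1"
| "ecost n (Minus a b) = ecost n a + ecost n b + 1"
| "ecost n (Rd a e) = ecost n e + 9"
| "ecost n (Ite c a b) = ecost n c + ecost n a + ecost n b + 1"
| "ecost n (Sm x e) = Suc n * (ecost n e + 6) + 9"

fun ccost :: "nat \<Rightarrow> com \<Rightarrow> nat" where
  "ccost n Nop = 1"
| "ccost n (Set x e) = ecost n e + 1"
| "ccost n (Wr a e1 e2) = ecost n e1 + ecost n e2 + 9"
| "ccost n (Sq c1 c2) = ccost n c1 + ccost n c2"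
| "ccost n (If e c1 c2) = ecost n e + ccost n c1 + ccost n c2 + 1"
| "ccost n (For x c) = Suc n * (ccost n c + 6) + 4"

text \<open>The arrays other than \<open>Raw\<close> are interleaved with stride 16 behind the input area.\<close>

definition represents :: "nat \<Rightarrow> st \<Rightarrow> state \<Rightarrow> bool" where
  "represents n \<sigma> s \<longleftrightarrow> fst s 0 = n \<and> fst s 1 = Suc n \<and> fst s 2 = n * n \<and>
     (\<forall>x. fst s (vreg x) = fst \<sigma> x) \<and>
     (\<forall>a i. a \<noteq> Raw \<longrightarrow> snd s (n * n + 16 * i + acode a) = snd \<sigma> a i) \<and>
     (\<forall>i<n * n. snd s i = snd \<sigma> Raw i) \<and> (\<forall>i\<ge>n * n. snd \<sigma> Raw i = 0)"

text \<open>A total-correctness triple with a time bound; the inequality allows one bound for both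
  branches of a test.\<close>

definition runs :: "prog \<Rightarrow> state \<Rightarrow> nat \<Rightarrow> (state \<Rightarrow> bool) \<Rightarrow> bool" where
  "runs P s T Q \<longleftrightarrow> (\<exists>k s'. exec P s k s' \<and> k \<le> T \<and> Q s')"

lemma runs_conseq: "runs P s T Q \<Longrightarrow> T \<le> T' \<Longrightarrow> (\<And>s'. Q s' \<Longrightarrow> Q' s') \<Longrightarrow> runs P s T' Q'"
  unfolding runs_def by (meson order_trans)

lemma runs_Seq: "runs P s T (\<lambda>s'. runs P' s' T' Q) \<Longrightarrow> runs (Seq P P') s (T + T') Q"
  unfolding runs_def by (meson exec.Seq add_mono)

lemma runs_Skip: "Q s \<Longrightarrow> runs Skip s 1 Q"
  unfolding runs_def by (meson exec.Skip order_refl)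

lemma runs_basic:
  "Q (r(x := c), m) \<Longrightarrow> runs (Const x c) (r, m) 1 Q"
  "Q (r(x := r y), m) \<Longrightarrow> runs (Copy x y) (r, m) 1 Q"
  "Q (r(x := r y + r z), m) \<Longrightarrow> runs (Add x y z) (r, m) 1 Q"
  "Q (r(x := r y - r z), m) \<Longrightarrow> runs (Sub x y z) (r, m) 1 Q"
  "Q (r(x := m (r y)), m) \<Longrightarrow> runs (Load x y) (r, m) 1 Q"
  "Q (r, m(r x := r y)) \<Longrightarrow> runs (Store x y) (r, m) 1 Q"
  unfolding runs_def by (meson exec.intros order_refl)+

lemma runs_If:
  "(fst s x \<noteq> 0 \<Longrightarrow> runs P s T Q) \<Longrightarrow> (fst s x = 0 \<Longrightarrow> runs P' s T' Q) \<Longrightarrow> runs (IfNZ x P P') s (T + T' + 1) Q"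
  unfolding runs_def
proof (cases "fst s x = 0")
  case True
  assume "fst s x = 0 \<Longrightarrow> \<exists>k s'. exec P' s k s' \<and> k \<le> T' \<and> Q s'"
  then obtain k s' where "exec P' s k s'" "k \<le> T'" "Q s'" using True by blast
  then show "\<exists>k s'. exec (IfNZ x P P') s k s' \<and> k \<le> T + T' + 1 \<and> Q s'"
    using exec.IfFalse[OF True, of P' k s' P] by (intro exI[of _ "1 + k"] exI[of _ s']) auto
next
  case False
  assume "fst s x \<noteq> 0 \<Longrightarrow> \<exists>k s'. exec P s k s' \<and> k \<le> T \<and> Q s'"
  then obtain k s' where "exec P s k s'" "k \<le> T" "Q s'" using False by blast
  then show "\<exists>k s'. exec (IfNZ x P P') s k s' \<and> k \<le> T + T' + 1 \<and> Q s'"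
    using exec.IfTrue[OF False, of P k s' P'] by (intro exI[of _ "1 + k"] exI[of _ s']) auto
qed

lemma runs_While:
  assumes "\<And>i s. i < N \<Longrightarrow> Inv i s \<Longrightarrow> fst s x \<noteq> 0 \<and> runs P s T (Inv (Suc i))"
    and "\<And>s. Inv N s \<Longrightarrow> fst s x = 0"
  shows "i \<le> N \<Longrightarrow> Inv i s \<Longrightarrow> runs (WhileNZ x P) s ((N - i) * (T + 1) + 1) (Inv N)"
proof (induction "N - i" arbitrary: i s)
  case 0
  then have "i = N" by simp
  then show ?case
    unfolding runs_def using 0 assms(2) exec.WhileFalse[of s x P] by (intro exI[of _ 1] exI[of _ s]) auto
next
  case (Suc k)
  then have i: "i < N" by simp
  with assms(1) Suc.prems obtain j s' where s': "fst s x \<noteq> 0" "exec P s j s'" "j \<le> T" "Inv (Suc i) s'"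
    unfolding runs_def by blast
  have "k = N - Suc i" using Suc.hyps(2) by simp
  then obtain l s'' where s'': "exec (WhileNZ x P) s' l s''" "l \<le> (N - Suc i) * (T + 1) + 1" "Inv N s''"
    using Suc.hyps(1)[of "Suc i" s'] i s'(4) unfolding runs_def by (meson Suc_leI)
  have "N - i = Suc (N - Suc i)" using i by simp
  then have "1 + j + l \<le> (N - i) * (T + 1) + 1" using s'(3) s''(2) by simp
  then show ?case
    unfolding runs_def using exec.WhileTrue[OF s'(1,2) s''(1)] s''(3) by blast
qed

lemma runs_seq_simps:
  "runs P s T (\<lambda>s'. runs (seq Ps) s' T' Q) \<Longrightarrow> runs (seq (P # Ps)) s (T + T') Q"
  "Q s \<Longrightarrow> runs (seq []) s 1 Q"
  by (simp_all add: runs_Seq runs_Skip)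

lemma represents_treg [simp]: "represents n \<sigma> (r(treg d := v), m) \<longleftrightarrow> represents n \<sigma> (r, m)"
  by (simp add: represents_def)

lemma represents_vreg: "represents n (\<rho>, \<mu>) (r, m) \<Longrightarrow> represents n (\<rho>(x := v), \<mu>) (r(vreg x := v), m)"
  by (auto simp: represents_def)

lemma represents_Store:
  assumes "represents n (\<rho>, \<mu>) (r, m)"
  shows "a \<noteq> Raw \<Longrightarrow> represents n (\<rho>, \<mu>(a := (\<mu> a)(i := v))) (r, m(n * n + 16 * i + acode a := v))"
    and "i < n * n \<Longrightarrow> represents n (\<rho>, \<mu>(Raw := (\<mu> Raw)(i := v))) (r, m(i := v))"
proof -
  have inj: "n * n + 16 * j + acode b = n * n + 16 * i + acode a \<longleftrightarrow> j = i \<and> b = a" for j b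
  proof
    assume "n * n + 16 * j + acode b = n * n + 16 * i + acode a"
    then have "16 * j + acode b = 16 * i + acode a" by simp
    then have "j = i" "acode b = acode a" using acode_less[of a] acode_less[of b] by presburger+
    then show "j = i \<and> b = a" by (simp add: acode_inject)
  qed simp
  show "a \<noteq> Raw \<Longrightarrow> represents n (\<rho>, \<mu>(a := (\<mu> a)(i := v))) (r, m(n * n + 16 * i + acode a := v))"
    using assms unfolding represents_def by (auto simp: inj)
  show "i < n * n \<Longrightarrow> represents n (\<rho>, \<mu>(Raw := (\<mu> Raw)(i := v))) (r, m(i := v))"
    using assms unfolding represents_def by auto
qed

lemma runs_caddr:
  assumes "fst s 2 = n * n"
    "\<And>r. r (treg d) = n * n + 16 * fst s (treg d) + acode a \<Longrightarrow>
       (\<And>x. x \<noteq> treg d \<Longrightarrow> x \<noteq> treg (d + 1) \<Longrightarrow> r x = fst s x) \<Longrightarrow> Q (r, snd s)"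
  shows "runs (caddr a d) s 8 Q"
proof -
  obtain r m where s: "s = (r, m)" by (cases s)
  have "runs (caddr a d) s (1 + (1 + (1 + (1 + (1 + (1 + (1 + 1))))))) Q"
    unfolding caddr_def s
    by (intro runs_seq_simps runs_basic, rule assms(2)[unfolded s, simplified])
      (use assms(1) s in \<open>auto simp: algebra_simps\<close>)
  then show ?thesis by (rule runs_conseq) auto
qed

lemma runs_cex:
  assumes "represents n (\<rho>, \<mu>) (r, m)"
  shows "runs (cex e d) (r, m) (ecost n e) (\<lambda>s. represents n (\<rho>, \<mu>) s \<and> snd s = m \<and>
    fst s (treg d) = ev n \<mu> \<rho> e \<and> (\<forall>d'<d. fst s (treg d') = r (treg d')))"
  using assms
proof (induction e arbitrary: \<rho> r d)
  case (V x)
  then show ?case by (auto intro!: runs_basic simp: represents_def)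
next
  case (C c)
  then show ?case by (auto intro!: runs_basic)
next
  case (Plus a b)
  have "runs (cex (Plus a b) d) (r, m) (ecost n a + (ecost n b + 1)) (\<lambda>s. represents n (\<rho>, \<mu>) s \<and> snd s = m \<and>
    fst s (treg d) = ev n \<mu> \<rho> (Plus a b) \<and> (\<forall>d'<d. fst s (treg d') = r (treg d')))"
    unfolding cex.simps
  proof (intro runs_Seq runs_conseq[OF Plus.IH(1)[OF Plus.prems]] order_refl)
    fix s assume s: "represents n (\<rho>, \<mu>) s \<and> snd s = m \<and> fst s (treg d) = ev n \<mu> \<rho> a \<and>
      (\<forall>d'<d. fst s (treg d') = r (treg d'))"
    obtain r1 where s1: "s = (r1, m)" using s by (cases s) auto
    show "runs (cex b (d + 1)) s (ecost n b) (\<lambda>s. runs (Add (treg d) (treg d) (treg (d + 1))) s 1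
      (\<lambda>s. represents n (\<rho>, \<mu>) s \<and> snd s = m \<and> fst s (treg d) = ev n \<mu> \<rho> (Plus a b) \<and>
        (\<forall>d'<d. fst s (treg d') = r (treg d'))))"
      unfolding s1
    proof (rule runs_conseq[OF Plus.IH(2)[of \<rho> r1 "d + 1"] order_refl])
      show "represents n (\<rho>, \<mu>) (r1, m)" using s s1 by simp
      fix s' assume "represents n (\<rho>, \<mu>) s' \<and> snd s' = m \<and> fst s' (treg (d + 1)) = ev n \<mu> \<rho> b \<and>
        (\<forall>d'<d + 1. fst s' (treg d') = r1 (treg d'))"
      with s s1 show "runs (Add (treg d) (treg d) (treg (d + 1))) s' 1
        (\<lambda>s. represents n (\<rho>, \<mu>) s \<and> snd s = m \<and> fst s (treg d) = ev n \<mu> \<rho> (Plus a b) \<and>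
        (\<forall>d'<d. fst s (treg d') = r (treg d')))"
        by (cases s') (auto intro!: runs_basic)
    qed
  qed
  then show ?case by (rule runs_conseq) auto
next
  case (Minus a b)
  have "runs (cex (Minus a b) d) (r, m) (ecost n a + (ecost n b + 1)) (\<lambda>s. represents n (\<rho>, \<mu>) s \<and> snd s = m \<and>
    fst s (treg d) = ev n \<mu> \<rho> (Minus a b) \<and> (\<forall>d'<d. fst s (treg d') = r (treg d')))"
    unfolding cex.simps
  proof (intro runs_Seq runs_conseq[OF Minus.IH(1)[OF Minus.prems]] order_refl)
    fix s assume s: "represents n (\<rho>, \<mu>) s \<and> snd s = m \<and> fst s (treg d) = ev n \<mu> \<rho> a \<and>
      (\<forall>d'<d. fst s (treg d') = r (treg d'))"
    obtain r1 where s1: "s = (r1, m)" using s by (cases s) auto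
    show "runs (cex b (d + 1)) s (ecost n b) (\<lambda>s. runs (Sub (treg d) (treg d) (treg (d + 1))) s 1
      (\<lambda>s. represents n (\<rho>, \<mu>) s \<and> snd s = m \<and> fst s (treg d) = ev n \<mu> \<rho> (Minus a b) \<and>
        (\<forall>d'<d. fst s (treg d') = r (treg d'))))"
      unfolding s1
    proof (rule runs_conseq[OF Minus.IH(2)[of \<rho> r1 "d + 1"] order_refl])
      show "represents n (\<rho>, \<mu>) (r1, m)" using s s1 by simp
      fix s' assume "represents n (\<rho>, \<mu>) s' \<and> snd s' = m \<and> fst s' (treg (d + 1)) = ev n \<mu> \<rho> b \<and>
        (\<forall>d'<d + 1. fst s' (treg d') = r1 (treg d'))"
      with s s1 show "runs (Sub (treg d) (treg d) (treg (d + 1))) s' 1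
        (\<lambda>s. represents n (\<rho>, \<mu>) s \<and> snd s = m \<and> fst s (treg d) = ev n \<mu> \<rho> (Minus a b) \<and>
        (\<forall>d'<d. fst s (treg d') = r (treg d')))"
        by (cases s') (auto intro!: runs_basic)
    qed
  qed
  then show ?case by (rule runs_conseq) auto
next
  case (Rd a e)
  show ?case
  proof (cases "a = Raw")
    case True
    have "runs (cex (Rd a e) d) (r, m) (ecost n e + (1 + (1 + 1 + 1))) (\<lambda>s. represents n (\<rho>, \<mu>) s \<and> snd s = m \<and>
      fst s (treg d) = ev n \<mu> \<rho> (Rd a e) \<and> (\<forall>d'<d. fst s (treg d') = r (treg d')))"
      unfolding cex.simps if_P[OF True]
    proof (intro runs_Seq runs_conseq[OF Rd.IH[OF Rd.prems]] order_refl)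
      fix s assume s: "represents n (\<rho>, \<mu>) s \<and> snd s = m \<and> fst s (treg d) = ev n \<mu> \<rho> e \<and>
        (\<forall>d'<d. fst s (treg d') = r (treg d'))"
      obtain r1 where s1: "s = (r1, m)" using s by (cases s) auto
      have 2: "r1 2 = n * n" "r1 (treg d) < n * n \<Longrightarrow> m (r1 (treg d)) = \<mu> Raw (r1 (treg d))"
        "n * n \<le> r1 (treg d) \<Longrightarrow> \<mu> Raw (r1 (treg d)) = 0"
        using s s1 by (auto simp: represents_def)
      show "runs (Sub (treg (d + 1)) 2 (treg d)) s 1
        (\<lambda>s. runs (IfNZ (treg (d + 1)) (Load (treg d) (treg d)) (Const (treg d) 0)) s (1 + 1 + 1)
          (\<lambda>s. represents n (\<rho>, \<mu>) s \<and> snd s = m \<and> fst s (treg d) = ev n \<mu> \<rho> (Rd a e) \<and>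
            (\<forall>d'<d. fst s (treg d') = r (treg d'))))"
        unfolding s1 by (intro runs_basic runs_If; use s s1 2 True in auto)
    qed
    then show ?thesis by (rule runs_conseq) auto
  next
    case False
    have "runs (cex (Rd a e) d) (r, m) (ecost n e + (8 + 1)) (\<lambda>s. represents n (\<rho>, \<mu>) s \<and> snd s = m \<and>
      fst s (treg d) = ev n \<mu> \<rho> (Rd a e) \<and> (\<forall>d'<d. fst s (treg d') = r (treg d')))"
      unfolding cex.simps if_not_P[OF False]
    proof (intro runs_Seq runs_conseq[OF Rd.IH[OF Rd.prems]] order_refl)
      fix s assume s: "represents n (\<rho>, \<mu>) s \<and> snd s = m \<and> fst s (treg d) = ev n \<mu> \<rho> e \<and>
        (\<forall>d'<d. fst s (treg d') = r (treg d'))"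
      obtain r1 where s1: "s = (r1, m)" using s by (cases s) auto
      show "runs (caddr a d) s 8 (\<lambda>s. runs (Load (treg d) (treg d)) s 1
          (\<lambda>s. represents n (\<rho>, \<mu>) s \<and> snd s = m \<and> fst s (treg d) = ev n \<mu> \<rho> (Rd a e) \<and>
            (\<forall>d'<d. fst s (treg d') = r (treg d'))))"
      proof (rule runs_caddr)
        show "fst s 2 = n * n" using s by (simp add: represents_def)
        fix r2 assume r2: "r2 (treg d) = n * n + 16 * fst s (treg d) + acode a"
          "\<And>x. x \<noteq> treg d \<Longrightarrow> x \<noteq> treg (d + 1) \<Longrightarrow> r2 x = fst s x"
        have "represents n (\<rho>, \<mu>) (r2, m)" using s r2(2) by (auto simp: represents_def)
        moreover have "m (r2 (treg d)) = \<mu> a (ev n \<mu> \<rho> e)"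
          using s r2(1) False by (auto simp: represents_def)
        moreover have "r2 (treg d') = r (treg d')" if "d' < d" for d' using s r2(2) that by auto
        ultimately show "runs (Load (treg d) (treg d)) (r2, snd s) 1
          (\<lambda>s. represents n (\<rho>, \<mu>) s \<and> snd s = m \<and> fst s (treg d) = ev n \<mu> \<rho> (Rd a e) \<and>
            (\<forall>d'<d. fst s (treg d') = r (treg d')))"
          using s by (intro runs_basic) auto
      qed
    qed
    then show ?thesis by (rule runs_conseq) auto
  qed
next
  case (Ite c a b)
  have "runs (cex (Ite c a b) d) (r, m) (ecost n c + (ecost n a + ecost n b + 1)) (\<lambda>s. represents n (\<rho>, \<mu>) s \<and>
    snd s = m \<and> fst s (treg d) = ev n \<mu> \<rho> (Ite c a b) \<and> (\<forall>d'<d. fst s (treg d') = r (treg d')))"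
    unfolding cex.simps
  proof (intro runs_Seq runs_conseq[OF Ite.IH(1)[OF Ite.prems]] order_refl)
    fix s assume s: "represents n (\<rho>, \<mu>) s \<and> snd s = m \<and> fst s (treg d) = ev n \<mu> \<rho> c \<and>
      (\<forall>d'<d. fst s (treg d') = r (treg d'))"
    obtain r1 where s1: "s = (r1, m)" using s by (cases s) auto
    have r1: "represents n (\<rho>, \<mu>) (r1, m)" using s s1 by simp
    show "runs (IfNZ (treg d) (cex a d) (cex b d)) s (ecost n a + ecost n b + 1)
      (\<lambda>s. represents n (\<rho>, \<mu>) s \<and> snd s = m \<and> fst s (treg d) = ev n \<mu> \<rho> (Ite c a b) \<and>
        (\<forall>d'<d. fst s (treg d') = r (treg d')))"
      unfolding s1
      by (intro runs_If; rule runs_conseq[OF Ite.IH(2)[OF r1, of d] order_refl]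
        runs_conseq[OF Ite.IH(3)[OF r1, of d] order_refl]; use s s1 in auto)
  qed
  then show ?case by (rule runs_conseq) auto
next
  case (Sm x e)
  define Inv where "Inv i s \<longleftrightarrow> represents n (\<rho>(x := i), \<mu>) s \<and> snd s = m \<and> fst s (treg d) = \<rho> x \<and>
    fst s (treg (d + 1)) = (\<Sum>j<i. ev n \<mu> (\<rho>(x := j)) e) \<and> fst s (treg (d + 2)) = Suc n - i \<and>
    (\<forall>d'<d. fst s (treg d') = r (treg d'))" for i s
  let ?B = "Seq (cex e (d + 2)) (seq [Add (treg (d + 1)) (treg (d + 1)) (treg (d + 2)),
       Const (treg (d + 2)) 1, Add (vreg x) (vreg x) (treg (d + 2)), Sub (treg (d + 2)) 1 (vreg x)])"
  have body: "fst s (treg (d + 2)) \<noteq> 0 \<and> runs ?B s (ecost n e + 5) (Inv (Suc i))"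
    if i: "i < Suc n" and inv: "Inv i s" for i s
  proof
    show "fst s (treg (d + 2)) \<noteq> 0" using i inv by (simp add: Inv_def)
    obtain r1 where s1: "s = (r1, m)" using inv by (cases s) (auto simp: Inv_def)
    have rep: "represents n (\<rho>(x := i), \<mu>) (r1, m)" using inv s1 by (simp add: Inv_def)
    have "runs ?B s (ecost n e + (1 + (1 + (1 + (1 + 1))))) (Inv (Suc i))"
      unfolding s1
    proof (intro runs_Seq runs_conseq[OF Sm.IH[OF rep, of "d + 2"] order_refl])
      fix s assume s: "represents n (\<rho>(x := i), \<mu>) s \<and> snd s = m \<and>
        fst s (treg (d + 2)) = ev n \<mu> (\<rho>(x := i)) e \<and> (\<forall>d'<d + 2. fst s (treg d') = r1 (treg d'))"
      obtain r2 where s2: "s = (r2, m)" using s by (cases s) auto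
      have r2: "r2 1 = Suc n" "r2 (vreg x) = i" "r2 (treg d) = \<rho> x"
        "r2 (treg (d + 1)) = (\<Sum>j<i. ev n \<mu> (\<rho>(x := j)) e)" "\<forall>d'<d. r2 (treg d') = r (treg d')"
        using s s2 inv s1 by (auto simp: represents_def Inv_def)
      have "represents n (\<rho>(x := Suc i), \<mu>) (r2(vreg x := Suc i), m)"
        using represents_vreg[of n "\<rho>(x := i)" \<mu> r2 m x "Suc i"] s s2 by simp
      then have rep': "represents n (\<rho>(x := Suc i), \<mu>) (r2(vreg x := Suc i, treg k := v, treg l := w), m)" for k l v w
        by simp
      show "runs (seq [Add (treg (d + 1)) (treg (d + 1)) (treg (d + 2)),
         Const (treg (d + 2)) 1, Add (vreg x) (vreg x) (treg (d + 2)), Sub (treg (d + 2)) 1 (vreg x)]) s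
         (1 + (1 + (1 + (1 + 1)))) (Inv (Suc i))"
        unfolding s2
        apply (intro runs_seq_simps runs_basic)
        using s s2 r2 i rep'[of "d + 1" _ "d + 2"]
        by (auto simp: Inv_def fun_upd_twist fun_upd_def[symmetric] Suc_eq_plus1[symmetric])
    qed
    then show "runs ?B s (ecost n e + 5) (Inv (Suc i))" by (rule runs_conseq) auto
  qed
  have fin: "fst s (treg (d + 2)) = 0" if "Inv (Suc n) s" for s using that by (simp add: Inv_def)
  have loop: "runs (WhileNZ (treg (d + 2)) ?B) s0 (Suc n * ((ecost n e + 5) + 1) + 1) (Inv (Suc n))"
    if "Inv 0 s0" for s0
    using runs_While[of "Suc n" Inv "treg (d + 2)" ?B "ecost n e + 5" 0 s0] body fin that by simp
  have "runs (cex (Sm x e) d) (r, m) ((1 + (1 + (1 + (1 + 1)))) +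
      ((Suc n * ((ecost n e + 5) + 1) + 1) + (1 + (1 + 1)))) (\<lambda>s. represents n (\<rho>, \<mu>) s \<and> snd s = m \<and>
    fst s (treg d) = ev n \<mu> \<rho> (Sm x e) \<and> (\<forall>d'<d. fst s (treg d') = r (treg d')))"
    unfolding cex.simps
  proof (rule runs_Seq, intro runs_seq_simps runs_basic, intro runs_Seq runs_conseq[OF loop order_refl])
    have "represents n (\<rho>(x := 0), \<mu>) (r(vreg x := 0), m)"
      using represents_vreg[OF Sm.prems, of x 0] .
    then show "Inv 0 (((r(treg d := r (vreg x)))(treg (d + 1) := 0, vreg x := 0))
        (treg (d + 2) := ((r(treg d := r (vreg x)))(treg (d + 1) := 0, vreg x := 0)) 1 -
         ((r(treg d := r (vreg x)))(treg (d + 1) := 0, vreg x := 0)) (vreg x)), m)"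
      using Sm.prems by (auto simp: Inv_def represents_def)
    fix s assume s: "Inv (Suc n) s"
    obtain r1 where s1: "s = (r1, m)" using s by (cases s) (auto simp: Inv_def)
    have "represents n (\<rho>, \<mu>) (r1(vreg x := \<rho> x), m)"
      using s s1 represents_vreg[of n "\<rho>(x := Suc n)" \<mu> r1 m x "\<rho> x"] by (simp add: Inv_def)
    then show "runs (seq [Copy (vreg x) (treg d), Copy (treg d) (treg (d + 1))]) s (1 + (1 + 1))
      (\<lambda>s. represents n (\<rho>, \<mu>) s \<and> snd s = m \<and> fst s (treg d) = ev n \<mu> \<rho> (Sm x e) \<and>
        (\<forall>d'<d. fst s (treg d') = r (treg d')))"
      unfolding s1 using s s1
      by (intro runs_seq_simps runs_basic) (auto simp: Inv_def)
  qed
  then show ?case by (rule runs_conseq) auto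
qed

lemma runs_ccom:
  assumes "represents n \<sigma> s"
  shows "runs (ccom c d) s (ccost n c) (\<lambda>s'. represents n (sem n c \<sigma>) s' \<and>
    (\<forall>d'<d. fst s' (treg d') = fst s (treg d')))"
  using assms
proof (induction c arbitrary: \<sigma> s d)
  case Nop
  then show ?case by (auto intro: runs_Skip)
next
  case (Set x e)
  obtain \<rho> \<mu> r m where eq: "\<sigma> = (\<rho>, \<mu>)" "s = (r, m)" by (cases \<sigma>; cases s)
  have rep: "represents n (\<rho>, \<mu>) (r, m)" using Set eq by simp
  show ?case
    unfolding ccom.simps ccost.simps eq
  proof (intro runs_Seq runs_conseq[OF runs_cex[OF rep] order_refl])
    fix s assume s: "represents n (\<rho>, \<mu>) s \<and> snd s = m \<and> fst s (treg d) = ev n \<mu> \<rho> e \<and>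
      (\<forall>d'<d. fst s (treg d') = r (treg d'))"
    then show "runs (Copy (vreg x) (treg d)) s 1 (\<lambda>s'. represents n (sem n (Set x e) (\<rho>, \<mu>)) s' \<and>
      (\<forall>d'<d. fst s' (treg d') = fst (r, m) (treg d')))"
      by (cases s) (auto intro!: runs_basic represents_vreg)
  qed
next
  case (Wr a e1 e2)
  obtain \<rho> \<mu> r m where eq: "\<sigma> = (\<rho>, \<mu>)" "s = (r, m)" by (cases \<sigma>; cases s)
  have rep: "represents n (\<rho>, \<mu>) (r, m)" using Wr eq by simp
  let ?Q = "\<lambda>s'. represents n (sem n (Wr a e1 e2) (\<rho>, \<mu>)) s' \<and> (\<forall>d'<d. fst s' (treg d') = fst (r, m) (treg d'))"
  show ?case
  proof (cases "a = Raw")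
    case True
    have "runs (ccom (Wr a e1 e2) d) s (ecost n e1 + (ecost n e2 + (1 + (1 + 1 + 1)))) ?Q"
      unfolding ccom.simps if_P[OF True] eq
    proof (intro runs_Seq runs_conseq[OF runs_cex[OF rep] order_refl])
      fix s assume s: "represents n (\<rho>, \<mu>) s \<and> snd s = m \<and> fst s (treg d) = ev n \<mu> \<rho> e1 \<and>
        (\<forall>d'<d. fst s (treg d') = r (treg d'))"
      then obtain r1 where s1: "s = (r1, m)" by (cases s) auto
      have rep1: "represents n (\<rho>, \<mu>) (r1, m)" using s s1 by simp
      show "runs (cex e2 (d + 1)) s (ecost n e2) (\<lambda>s. runs (Seq (Sub (treg (d + 2)) 2 (treg d))
          (IfNZ (treg (d + 2)) (Store (treg d) (treg (d + 1))) Skip)) s (1 + (1 + 1 + 1)) ?Q)"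
        unfolding s1
      proof (rule runs_conseq[OF runs_cex[OF rep1] order_refl])
        fix s' assume s': "represents n (\<rho>, \<mu>) s' \<and> snd s' = m \<and> fst s' (treg (d + 1)) = ev n \<mu> \<rho> e2 \<and>
          (\<forall>d'<d + 1. fst s' (treg d') = r1 (treg d'))"
        then obtain r2 where s2: "s' = (r2, m)" by (cases s') auto
        have r2: "r2 2 = n * n" "r2 (treg d) = ev n \<mu> \<rho> e1" "r2 (treg (d + 1)) = ev n \<mu> \<rho> e2"
          "\<And>d'. d' < d \<Longrightarrow> r2 (treg d') = r (treg d')"
          using s s1 s' s2 by (auto simp: represents_def)
        have rep2: "represents n (\<rho>, \<mu>) (r2, m)" using s' s2 by simp
        show "runs (Seq (Sub (treg (d + 2)) 2 (treg d))
          (IfNZ (treg (d + 2)) (Store (treg d) (treg (d + 1))) Skip)) s' (1 + (1 + 1 + 1)) ?Q"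
          unfolding s2
          by (intro runs_Seq runs_basic runs_If runs_Skip; use r2 rep2 True represents_Store(2)[OF rep2] in auto)
      qed
    qed
    then show ?thesis unfolding eq by (rule runs_conseq) auto
  next
    case False
    have "runs (ccom (Wr a e1 e2) d) s (ecost n e1 + (8 + (ecost n e2 + 1))) ?Q"
      unfolding ccom.simps if_not_P[OF False] eq
    proof (intro runs_Seq runs_conseq[OF runs_cex[OF rep] order_refl])
      fix s assume s: "represents n (\<rho>, \<mu>) s \<and> snd s = m \<and> fst s (treg d) = ev n \<mu> \<rho> e1 \<and>
        (\<forall>d'<d. fst s (treg d') = r (treg d'))"
      show "runs (caddr a d) s 8 (\<lambda>s. runs (Seq (cex e2 (d + 1)) (Store (treg d) (treg (d + 1)))) s
          (ecost n e2 + 1) ?Q)"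
      proof (rule runs_caddr)
        show "fst s 2 = n * n" using s by (simp add: represents_def)
        fix r1 assume r1: "r1 (treg d) = n * n + 16 * fst s (treg d) + acode a"
          "\<And>x. x \<noteq> treg d \<Longrightarrow> x \<noteq> treg (d + 1) \<Longrightarrow> r1 x = fst s x"
        have rep1: "represents n (\<rho>, \<mu>) (r1, m)" using s r1(2) by (auto simp: represents_def)
        have sm: "snd s = m" using s by simp
        show "runs (Seq (cex e2 (d + 1)) (Store (treg d) (treg (d + 1)))) (r1, snd s) (ecost n e2 + 1) ?Q"
          unfolding sm
        proof (rule runs_Seq, rule runs_conseq[OF runs_cex[OF rep1] order_refl])
          fix s' assume s': "represents n (\<rho>, \<mu>) s' \<and> snd s' = m \<and> fst s' (treg (d + 1)) = ev n \<mu> \<rho> e2 \<and>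
            (\<forall>d'<d + 1. fst s' (treg d') = r1 (treg d'))"
          then obtain r2 where s2: "s' = (r2, m)" by (cases s') auto
          have r2: "r2 (treg d) = n * n + 16 * ev n \<mu> \<rho> e1 + acode a" "r2 (treg (d + 1)) = ev n \<mu> \<rho> e2"
            "\<And>d'. d' < d \<Longrightarrow> r2 (treg d') = r (treg d')"
            using s s' s2 r1 by auto
          have rep2: "represents n (\<rho>, \<mu>) (r2, m)" using s' s2 by simp
          show "runs (Store (treg d) (treg (d + 1))) s' 1 ?Q"
            unfolding s2
            by (intro runs_basic; use r2 False represents_Store(1)[OF rep2 False] in auto)
        qed
      qed
    qed
    then show ?thesis unfolding eq by (rule runs_conseq) auto
  qed
next
  case (Sq c1 c2)
  show ?case
    unfolding ccom.simps ccost.simps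
  proof (intro runs_Seq runs_conseq[OF Sq.IH(1)[OF Sq.prems] order_refl])
    fix s' assume s': "represents n (sem n c1 \<sigma>) s' \<and> (\<forall>d'<d. fst s' (treg d') = fst s (treg d'))"
    show "runs (ccom c2 d) s' (ccost n c2) (\<lambda>s'. represents n (sem n (Sq c1 c2) \<sigma>) s' \<and>
      (\<forall>d'<d. fst s' (treg d') = fst s (treg d')))"
      by (rule runs_conseq[OF Sq.IH(2) order_refl]) (use s' in auto)
  qed
next
  case (If e c1 c2)
  obtain \<rho> \<mu> r m where eq: "\<sigma> = (\<rho>, \<mu>)" "s = (r, m)" by (cases \<sigma>; cases s)
  have rep: "represents n (\<rho>, \<mu>) (r, m)" using If eq by simp
  have "runs (ccom (If e c1 c2) d) s (ecost n e + (ccost n c1 + ccost n c2 + 1))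
    (\<lambda>s'. represents n (sem n (If e c1 c2) \<sigma>) s' \<and> (\<forall>d'<d. fst s' (treg d') = fst s (treg d')))"
    unfolding ccom.simps eq
  proof (intro runs_Seq runs_conseq[OF runs_cex[OF rep] order_refl])
    fix s assume s: "represents n (\<rho>, \<mu>) s \<and> snd s = m \<and> fst s (treg d) = ev n \<mu> \<rho> e \<and>
      (\<forall>d'<d. fst s (treg d') = r (treg d'))"
    then have rep1: "represents n (\<rho>, \<mu>) s" by simp
    show "runs (IfNZ (treg d) (ccom c1 d) (ccom c2 d)) s (ccost n c1 + ccost n c2 + 1)
      (\<lambda>s'. represents n (sem n (If e c1 c2) (\<rho>, \<mu>)) s' \<and> (\<forall>d'<d. fst s' (treg d') = fst (r, m) (treg d')))"
      by (intro runs_If; rule runs_conseq[OF If.IH(1)[OF rep1, of d] order_refl]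
        runs_conseq[OF If.IH(2)[OF rep1, of d] order_refl]; use s in auto)
  qed
  then show ?case by (rule runs_conseq) auto
next
  case (For x c)
  define \<tau> where "\<tau> i = foldl (\<lambda>\<sigma> i. sem n c ((fst \<sigma>)(x := i), snd \<sigma>)) \<sigma> [0..<i]" for i
  have \<tau>: "\<tau> 0 = \<sigma>" "\<And>i. \<tau> (Suc i) = sem n c ((fst (\<tau> i))(x := i), snd (\<tau> i))" "sem n (For x c) \<sigma> = \<tau> (Suc n)"
    by (simp_all add: \<tau>_def)
  define Inv where "Inv i s' \<longleftrightarrow> represents n (\<tau> i) s' \<and> fst s' (treg d) = i \<and>
    fst s' (treg (d + 1)) = Suc n - i \<and> (\<forall>d'<d. fst s' (treg d') = fst s (treg d'))" for i s'
  let ?B = "Seq (Copy (vreg x) (treg d)) (Seq (ccom c (d + 1)) (seq [Const (treg (d + 1)) 1,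
       Add (treg d) (treg d) (treg (d + 1)), Sub (treg (d + 1)) 1 (treg d)]))"
  have body: "fst s' (treg (d + 1)) \<noteq> 0 \<and> runs ?B s' (ccost n c + 5) (Inv (Suc i))"
    if i: "i < Suc n" and inv: "Inv i s'" for i s'
  proof
    show "fst s' (treg (d + 1)) \<noteq> 0" using i inv by (simp add: Inv_def)
    obtain r m where s1: "s' = (r, m)" by (cases s')
    obtain \<rho> \<mu> where t1: "\<tau> i = (\<rho>, \<mu>)" by (cases "\<tau> i")
    have r: "r (treg d) = i" using inv s1 by (simp add: Inv_def)
    have rep: "represents n (\<rho>(x := i), \<mu>) (r(vreg x := i), m)"
      using inv s1 t1 represents_vreg[of n \<rho> \<mu> r m x i] by (simp add: Inv_def)
    have "runs ?B s' (1 + (ccost n c + (1 + (1 + (1 + 1))))) (Inv (Suc i))"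
      unfolding s1
    proof (intro runs_Seq runs_basic(2), unfold r, rule runs_conseq[OF For.IH[OF rep, of "d + 1"] order_refl])
      fix s2 assume s2: "represents n (sem n c (\<rho>(x := i), \<mu>)) s2 \<and>
        (\<forall>d'<d + 1. fst s2 (treg d') = fst (r(vreg x := i), m) (treg d'))"
      obtain r2 m2 where e2: "s2 = (r2, m2)" by (cases s2)
      have "represents n (\<tau> (Suc i)) (r2, m2)" using s2 e2 t1 by (simp add: \<tau>(2))
      moreover have "r2 (treg d) = i" "\<And>d'. d' < d \<Longrightarrow> r2 (treg d') = fst s (treg d')" "r2 1 = Suc n"
        using s2 e2 inv s1 by (auto simp: Inv_def represents_def)
      ultimately show "runs (seq [Const (treg (d + 1)) 1,
         Add (treg d) (treg d) (treg (d + 1)), Sub (treg (d + 1)) 1 (treg d)]) s2 (1 + (1 + (1 + 1))) (Inv (Suc i))"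
        unfolding e2 by (intro runs_seq_simps runs_basic) (auto simp: Inv_def)
    qed
    then show "runs ?B s' (ccost n c + 5) (Inv (Suc i))" by (rule runs_conseq) auto
  qed
  have fin: "fst s' (treg (d + 1)) = 0" if "Inv (Suc n) s'" for s' using that by (simp add: Inv_def)
  have loop: "runs (WhileNZ (treg (d + 1)) ?B) s0 (Suc n * ((ccost n c + 5) + 1) + 1) (Inv (Suc n))"
    if "Inv 0 s0" for s0
    using runs_While[of "Suc n" Inv "treg (d + 1)" ?B "ccost n c + 5" 0 s0] body fin that by simp
  obtain r m where s1: "s = (r, m)" by (cases s)
  have "runs (ccom (For x c) d) s ((1 + (1 + 1)) + (Suc n * ((ccost n c + 5) + 1) + 1))
    (\<lambda>s'. represents n (sem n (For x c) \<sigma>) s' \<and> (\<forall>d'<d. fst s' (treg d') = fst s (treg d')))"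
    unfolding ccom.simps s1
  proof (rule runs_Seq, intro runs_seq_simps runs_basic, rule runs_conseq[OF loop order_refl])
    show "Inv 0 ((r(treg d := 0))(treg (d + 1) := (r(treg d := 0)) 1 - (r(treg d := 0)) (treg d)), m)"
      using For.prems s1 by (auto simp: Inv_def \<tau>(1) represents_def)
    show "represents n (sem n (For x c) \<sigma>) s' \<and> (\<forall>d'<d. fst s' (treg d') = fst (r, m) (treg d'))"
      if "Inv (Suc n) s'" for s' using that s1 unfolding \<tau>(3) by (simp add: Inv_def)
  qed
  then show ?case by (rule runs_conseq) auto
qed

declare One_nat_def [simp]

declare One_nat_def [simp del]

section \<open>Setting up the constants \<open>n + 1\<close> and \<open>n * n\<close>; costs as
  powers of \<open>max n 2\<close>\<close>

subsection \<open>Initialisation and running time\<close>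

definition init_prog :: prog where
  "init_prog = Seq (seq [Const (treg 0) 1, Add 1 0 (treg 0), Copy (treg 1) 0])
     (WhileNZ (treg 1) (seq [Add 2 2 0, Sub (treg 1) (treg 1) (treg 0)]))"

definition input_state :: "nat \<Rightarrow> nat set set \<Rightarrow> st" where
  "input_state n E = (\<lambda>_. 0, \<lambda>a. if a = Raw then snd (graph_input n E) else (\<lambda>_. 0))"

lemma runs_init_prog:
  "runs init_prog (graph_input n E) (4 * n + 5) (represents n (input_state n E))"
proof -
  obtain r m where s: "graph_input n E = (r, m)" by (cases "graph_input n E")
  have r: "r = (\<lambda>_. 0)(0 := n)" and m: "m = snd (graph_input n E)" using s by (auto simp: graph_input_def)
  define Inv where "Inv i s \<longleftrightarrow> snd s = m \<and> fst s 0 = n \<and> fst s 1 = Suc n \<and> fst s 2 = i * n \<and>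
    (\<forall>x. fst s (vreg x) = 0) \<and> fst s (treg 0) = 1 \<and> fst s (treg 1) = n - i" for i s
  let ?B = "seq [Add 2 2 0, Sub (treg 1) (treg 1) (treg 0)]"
  have body: "fst s (treg 1) \<noteq> 0 \<and> runs ?B s 3 (Inv (Suc i))" if i: "i < n" and inv: "Inv i s" for i s
  proof
    show "fst s (treg 1) \<noteq> 0" using i inv by (simp add: Inv_def)
    obtain r1 where s1: "s = (r1, m)" using inv by (cases s) (auto simp: Inv_def)
    have "runs ?B s (1 + (1 + 1)) (Inv (Suc i))"
      unfolding s1 using inv s1 i by (intro runs_seq_simps runs_basic) (auto simp: Inv_def)
    then show "runs ?B s 3 (Inv (Suc i))" by (rule runs_conseq) auto
  qed
  have fin: "fst s (treg 1) = 0" if "Inv n s" for s using that by (simp add: Inv_def)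
  have loop: "runs (WhileNZ (treg 1) ?B) s0 (n * (3 + 1) + 1) (Inv n)" if "Inv 0 s0" for s0
    using runs_While[of n Inv "treg 1" ?B 3 0 s0, OF body fin _ that] by simp
  have "runs init_prog (r, m) ((1 + (1 + (1 + 1))) + (n * (3 + 1) + 1)) (represents n (input_state n E))"
    unfolding init_prog_def
  proof (rule runs_Seq, intro runs_seq_simps runs_basic, rule runs_conseq[OF loop order_refl])
    show "represents n (input_state n E) s" if "Inv n s" for s
      using that m by (auto simp: Inv_def represents_def input_state_def graph_input_def)
  qed (auto simp: Inv_def r)
  then show ?thesis unfolding s by (rule runs_conseq) auto
qed

text \<open>An exponent for \<open>max n 2\<close> that bounds the cost. Since the base is at least
  2, a constant factor \<open>2 ^ j\<close> costs \<open>j\<close>, as for the summands 2 and 4.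
  Weights of subterms are added where a maximum would do; the total still grows only linearly in the
  parameters of the program.\<close>

fun ewt :: "ex \<Rightarrow> nat" where
  "ewt (V x) = 0"
| "ewt (C c) = 0"
| "ewt (Plus a b) = ewt a + ewt b + 2"
| "ewt (Minus a b) = ewt a + ewt b + 2"
| "ewt (Rd a e) = ewt e + 4"
| "ewt (Ite c a b) = ewt c + ewt a + ewt b + 2"
| "ewt (Sm x e) = ewt e + 5"

fun cwt :: "com \<Rightarrow> nat" where
  "cwt Nop = 0"
| "cwt (Set x e) = ewt e + 1"
| "cwt (Wr a e1 e2) = ewt e1 + ewt e2 + 4"
| "cwt (Sq c1 c2) = cwt c1 + cwt c2 + 1"
| "cwt (If e c1 c2) = ewt e + cwt c1 + cwt c2 + 2"
| "cwt (For x c) = cwt c + 5"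

lemma power_absorb:
  assumes "T \<le> q * m ^ k" "q \<le> (2::nat) ^ j" "2 \<le> m"
  shows "T \<le> m ^ (k + j)"
proof -
  have "(2::nat) ^ j \<le> m ^ j" using assms(3) by (rule power_mono) simp
  with assms(2) have "q \<le> m ^ j" by (rule order_trans)
  then have "q * m ^ k \<le> m ^ j * m ^ k" by (rule mult_le_mono1)
  with assms(1) have "T \<le> m ^ j * m ^ k" by (rule order_trans)
  also have "\<dots> = m ^ (k + j)" by (simp only: power_add mult.commute)
  finally show ?thesis .
qed

lemma power_le_power:
  assumes "T \<le> m ^ a" "a \<le> k" "2 \<le> (m::nat)"
  shows "T \<le> m ^ k"
proof -
  have "m ^ a \<le> m ^ k" using assms(2,3) by (intro power_increasing) auto
  with assms(1) show ?thesis by (rule order_trans)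
qed

text \<open>Everything is reduced to \<open>7 * Suc m + 9 <= m ^ 5\<close>, which is
  \<open>30 <= 32\<close> for \<open>m = 2\<close>; for larger \<open>m\<close> the left side is at
  most \<open>16 * m\<close>.\<close>

lemma power_loop:
  assumes T: "T \<le> m ^ k" and m: "m = max n 2"
  shows "Suc n * (T + 6) + 9 \<le> m ^ (k + 5)"
proof -
  have m2: "2 \<le> m" "n \<le> m" using m by auto
  define z where "z = m ^ k"
  have z: "T \<le> z" "1 \<le> z" using T m2 by (auto simp: z_def)
  have "Suc n * (T + 6) \<le> Suc m * (7 * z)"
    by (rule mult_le_mono) (use z m2 in linarith)+
  then have "Suc n * (T + 6) + 9 \<le> Suc m * (7 * z) + 9 * z" using z(2) by linarith
  also have "\<dots> = (7 * Suc m + 9) * z" by (simp add: algebra_simps)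
  also have "\<dots> \<le> m ^ 5 * z"
  proof (rule mult_le_mono1)
    show "7 * Suc m + 9 \<le> m ^ 5"
    proof (cases "m = 2")
      case False
      have "(2::nat) ^ 4 \<le> m ^ 4" using m2(1) by (rule power_mono) simp
      then have "16 * m \<le> m ^ 4 * m" by (intro mult_le_mono1) simp
      moreover have "7 * Suc m + 9 \<le> 16 * m" using m2(1) by simp
      ultimately have "7 * Suc m + 9 \<le> m ^ 4 * m" by (rule order_trans[rotated])
      then show ?thesis by (simp only: power_Suc2[symmetric]) simp
    qed simp
  qed
  also have "\<dots> = m ^ (k + 5)" by (simp only: z_def power_add mult.commute)
  finally show ?thesis .
qed

lemma ecost_bound: "ecost n e \<le> max n 2 ^ ewt e"
proof -
  define m where "m = max n 2"
  have m2: "2 \<le> m" by (simp add: m_def)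
  have one: "1 \<le> m ^ a" for a using m2 by simp
  have "ecost n e \<le> m ^ ewt e"
  proof (induction e)
    case (Plus a b)
    define k where "k = ewt a + ewt b"
    have "ecost n a \<le> m ^ k" "ecost n b \<le> m ^ k"
      using Plus by (auto simp: k_def intro: power_le_power m2)
    then have "ecost n (Plus a b) \<le> 3 * m ^ k" unfolding ecost.simps using one[of k] by linarith
    then have "ecost n (Plus a b) \<le> m ^ (k + 2)" by (rule power_absorb) (use m2 in auto)
    then show ?case by (simp only: k_def ewt.simps)
  next
    case (Minus a b)
    define k where "k = ewt a + ewt b"
    have "ecost n a \<le> m ^ k" "ecost n b \<le> m ^ k"
      using Minus by (auto simp: k_def intro: power_le_power m2)
    then have "ecost n (Minus a b) \<le> 3 * m ^ k" unfolding ecost.simps using one[of k] by linarith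
    then have "ecost n (Minus a b) \<le> m ^ (k + 2)" by (rule power_absorb) (use m2 in auto)
    then show ?case by (simp only: k_def ewt.simps)
  next
    case (Rd a e)
    then have "ecost n (Rd a e) \<le> 10 * m ^ ewt e" unfolding ecost.simps using one[of "ewt e"] by linarith
    then have "ecost n (Rd a e) \<le> m ^ (ewt e + 4)" by (rule power_absorb) (use m2 in auto)
    then show ?case by (simp only: ewt.simps)
  next
    case (Ite c a b)
    define k where "k = ewt c + ewt a + ewt b"
    have "ewt c \<le> k" "ewt a \<le> k" "ewt b \<le> k" by (auto simp: k_def)
    then have "ecost n c \<le> m ^ k" "ecost n a \<le> m ^ k" "ecost n b \<le> m ^ k"
      using Ite by (auto intro: power_le_power m2)
    then have "ecost n (Ite c a b) \<le> 4 * m ^ k" unfolding ecost.simps using one[of k] by linarith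
    then have "ecost n (Ite c a b) \<le> m ^ (k + 2)" by (rule power_absorb) (use m2 in auto)
    then show ?case by (simp only: k_def ewt.simps)
  next
    case (Sm x e)
    then show ?case using power_loop[OF _ m_def, of "ecost n e" "ewt e"] by (simp only: ecost.simps ewt.simps)
  qed simp_all
  then show ?thesis by (simp add: m_def)
qed

lemma ccost_bound: "ccost n c \<le> max n 2 ^ cwt c"
proof -
  define m where "m = max n 2"
  have m2: "2 \<le> m" by (simp add: m_def)
  have one: "1 \<le> m ^ a" for a using m2 by simp
  have e: "ecost n e \<le> m ^ ewt e" for e using ecost_bound by (simp add: m_def)
  have "ccost n c \<le> m ^ cwt c"
  proof (induction c)
    case (Set x e)
    have "ccost n (Set x e) \<le> 2 * m ^ ewt e" unfolding ccost.simps using e[of e] one[of "ewt e"] by linarith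
    then have "ccost n (Set x e) \<le> m ^ (ewt e + 1)" by (rule power_absorb) (use m2 in auto)
    then show ?case by (simp only: cwt.simps)
  next
    case (Wr a e1 e2)
    define k where "k = ewt e1 + ewt e2"
    have "ecost n e1 \<le> m ^ k" "ecost n e2 \<le> m ^ k"
      using e[of e1] e[of e2] by (auto simp: k_def intro: power_le_power m2)
    then have "ccost n (Wr a e1 e2) \<le> 11 * m ^ k" unfolding ccost.simps using one[of k] by linarith
    then have "ccost n (Wr a e1 e2) \<le> m ^ (k + 4)" by (rule power_absorb) (use m2 in auto)
    then show ?case by (simp only: k_def cwt.simps)
  next
    case (Sq c1 c2)
    define k where "k = cwt c1 + cwt c2"
    have "ccost n c1 \<le> m ^ k" "ccost n c2 \<le> m ^ k"
      using Sq by (auto simp: k_def intro: power_le_power m2)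
    then have "ccost n (Sq c1 c2) \<le> 2 * m ^ k" unfolding ccost.simps by linarith
    then have "ccost n (Sq c1 c2) \<le> m ^ (k + 1)" by (rule power_absorb) (use m2 in auto)
    then show ?case by (simp only: k_def cwt.simps)
  next
    case (If x c1 c2)
    define k where "k = ewt x + cwt c1 + cwt c2"
    have "ewt x \<le> k" "cwt c1 \<le> k" "cwt c2 \<le> k" by (auto simp: k_def)
    then have "ecost n x \<le> m ^ k" "ccost n c1 \<le> m ^ k" "ccost n c2 \<le> m ^ k"
      using If e[of x] by (auto intro: power_le_power m2)
    then have "ccost n (If x c1 c2) \<le> 4 * m ^ k" unfolding ccost.simps using one[of k] by linarith
    then have "ccost n (If x c1 c2) \<le> m ^ (k + 2)" by (rule power_absorb) (use m2 in auto)
    then show ?case by (simp only: k_def cwt.simps)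
  next
    case (For x c)
    then have "Suc n * (ccost n c + 6) + 9 \<le> m ^ (cwt c + 5)" by (rule power_loop[OF _ m_def])
    then show ?case unfolding ccost.simps cwt.simps by linarith
  qed simp_all
  then show ?thesis by (simp add: m_def)
qed

theorem compiled_program:
  shows "\<exists>k s. exec (Seq init_prog (ccom c 0)) (graph_input n E) k s \<and> k \<le> max n 2 ^ (cwt c + 5) \<and>
    set_output n s = {v. v < n \<and> snd (sem n c (input_state n E)) Raw v = 1}"
proof -
  have "runs (Seq init_prog (ccom c 0)) (graph_input n E) ((4 * n + 5) + ccost n c)
      (\<lambda>s. represents n (sem n c (input_state n E)) s)"
    by (intro runs_Seq runs_conseq[OF runs_init_prog order_refl])
      (auto intro: runs_conseq[OF runs_ccom order_refl])
  then obtain k s where ks: "exec (Seq init_prog (ccom c 0)) (graph_input n E) k s"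
    "k \<le> (4 * n + 5) + ccost n c" "represents n (sem n c (input_state n E)) s"
    unfolding runs_def by blast
  define m where "m = max n 2"
  have m: "2 \<le> m" "n \<le> m" by (auto simp: m_def)
  have c: "ccost n c \<le> m ^ cwt c" using ccost_bound by (simp add: m_def)
  have one: "1 \<le> m ^ cwt c" using m by simp
  define z where "z = m ^ cwt c"
  have z: "ccost n c \<le> z" "1 \<le> z" using c one by (auto simp: z_def)
  have "m * 1 \<le> m * z" using z(2) by (rule mult_le_mono2)
  moreover have "1 * z \<le> m * z" using m(1) by (intro mult_le_mono1) simp
  \<comment> \<open>\<open>4 * n\<close> takes four copies of \<open>m * z\<close>, the constant 5
    at most three because \<open>m * z\<close> is at least 2, and the compiled command one.\<close>
  ultimately have "k \<le> 8 * (m * z)" using ks(2) z m by linarith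
  then have "k \<le> 8 * m ^ Suc (cwt c)" by (simp add: z_def)
  then have "k \<le> m ^ (Suc (cwt c) + 3)" by (rule power_absorb) (use m in auto)
  then have "k \<le> m ^ (cwt c + 5)" by (rule power_le_power) (use m in auto)
  then have "k \<le> max n 2 ^ (cwt c + 5)" by (simp add: m_def)
  moreover have "set_output n s = {v. v < n \<and> snd (sem n c (input_state n E)) Raw v = 1}"
  proof -
    have "v < n * n" if "v < n" for v
    proof -
      have "n \<le> n * n" by (rule le_square)
      with that show ?thesis by (rule less_le_trans)
    qed
    then show ?thesis using ks(3) by (auto simp: set_output_def represents_def)
  qed
  ultimately show ?thesis using ks(1) by blast
qed

declare One_nat_def [simp]

section \<open>Frame rules, truth values, tables and nested loops\<close>

section \<open>Program schemes\<close>

fun wv :: "com \<Rightarrow> var set" where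
  "wv Nop = {}" | "wv (Set x e) = {x}" | "wv (Wr a e1 e2) = {}" | "wv (Sq c1 c2) = wv c1 \<union> wv c2"
| "wv (If e c1 c2) = wv c1 \<union> wv c2" | "wv (For x c) = insert x (wv c)"

fun wa :: "com \<Rightarrow> arr set" where
  "wa Nop = {}" | "wa (Set x e) = {}" | "wa (Wr a e1 e2) = {a}" | "wa (Sq c1 c2) = wa c1 \<union> wa c2"
| "wa (If e c1 c2) = wa c1 \<union> wa c2" | "wa (For x c) = wa c"

lemma For_rule:
  assumes "Inv 0 \<sigma>" "\<And>i \<sigma>. i \<le> n \<Longrightarrow> Inv i \<sigma> \<Longrightarrow> Inv (Suc i) (sem n c ((fst \<sigma>)(x := i), snd \<sigma>))"
  shows "Inv (Suc n) (sem n (For x c) \<sigma>)"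
proof -
  have "Inv i (foldl (\<lambda>\<sigma> i. sem n c ((fst \<sigma>)(x := i), snd \<sigma>)) \<sigma> [0..<i])" if "i \<le> Suc n" for i
    using that by (induction i) (auto simp: assms)
  then show ?thesis by (simp del: upt_Suc)
qed

lemma frame_var: "x \<notin> wv c \<Longrightarrow> fst (sem n c \<sigma>) x = fst \<sigma> x"
proof (induction c arbitrary: \<sigma>)
  case (For y c)
  show ?case
    by (rule For_rule[where Inv = "\<lambda>_ \<sigma>'. fst \<sigma>' x = fst \<sigma> x"]) (use For in auto)
qed auto

lemma frame_arr: "a \<notin> wa c \<Longrightarrow> snd (sem n c \<sigma>) a = snd \<sigma> a"
proof (induction c arbitrary: \<sigma>)
  case (For y c)
  show ?case
    by (rule For_rule[where Inv = "\<lambda>_ \<sigma>'. snd \<sigma>' a = snd \<sigma> a"]) (use For in auto)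
qed auto

definition tv :: "nat \<Rightarrow> (arr \<Rightarrow> nat \<Rightarrow> nat) \<Rightarrow> (var \<Rightarrow> nat) \<Rightarrow> ex \<Rightarrow> bool" where
  "tv n \<mu> \<rho> e \<longleftrightarrow> ev n \<mu> \<rho> e \<noteq> 0"

definition andE :: "ex \<Rightarrow> ex \<Rightarrow> ex" where "andE a b = Ite a b (C 0)"
definition orE :: "ex \<Rightarrow> ex \<Rightarrow> ex" where "orE a b = Plus a b"
definition notE :: "ex \<Rightarrow> ex" where "notE a = Minus (C 1) a"
definition ltE :: "ex \<Rightarrow> ex \<Rightarrow> ex" where "ltE a b = Minus b a"
definition eqE :: "ex \<Rightarrow> ex \<Rightarrow> ex" where "eqE a b = notE (Plus (Minus a b) (Minus b a))"
definition exE :: "var \<Rightarrow> ex \<Rightarrow> ex" where "exE x e = Sm x e"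
definition cntE :: "var \<Rightarrow> ex \<Rightarrow> ex" where "cntE x e = Sm x (Ite e (C 1) (C 0))"
text \<open>The language has no name for \<open>n\<close>; summing ones over the fixed range
  recovers \<open>n + 1\<close>.\<close>

definition sizeE :: ex where "sizeE = Sm (L 0) (C 1)"
definition orsE :: "ex list \<Rightarrow> ex" where "orsE es = foldr orE es (C 0)"
definition andsE :: "ex list \<Rightarrow> ex" where "andsE es = foldr andE es (C 1)"

lemma tv_simps [simp]:
  "tv n \<mu> \<rho> (andE a b) \<longleftrightarrow> tv n \<mu> \<rho> a \<and> tv n \<mu> \<rho> b"
  "tv n \<mu> \<rho> (orE a b) \<longleftrightarrow> tv n \<mu> \<rho> a \<or> tv n \<mu> \<rho> b"
  "tv n \<mu> \<rho> (notE a) \<longleftrightarrow> \<not> tv n \<mu> \<rho> a"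
  "tv n \<mu> \<rho> (ltE a b) \<longleftrightarrow> ev n \<mu> \<rho> a < ev n \<mu> \<rho> b"
  "tv n \<mu> \<rho> (eqE a b) \<longleftrightarrow> ev n \<mu> \<rho> a = ev n \<mu> \<rho> b"
  "tv n \<mu> \<rho> (Rd r e) \<longleftrightarrow> 0 < \<mu> r (ev n \<mu> \<rho> e)"
  "tv n \<mu> \<rho> (C k) \<longleftrightarrow> k \<noteq> 0"
  by (auto simp: tv_def andE_def orE_def notE_def ltE_def eqE_def)

lemma tv_ex [simp]: "tv n \<mu> \<rho> (exE x e) \<longleftrightarrow> (\<exists>i\<le>n. tv n \<mu> (\<rho>(x := i)) e)"
  unfolding tv_def exE_def ev.simps by (auto simp: less_Suc_eq_le simp del: sum.lessThan_Suc)

lemma tv_ors [simp]: "tv n \<mu> \<rho> (orsE es) \<longleftrightarrow> (\<exists>e\<in>set es. tv n \<mu> \<rho> e)"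
  unfolding orsE_def by (induction es) auto

lemma tv_ands [simp]: "tv n \<mu> \<rho> (andsE es) \<longleftrightarrow> (\<forall>e\<in>set es. tv n \<mu> \<rho> e)"
  unfolding andsE_def by (induction es) auto

lemma ev_cnt [simp]: "ev n \<mu> \<rho> (cntE x e) = card {i. i \<le> n \<and> tv n \<mu> (\<rho>(x := i)) e}"
proof -
  have "ev n \<mu> \<rho> (cntE x e) = (\<Sum>i\<in>{..<Suc n}. if tv n \<mu> (\<rho>(x := i)) e then 1 else 0)"
    unfolding cntE_def ev.simps tv_def by (rule sum.cong) auto
  also have "\<dots> = card {i \<in> {..<Suc n}. tv n \<mu> (\<rho>(x := i)) e}"
    by (subst sum.If_cases) (auto simp: Int_def)
  finally show ?thesis by (simp add: less_Suc_eq_le)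
qed

lemma ev_size [simp]: "ev n \<mu> \<rho> sizeE = Suc n"
  by (simp add: sizeE_def)

definition tab :: "var \<Rightarrow> arr \<Rightarrow> ex \<Rightarrow> com" where
  "tab x a e = For x (Wr a (V x) e)"

lemma tab_wv [simp]: "wv (tab x a e) = {x}" and tab_wa [simp]: "wa (tab x a e) = {a}"
  by (auto simp: tab_def)

text \<open>The table is filled in place and \<open>e\<close> may read it: at entry \<open>i\<close>
  the entries below \<open>i\<close> are already new and the others still old. The first-fit rule
  and the closure computation rely on this order.\<close>

lemma tab_sem:
  fixes n :: nat and x :: var and a :: arr and e :: ex and \<sigma> :: st
  assumes "a \<noteq> Raw"
  defines "f \<equiv> snd (sem n (tab x a e) \<sigma>) a"
  shows "i \<le> n \<Longrightarrow> f i = ev n ((snd \<sigma>)(a := \<lambda>j. if j < i then f j else snd \<sigma> a j)) ((fst \<sigma>)(x := i)) e"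
    and "n < i \<Longrightarrow> f i = snd \<sigma> a i"
proof -
  define Inv where "Inv k \<sigma>' \<longleftrightarrow> (\<forall>y. y \<noteq> x \<longrightarrow> fst \<sigma>' y = fst \<sigma> y) \<and> (\<forall>b. b \<noteq> a \<longrightarrow> snd \<sigma>' b = snd \<sigma> b) \<and>
    (\<forall>i<k. snd \<sigma>' a i = ev n ((snd \<sigma>)(a := \<lambda>j. if j < i then snd \<sigma>' a j else snd \<sigma> a j)) ((fst \<sigma>)(x := i)) e) \<and>
    (\<forall>i\<ge>k. snd \<sigma>' a i = snd \<sigma> a i)" for k \<sigma>'
  have "Inv (Suc n) (sem n (tab x a e) \<sigma>)"
    unfolding tab_def
  proof (rule For_rule)
    show "Inv 0 \<sigma>" by (simp add: Inv_def)
    fix k \<tau> assume k: "k \<le> n" and inv: "Inv k \<tau>"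
    define v where "v = ev n (snd \<tau>) ((fst \<tau>)(x := k)) e"
    have s: "sem n (Wr a (V x) e) ((fst \<tau>)(x := k), snd \<tau>) =
        ((fst \<tau>)(x := k), (snd \<tau>)(a := (snd \<tau> a)(k := v)))"
      using assms(1) by (simp add: v_def)
    have 1: "(fst \<tau>)(x := k) = (fst \<sigma>)(x := k)" using inv by (auto simp: Inv_def fun_eq_iff)
    have 2: "snd \<tau> = (snd \<sigma>)(a := \<lambda>j. if j < k then snd \<tau> a j else snd \<sigma> a j)"
      using inv by (auto simp: Inv_def fun_eq_iff not_less)
    have v: "v = ev n ((snd \<sigma>)(a := \<lambda>j. if j < k then snd \<tau> a j else snd \<sigma> a j)) ((fst \<sigma>)(x := k)) e"
      unfolding v_def 1 by (subst 2) (rule refl)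
    have old: "(\<lambda>j. if j < i then ((snd \<tau> a)(k := v)) j else snd \<sigma> a j) =
        (\<lambda>j. if j < i then snd \<tau> a j else snd \<sigma> a j)" if "i \<le> k" for i
      using that by (auto simp: fun_eq_iff)
    show "Inv (Suc k) (sem n (Wr a (V x) e) ((fst \<tau>)(x := k), snd \<tau>))"
      unfolding s Inv_def
    proof (intro conjI allI impI)
      fix i assume "i < Suc k"
      then have i: "i \<le> k" by simp
      have "((snd \<tau> a)(k := v)) i = ev n ((snd \<sigma>)(a := \<lambda>j. if j < i then snd \<tau> a j else snd \<sigma> a j))
          ((fst \<sigma>)(x := i)) e"
        using inv v i by (cases "i = k") (auto simp: Inv_def)
      then show "snd ((fst \<tau>)(x := k), (snd \<tau>)(a := (snd \<tau> a)(k := v))) a i =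
          ev n ((snd \<sigma>)(a := \<lambda>j. if j < i
            then snd ((fst \<tau>)(x := k), (snd \<tau>)(a := (snd \<tau> a)(k := v))) a j else snd \<sigma> a j)) ((fst \<sigma>)(x := i)) e"
        unfolding snd_conv fun_upd_same old[OF i] .
    qed (use inv in \<open>auto simp: Inv_def\<close>)
  qed
  then show "i \<le> n \<Longrightarrow> f i = ev n ((snd \<sigma>)(a := \<lambda>j. if j < i then f j else snd \<sigma> a j)) ((fst \<sigma>)(x := i)) e"
    "n < i \<Longrightarrow> f i = snd \<sigma> a i"
    unfolding f_def Inv_def by (auto simp: less_Suc_eq_le)
qed

lemma tab_tv:
  assumes "a \<noteq> Raw" "i \<le> n"
  shows "0 < snd (sem n (tab x a e) \<sigma>) a i \<longleftrightarrow>
    tv n ((snd \<sigma>)(a := \<lambda>j. if j < i then snd (sem n (tab x a e) \<sigma>) a j else snd \<sigma> a j)) ((fst \<sigma>)(x := i)) e"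
  unfolding tv_def using tab_sem(1)[OF assms, of x e \<sigma>] by simp

subsection \<open>Nested loops\<close>

fun nest :: "(nat \<Rightarrow> var) \<Rightarrow> nat \<Rightarrow> com \<Rightarrow> com" where
  "nest f 0 c = c"
| "nest f (Suc K) c = For (f 0) (nest (\<lambda>i. f (Suc i)) K c)"

fun tuples :: "nat \<Rightarrow> nat \<Rightarrow> nat list list" where
  "tuples n 0 = [[]]"
| "tuples n (Suc K) = concat (map (\<lambda>i. map (Cons i) (tuples n K)) [0..<Suc n])"

lemma set_tuples: "set (tuples n K) = {g. length g = K \<and> set g \<subseteq> {..n}}"
proof (induction K)
  case (Suc K)
  show ?case
  proof (intro set_eqI iffI)
    fix g assume "g \<in> {g. length g = Suc K \<and> set g \<subseteq> {..n}}"
    then obtain i h where "g = i # h" "length h = K" "set h \<subseteq> {..n}" "i \<le> n" by (cases g) auto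
    then show "g \<in> set (tuples n (Suc K))" using Suc.IH by (auto simp: less_Suc_eq_le simp del: upt_Suc)
  qed (use Suc.IH in \<open>auto simp: less_Suc_eq_le simp del: upt_Suc\<close>)
qed auto

lemma nest_wv: "wv (nest f K c) = f ` {..<K} \<union> wv c"
proof (induction K arbitrary: f)
  case (Suc K)
  have "{..<Suc K} = insert 0 (Suc ` {..<K})" by (auto simp: image_iff less_Suc_eq_0_disj)
  then show ?case by (simp add: Suc image_image)
qed simp

lemma nest_wa [simp]: "wa (nest f K c) = wa c"
  by (induction K arbitrary: f) auto

lemma cwt_nest: "cwt (nest f K c) = cwt c + 5 * K"
  by (induction K arbitrary: f) auto

text \<open>\<open>Inv\<close> refers to the tuples processed so far, which turns nested loops into
  one pass through \<open>tuples n K\<close>. It must ignore the loop variables, because the loops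
  assign them between runs of the body.\<close>

lemma nest_rule:
  assumes "\<And>i j. i < K \<Longrightarrow> j < K \<Longrightarrow> f i = f j \<Longrightarrow> i = j" and "\<And>i. i < K \<Longrightarrow> f i \<notin> wv c"
    and "\<And>pre \<rho> \<mu> i x. i < K \<Longrightarrow> Inv pre (\<rho>, \<mu>) \<Longrightarrow> Inv pre (\<rho>(f i := x), \<mu>)"
    and "\<And>pre g \<rho> \<mu>. g \<in> set (tuples n K) \<Longrightarrow> (\<And>i. i < K \<Longrightarrow> \<rho> (f i) = g ! i) \<Longrightarrow> Inv pre (\<rho>, \<mu>) \<Longrightarrow>
      Inv (pre @ [g]) (sem n c (\<rho>, \<mu>))"
    and "Inv pre \<sigma>"
  shows "Inv (pre @ tuples n K) (sem n (nest f K c) \<sigma>)"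
  using assms
proof (induction K arbitrary: f Inv pre \<sigma>)
  case 0
  then show ?case by (cases \<sigma>) simp
next
  case (Suc K)
  define Pre where "Pre i = pre @ concat (map (\<lambda>i. map (Cons i) (tuples n K)) [0..<i])" for i
  have "Inv (Pre (Suc n)) (sem n (For (f 0) (nest (\<lambda>i. f (Suc i)) K c)) \<sigma>)"
  proof (rule For_rule[where Inv = "\<lambda>i. Inv (Pre i)"])
    show "Inv (Pre 0) \<sigma>" using Suc.prems(5) by (simp add: Pre_def)
    fix i \<sigma> assume i: "i \<le> n" and inv: "Inv (Pre i) \<sigma>"
    define Inv' where "Inv' q \<sigma>' \<longleftrightarrow> fst \<sigma>' (f 0) = i \<and> Inv (Pre i @ map (Cons i) q) \<sigma>'" for q \<sigma>'
    have "Inv' ([] @ tuples n K) (sem n (nest (\<lambda>i. f (Suc i)) K c) ((fst \<sigma>)(f 0 := i), snd \<sigma>))"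
    proof (rule Suc.IH)
      show "i = j" if "i < K" "j < K" "f (Suc i) = f (Suc j)" for i j
        using Suc.prems(1)[of "Suc i" "Suc j"] that by simp
      show "f (Suc i) \<notin> wv c" if "i < K" for i using Suc.prems(2) that by simp
      show "Inv' q (\<rho>(f (Suc j) := x), \<mu>)" if "j < K" "Inv' q (\<rho>, \<mu>)" for q \<rho> \<mu> j x
      proof -
        have "f 0 \<noteq> f (Suc j)" using Suc.prems(1)[of 0 "Suc j"] that(1) by auto
        moreover have "Inv (Pre i @ map (Cons i) q) (\<rho>(f (Suc j) := x), \<mu>)"
          by (rule Suc.prems(3)) (use that in \<open>auto simp: Inv'_def\<close>)
        ultimately show ?thesis using that(2) unfolding Inv'_def by simp
      qed
      show "Inv' (q @ [g]) (sem n c (\<rho>, \<mu>))"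
        if g: "g \<in> set (tuples n K)" "\<And>j. j < K \<Longrightarrow> \<rho> (f (Suc j)) = g ! j" "Inv' q (\<rho>, \<mu>)" for q g \<rho> \<mu>
      proof -
        have mem: "i # g \<in> set (tuples n (Suc K))" using g(1) i by (auto simp: less_Suc_eq_le simp del: upt_Suc)
        have nth: "\<rho> (f j) = (i # g) ! j" if "j < Suc K" for j
          using that g(2,3) by (cases j) (auto simp: Inv'_def)
        have "Inv ((Pre i @ map (Cons i) q) @ [i # g]) (sem n c (\<rho>, \<mu>))"
        proof (rule Suc.prems(4))
          show "i # g \<in> set (tuples n (Suc K))" by (rule mem)
          show "\<rho> (f j) = (i # g) ! j" if "j < Suc K" for j using that by (rule nth)
          show "Inv (Pre i @ map (Cons i) q) (\<rho>, \<mu>)" using g(3) by (simp add: Inv'_def)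
        qed
        moreover have "fst (sem n c (\<rho>, \<mu>)) (f 0) = i"
          using frame_var[of "f 0" c n "(\<rho>, \<mu>)"] Suc.prems(2)[of 0] g(3) by (simp add: Inv'_def)
        ultimately show ?thesis by (simp add: Inv'_def)
      qed
      show "Inv' [] ((fst \<sigma>)(f 0 := i), snd \<sigma>)"
      proof -
        have "Inv (Pre i) ((fst \<sigma>)(f 0 := i), snd \<sigma>)"
          by (rule Suc.prems(3)) (use inv in simp_all)
        then show ?thesis by (simp add: Inv'_def)
      qed
    qed
    then show "Inv (Pre (Suc i)) (sem n (nest (\<lambda>i. f (Suc i)) K c) ((fst \<sigma>)(f 0 := i), snd \<sigma>))"
      by (simp add: Inv'_def Pre_def)
  qed
  then show ?case by (simp add: Pre_def del: upt_Suc)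
qed

lemma length_tuples: "length (tuples n K) = Suc n ^ K"
  by (induction K) (simp_all add: length_concat comp_def sum_list_triv del: upt_Suc)

section \<open>The program: reduction, one step, enumeration of all codes, output\<close>

section \<open>The algorithm\<close>

text \<open>
  Arrays hold vertex sets, the value \<open>n\<close> standing for no vertex: \<open>AL\<close> and \<open>S0\<close> are the vertices that survive
  the reduction and those chosen by it; \<open>BX\<close>, \<open>BB\<close>, \<open>SS\<close>, \<open>WW\<close>, \<open>UU\<close> are the sets \<open>bag X\<close>, \<open>bag (insert p X)\<close>,
  the trace, the region and the assembled set of one step; \<open>MM\<close>, \<open>M2\<close> are used to compute components, \<open>BST\<close>
  is the largest listed set contained in \<open>TT\<close>; and \<open>LL\<close> is the list of all sets found so far.
  The variable \<open>G 0\<close> only counts rounds, the other \<open>G i\<close> hold the digits of a code: \<open>p\<close>, \<open>c\<close>, the \<open>q\<close> members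
  of \<open>X\<close>, and then the first and the second components of the \<open>s\<close> pairs. \<open>L 0\<close> is reserved for \<open>adjR\<close>.
\<close>

abbreviation "vv \<equiv> L 1"
abbreviation "ww \<equiv> L 2"
abbreviation "uu \<equiv> L 3"
abbreviation "kk \<equiv> L 4"
abbreviation "cc \<equiv> L 5"
abbreviation "off \<equiv> L 6"
abbreviation "cn \<equiv> L 7"

definition nE :: ex where "nE = Minus sizeE (C 1)"

text \<open>The product with \<open>n\<close> is a sum of \<open>n + 1\<close> copies of
  \<open>x\<close> minus one copy. The test of \<open>y\<close> keeps the index within the row of
  \<open>x\<close>.\<close>

definition adjR :: "var \<Rightarrow> var \<Rightarrow> ex" where
  "adjR x y = andE (ltE (V y) nE) (Rd Raw (Plus (Minus (Sm (L 0) (V x)) (V x)) (V y)))"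

definition adjA :: "var \<Rightarrow> var \<Rightarrow> ex" where
  "adjA x y = andE (Rd AL (V x)) (andE (Rd AL (V y)) (adjR x y))"

lemma ev_nE [simp]: "ev n \<mu> \<rho> nE = n"
  by (simp add: nE_def)

definition prep_step :: com where
  "prep_step = If (andE (Rd AL (V vv)) (ltE (cntE ww (adjA vv ww)) (C 2)))
     (Sq (Wr S0 (V vv) (C 1))
       (tab ww AL (andE (Rd AL (V ww)) (andE (notE (eqE (V ww) (V vv))) (notE (adjR vv ww)))))) Nop"

definition prep :: com where
  "prep = Sq (tab vv AL (ltE (V vv) nE)) (For kk (For vv prep_step))"

locale input_graph =
  fixes n :: nat and E :: "nat set set"
  assumes simple: "simple_graph ({..<n}, E)"
begin

definition input :: "nat \<Rightarrow> nat" where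
  "input = snd (graph_input n E)"

lemma edge:
  assumes "{x, y} \<in> E"
  shows "x < n" "y < n" "x \<noteq> y"
proof -
  have "E \<subseteq> nsets {..<n} 2" using simple by (simp add: simple_graph_def)
  then have "{x, y} \<in> nsets {..<n} 2" using assms by blast
  then have "{x, y} \<subseteq> {..<n}" and c: "card {x, y} = 2" by (auto simp: nsets_def)
  then show "x < n" "y < n" by auto
  show "x \<noteq> y" using c by auto
qed

lemma tv_adjR [simp]:
  assumes "\<mu> Raw = input" "x \<noteq> L 0" "y \<noteq> L 0"
  shows "tv n \<mu> \<rho> (adjR x y) \<longleftrightarrow> {\<rho> x, \<rho> y} \<in> E"
proof -
  have s: "ev n \<mu> \<rho> (Plus (Minus (Sm (L 0) (V x)) (V x)) (V y)) = \<rho> x * n + \<rho> y"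
    using assms(2) by (simp add: mult.commute)
  have "0 < input (\<rho> x * n + \<rho> y) \<longleftrightarrow> {\<rho> x, \<rho> y} \<in> E" if y: "\<rho> y < n"
  proof
    assume "0 < input (\<rho> x * n + \<rho> y)"
    then have "{(\<rho> x * n + \<rho> y) div n, (\<rho> x * n + \<rho> y) mod n} \<in> E"
      by (auto simp: input_def graph_input_def split: if_splits)
    then show "{\<rho> x, \<rho> y} \<in> E" using y by simp
  next
    assume e: "{\<rho> x, \<rho> y} \<in> E"
    then have "\<rho> x * n + \<rho> y < Suc (\<rho> x) * n" using y by simp
    also have "\<dots> \<le> n * n" using edge(1)[OF e] by (intro mult_le_mono1) simp
    finally show "0 < input (\<rho> x * n + \<rho> y)" using e y by (simp add: input_def graph_input_def)
  qed
  then have "tv n \<mu> \<rho> (adjR x y) \<longleftrightarrow> \<rho> y < n \<and> {\<rho> x, \<rho> y} \<in> E"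
    unfolding adjR_def tv_simps s assms(1) ev_nE by (simp only: ev.simps) blast
  then show ?thesis using edge(2) by blast
qed

lemma tv_adjA [simp]:
  assumes "\<mu> Raw = input" "x \<noteq> L 0" "y \<noteq> L 0"
  shows "tv n \<mu> \<rho> (adjA x y) \<longleftrightarrow> 0 < \<mu> AL (\<rho> x) \<and> 0 < \<mu> AL (\<rho> y) \<and> {\<rho> x, \<rho> y} \<in> E"
  using tv_adjR[of \<mu> x y \<rho>] assms by (simp add: adjA_def)

subsection \<open>Removal of vertices of degree at most one\<close>

definition deg_in :: "nat set \<Rightarrow> nat \<Rightarrow> nat" where
  "deg_in A v = card {w \<in> A. {v, w} \<in> E}"

definition indepE :: "nat set \<Rightarrow> bool" where
  "indepE S \<longleftrightarrow> S \<subseteq> {..<n} \<and> (\<forall>x\<in>S. \<forall>y\<in>S. {x, y} \<notin> E)"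

definition reduced :: "nat set \<Rightarrow> nat set \<Rightarrow> bool" where
  "reduced A S \<longleftrightarrow> A \<subseteq> {..<n} \<and> indepE S \<and> S \<inter> A = {} \<and> (\<forall>x\<in>S. \<forall>y\<in>A. {x, y} \<notin> E) \<and>
     (\<forall>I. indepE I \<longrightarrow> (\<exists>I'\<subseteq>A. indepE I' \<and> card I \<le> card S + card I'))"

lemma reduced_init: "reduced {..<n} {}"
  unfolding reduced_def by (auto simp: indepE_def)

text \<open>The closed neighbourhood of \<open>v\<close> inside \<open>A\<close> is a single vertex
  or an edge, so an independent set loses at most one vertex with it, and \<open>v\<close> makes up
  for this.\<close>

lemma reduced_step:
  assumes r: "reduced A S" and v: "v \<in> A" "deg_in A v < 2"
  shows "reduced {w \<in> A. w \<noteq> v \<and> {v, w} \<notin> E} (insert v S)"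
proof -
  define A' where "A' = {w \<in> A. w \<noteq> v \<and> {v, w} \<notin> E}"
  have A: "A \<subseteq> {..<n}" and S: "indepE S" "S \<inter> A = {}" "\<And>x y. x \<in> S \<Longrightarrow> y \<in> A \<Longrightarrow> {x, y} \<notin> E"
    using r by (auto simp: reduced_def)
  have finA: "finite A" using A finite_subset by blast
  have finS: "finite S" using S(1) finite_subset unfolding indepE_def by blast
  have "v \<notin> S" using S(2) v(1) by auto
  then have cS: "card (insert v S) = Suc (card S)" using finS by simp
  have "\<exists>I''\<subseteq>A'. indepE I'' \<and> card I \<le> card (insert v S) + card I''" if I: "indepE I" for I
  proof -
    obtain I' where I': "I' \<subseteq> A" "indepE I'" "card I \<le> card S + card I'"
      using r I by (auto simp: reduced_def)
    have fin: "finite I'" using I'(1) finA finite_subset by blast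
    have "card (I' - A') \<le> 1"
    proof -
      have "x = y" if xy: "x \<in> I' - A'" "y \<in> I' - A'" for x y
      proof -
        have c: "x = v \<or> {v, x} \<in> E" "y = v \<or> {v, y} \<in> E" using xy I'(1) by (auto simp: A'_def)
        have ind: "{x, y} \<notin> E" "{y, x} \<notin> E" using xy I'(2) by (auto simp: indepE_def)
        have "x = y" if "{v, x} \<in> E" "{v, y} \<in> E"
        proof -
          have "{x, y} \<subseteq> {w \<in> A. {v, w} \<in> E}" using that xy I'(1) by auto
          then have "card {x, y} \<le> deg_in A v" unfolding deg_in_def using finA by (intro card_mono) auto
          with v(2) have "card {x, y} \<le> 1" by simp
          then show "x = y" by (cases "x = y") auto
        qed
        with c ind show "x = y" by auto
      qed
      then show ?thesis using fin by (metis One_nat_def card_le_Suc0_iff_eq finite_Diff)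
    qed
    moreover have "card I' \<le> card (I' \<inter> A') + card (I' - A')"
      using card_Un_le[of "I' \<inter> A'" "I' - A'"] by (simp add: Un_Diff_Int Int_Diff_Un)
    ultimately have "card I \<le> card (insert v S) + card (I' \<inter> A')" using I'(3) cS by simp
    moreover have "indepE (I' \<inter> A')" using I'(2) by (auto simp: indepE_def)
    ultimately show ?thesis by blast
  qed
  moreover have "indepE (insert v S)"
  proof -
    have "{x, v} \<notin> E \<and> {v, x} \<notin> E" if "x \<in> S" for x using S(3)[OF that v(1)] by (simp add: insert_commute)
    moreover have "{v, v} \<notin> E" using edge(3) by blast
    ultimately show ?thesis using S(1) v(1) A unfolding indepE_def by auto
  qed
  ultimately show ?thesis
    using A S v unfolding reduced_def A'_def[symmetric] by (auto simp: A'_def)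
qed

definition prep_state :: "nat set \<Rightarrow> nat set \<Rightarrow> st \<Rightarrow> bool" where
  "prep_state A S \<sigma> \<longleftrightarrow> snd \<sigma> Raw = input \<and> (\<forall>i. 0 < snd \<sigma> AL i \<longleftrightarrow> i \<in> A) \<and>
     (\<forall>i. 0 < snd \<sigma> S0 i \<longleftrightarrow> i \<in> S) \<and> reduced A S"

definition stable :: "nat set \<Rightarrow> bool" where
  "stable A \<longleftrightarrow> (\<forall>v\<in>A. 2 \<le> deg_in A v)"

lemma prep_step_sem:
  assumes p: "prep_state A S \<sigma>" and i: "fst \<sigma> vv \<le> n"
  shows "if fst \<sigma> vv \<in> A \<and> deg_in A (fst \<sigma> vv) < 2
    then prep_state {w \<in> A. w \<noteq> fst \<sigma> vv \<and> {fst \<sigma> vv, w} \<notin> E} (insert (fst \<sigma> vv) S) (sem n prep_step \<sigma>)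
    else sem n prep_step \<sigma> = \<sigma>"
proof -
  let ?i = "fst \<sigma> vv"
  have raw: "snd \<sigma> Raw = input" and al: "\<And>i. 0 < snd \<sigma> AL i \<longleftrightarrow> i \<in> A"
    and s0: "\<And>i. 0 < snd \<sigma> S0 i \<longleftrightarrow> i \<in> S" and red: "reduced A S"
    using p by (auto simp: prep_state_def)
  have An: "A \<subseteq> {..<n}" using red by (simp add: reduced_def)
  have c: "{w. w \<le> n \<and> ?i \<in> A \<and> w \<in> A \<and> {?i, w} \<in> E} = {w \<in> A. {?i, w} \<in> E}" if "?i \<in> A"
    using An that by auto
  have cond: "tv n (snd \<sigma>) (fst \<sigma>) (andE (Rd AL (V vv)) (ltE (cntE ww (adjA vv ww)) (C 2))) \<longleftrightarrow>
      ?i \<in> A \<and> deg_in A ?i < 2"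
    using raw al c by (auto simp: deg_in_def)
  show ?thesis
  proof (cases "?i \<in> A \<and> deg_in A ?i < 2")
    case True
    define \<sigma>1 where "\<sigma>1 = sem n (Wr S0 (V vv) (C 1)) \<sigma>"
    define e where "e = andE (Rd AL (V ww)) (andE (notE (eqE (V ww) (V vv))) (notE (adjR vv ww)))"
    define \<sigma>2 where "\<sigma>2 = sem n (tab ww AL e) \<sigma>1"
    have s1: "fst \<sigma>1 = fst \<sigma>" "snd \<sigma>1 = (snd \<sigma>)(S0 := (snd \<sigma> S0)(?i := 1))" by (auto simp: \<sigma>1_def)
    have s: "sem n prep_step \<sigma> = \<sigma>2"
      using True cond unfolding prep_step_def \<sigma>2_def \<sigma>1_def e_def tv_def by simp
    have "0 < snd \<sigma>2 AL j \<longleftrightarrow> j \<in> A \<and> j \<noteq> ?i \<and> {?i, j} \<notin> E" for j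
    proof (cases "j \<le> n")
      case True
      then show ?thesis
        unfolding \<sigma>2_def using tab_tv[of AL j n ww e \<sigma>1] s1 raw al by (simp add: e_def)
    next
      case False
      then have "snd \<sigma>2 AL j = snd \<sigma>1 AL j" unfolding \<sigma>2_def using tab_sem(2)[of AL n j ww e \<sigma>1] by simp
      moreover have "j \<notin> A" using False An by auto
      ultimately show ?thesis using s1 al[of j] by simp
    qed
    moreover have "snd \<sigma>2 b = snd \<sigma>1 b" if "b \<noteq> AL" for b
      unfolding \<sigma>2_def by (rule frame_arr) (use that in simp)
    ultimately have "prep_state {w \<in> A. w \<noteq> ?i \<and> {?i, w} \<notin> E} (insert ?i S) \<sigma>2"
      using reduced_step[OF red] True raw s0 s1 unfolding prep_state_def by auto
    then show ?thesis using True s by simp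
  next
    case False
    then have "sem n prep_step \<sigma> = \<sigma>" using cond unfolding prep_step_def tv_def by auto
    then show ?thesis unfolding if_not_P[OF False] .
  qed
qed

lemma prep_round:
  assumes p: "prep_state A0 S \<sigma>"
  shows "\<exists>A S. prep_state A S (sem n (For vv prep_step) \<sigma>) \<and>
    (stable A0 \<longrightarrow> A = A0) \<and> (A = A0 \<and> stable A0 \<or> card A < card A0)"
proof -
  have A0n: "A0 \<subseteq> {..<n}" using p by (simp add: prep_state_def reduced_def)
  then have finA0: "finite A0" using finite_subset by blast
  define Inv where "Inv j \<tau> \<longleftrightarrow> (\<exists>A S. prep_state A S \<tau> \<and> A \<subseteq> A0 \<and> (stable A0 \<longrightarrow> A = A0) \<and>
      (A = A0 \<and> (\<forall>v\<in>A0. v < j \<longrightarrow> 2 \<le> deg_in A0 v) \<or> card A < card A0))" for j \<tau>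
  have "Inv (Suc n) (sem n (For vv prep_step) \<sigma>)"
  proof (rule For_rule)
    show "Inv 0 \<sigma>" using p by (auto simp: Inv_def)
    fix j \<tau> assume j: "j \<le> n" and "Inv j \<tau>"
    then obtain A S where A: "prep_state A S \<tau>" "A \<subseteq> A0" "stable A0 \<longrightarrow> A = A0"
      "A = A0 \<and> (\<forall>v\<in>A0. v < j \<longrightarrow> 2 \<le> deg_in A0 v) \<or> card A < card A0"
      unfolding Inv_def by blast
    define \<tau>' where "\<tau>' = ((fst \<tau>)(vv := j), snd \<tau>)"
    have p': "prep_state A S \<tau>'" using A(1) by (simp add: prep_state_def \<tau>'_def)
    have j': "fst \<tau>' vv = j" by (simp add: \<tau>'_def)
    note st = prep_step_sem[OF p', unfolded j', OF j]
    show "Inv (Suc j) (sem n prep_step \<tau>')"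
    proof (cases "j \<in> A \<and> deg_in A j < 2")
      case True
      define A' where "A' = {w \<in> A. w \<noteq> j \<and> {j, w} \<notin> E}"
      have "A' \<subset> A" using True by (auto simp: A'_def)
      then have "A' \<subset> A0" using A(2) by auto
      then have "card A' < card A0" using finA0 by (rule psubset_card_mono[rotated])
      moreover have "\<not> stable A0"
      proof
        assume st: "stable A0"
        then have "2 \<le> deg_in A j" using True A(3) by (simp add: stable_def)
        then show False using True by simp
      qed
      moreover have "prep_state A' (insert j S) (sem n prep_step \<tau>')" using st True by (simp add: A'_def)
      ultimately show ?thesis unfolding Inv_def using \<open>A' \<subset> A0\<close> by blast
    next
      case False
      then have "sem n prep_step \<tau>' = \<tau>'" using st by presburger
      moreover have "A = A0 \<and> (\<forall>v\<in>A0. v < Suc j \<longrightarrow> 2 \<le> deg_in A0 v) \<or> card A < card A0"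
        using A(4) False by (auto simp: less_Suc_eq)
      ultimately show ?thesis unfolding Inv_def using p' A(2,3) by auto
    qed
  qed
  then obtain A S where A: "prep_state A S (sem n (For vv prep_step) \<sigma>)" "stable A0 \<longrightarrow> A = A0"
    "A = A0 \<and> (\<forall>v\<in>A0. v < Suc n \<longrightarrow> 2 \<le> deg_in A0 v) \<or> card A < card A0"
    unfolding Inv_def by blast
  moreover have "stable A0" if "\<forall>v\<in>A0. v < Suc n \<longrightarrow> 2 \<le> deg_in A0 v"
    using that A0n by (auto simp: stable_def)
  ultimately show ?thesis by blast
qed

lemma prep_sem:
  assumes "snd \<sigma> Raw = input" "\<And>i. snd \<sigma> AL i = 0" "\<And>i. snd \<sigma> S0 i = 0"
  shows "\<exists>A S. prep_state A S (sem n prep \<sigma>) \<and> stable A"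
proof -
  define \<sigma>1 where "\<sigma>1 = sem n (tab vv AL (ltE (V vv) nE)) \<sigma>"
  have al: "0 < snd \<sigma>1 AL i \<longleftrightarrow> i \<in> {..<n}" for i
  proof (cases "i \<le> n")
    case True
    then show ?thesis unfolding \<sigma>1_def using tab_tv[of AL i n vv "ltE (V vv) nE" \<sigma>] by simp
  next
    case False
    then show ?thesis unfolding \<sigma>1_def using tab_sem(2)[of AL n i vv "ltE (V vv) nE" \<sigma>] assms(2) by simp
  qed
  moreover have "snd \<sigma>1 b = snd \<sigma> b" if "b \<noteq> AL" for b
    unfolding \<sigma>1_def by (rule frame_arr) (use that in simp)
  ultimately have p1: "prep_state {..<n} {} \<sigma>1"
    using assms reduced_init unfolding prep_state_def by auto
  \<comment> \<open>A pass without effect certifies stability and any other pass shrinks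
    \<open>A\<close>; after \<open>Suc n\<close> passes the second alternative would ask for
    \<open>Suc n <= n\<close>.\<close>
  define Inv where "Inv k \<tau> \<longleftrightarrow> (\<exists>A S. prep_state A S \<tau> \<and> (stable A \<or> card A + k \<le> n))" for k \<tau>
  have "Inv (Suc n) (sem n (For kk (For vv prep_step)) \<sigma>1)"
  proof (rule For_rule)
    show "Inv 0 \<sigma>1" unfolding Inv_def using p1 by (intro exI[of _ "{..<n}"] exI[of _ "{}"]) auto
    fix k \<tau> assume "k \<le> n" and "Inv k \<tau>"
    then obtain A S where A: "prep_state A S \<tau>" "stable A \<or> card A + k \<le> n" by (auto simp: Inv_def)
    have "prep_state A S ((fst \<tau>)(kk := k), snd \<tau>)" using A(1) by (simp add: prep_state_def)
    from prep_round[OF this] obtain A' S' where A':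
      "prep_state A' S' (sem n (For vv prep_step) ((fst \<tau>)(kk := k), snd \<tau>))"
      "stable A \<longrightarrow> A' = A" "A' = A \<and> stable A \<or> card A' < card A" by blast
    have "stable A' \<or> card A' + Suc k \<le> n" using A(2) A'(2,3) by auto
    then show "Inv (Suc k) (sem n (For vv prep_step) ((fst \<tau>)(kk := k), snd \<tau>))"
      using A'(1) unfolding Inv_def by blast
  qed
  then obtain A S where "prep_state A S (sem n (For kk (For vv prep_step)) \<sigma>1)" "stable A"
    unfolding Inv_def by auto
  then show ?thesis unfolding prep_def \<sigma>1_def by auto
qed

end

subsection \<open>The dynamic program\<close>

definition clos :: "arr \<Rightarrow> ex \<Rightarrow> com" where
  "clos a e = For kk (tab vv a (orE (Rd a (V vv)) (andE e (exE uu (andE (Rd a (V uu)) (adjA uu vv))))))"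

text \<open>The variables of the \<open>K\<close> nested loops are only a clock with
  \<open>Suc n ^ K\<close> ticks, one for each slot that the list can have; \<open>off\<close> moves
  on by one slot per tick. Slots not yet written read as empty sets.\<close>

definition bestP :: "nat \<Rightarrow> com" where
  "bestP K = Sq (Set off (C 0)) (Sq (tab vv BST (C 0)) (nest (\<lambda>i. L (10 + i)) K (Sq
     (If (andE (notE (exE vv (andE (Rd LL (Plus (V off) (V vv))) (notE (Rd TT (V vv))))))
           (ltE (cntE vv (Rd BST (V vv))) (cntE vv (Rd LL (Plus (V off) (V vv))))))
       (tab vv BST (Rd LL (Plus (V off) (V vv)))) Nop)
     (Set off (Plus (V off) sizeE)))))"

definition bagC :: "nat \<Rightarrow> com" where
  "bagC q = Sq
     (tab vv BX (andE (Rd AL (V vv)) (orsE (map (\<lambda>i. orE (eqE (V (G (3 + i))) (V vv)) (adjA (G (3 + i)) vv)) [0..<q]))))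
     (tab vv BB (andE (Rd AL (V vv)) (orE (Rd BX (V vv)) (orE (eqE (V (G 1)) (V vv)) (adjA (G 1) vv)))))"

definition traceC :: "nat \<Rightarrow> nat \<Rightarrow> com" where
  "traceC q s = tab ww SS (andE (Rd BB (V ww)) (andE
     (andsE (map (\<lambda>i. orE (andE (Rd BB (V (G (3 + q + s + i)))) (notE (ltE (V ww) (V (G (3 + q + s + i))))))
        (andE (notE (adjA (G (3 + q + i)) ww)) (notE (adjA (G (3 + q + s + i)) ww)))) [0..<s]))
     (notE (exE uu (andE (ltE (V uu) (V ww)) (andE (Rd SS (V uu)) (adjA uu ww)))))))"

definition regionC :: com where
  "regionC = Sq (tab vv MM (andE (andE (Rd AL (V vv)) (notE (Rd BX (V vv))))
       (orE (eqE (V (G 2)) (V vv)) (notE (ltE (V (G 2)) nE)))))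
     (Sq (clos MM (andE (Rd AL (V vv)) (notE (Rd BX (V vv)))))
     (tab vv WW (andE (Rd MM (V vv)) (notE (exE uu (andE (andE (Rd SS (V uu)) (Rd BX (V uu))) (adjA uu vv)))))))"

definition partC :: "nat \<Rightarrow> com" where
  "partC K = Sq (tab vv M2 (eqE (V vv) (V cc))) (Sq (clos M2 (andE (Rd AL (V vv)) (notE (Rd BB (V vv)))))
     (Sq (tab vv TT (andE (Rd M2 (V vv)) (notE (exE uu (andE (Rd SS (V uu)) (adjA uu vv))))))
     (Sq (bestP K) (tab vv UU (orE (Rd UU (V vv)) (Rd BST (V vv)))))))"

definition collectC :: "nat \<Rightarrow> com" where
  "collectC K = Sq (tab vv UU (andE (Rd SS (V vv)) (Rd WW (V vv))))
     (For cc (If (andE (Rd WW (V cc)) (notE (Rd BB (V cc)))) (partC K) Nop))"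

definition appendC :: com where
  "appendC = Sq (For vv (Wr LL (Plus (V cn) (V vv)) (Rd UU (V vv)))) (Set cn (Plus (V cn) sizeE))"

definition stepC :: "nat \<Rightarrow> nat \<Rightarrow> nat \<Rightarrow> com" where
  "stepC q s K = Sq (bagC q) (Sq (traceC q s) (Sq regionC (Sq (collectC K) appendC)))"

definition finishC :: "nat \<Rightarrow> com" where
  "finishC K = Sq (tab vv TT (Rd AL (V vv))) (Sq (bestP K)
     (For vv (Wr Raw (V vv) (Ite (orE (Rd S0 (V vv)) (Rd BST (V vv))) (C 1) (C 0)))))"

locale core_graph = input_graph +
  fixes A :: "nat set"
  assumes A_sub: "A \<subseteq> {..<n}"
begin

definition adj1 :: "nat \<Rightarrow> nat \<Rightarrow> bool" where
  "adj1 u v \<longleftrightarrow> u \<in> A \<and> v \<in> A \<and> {u, v} \<in> E"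

sublocale dp adj1 A
proof
  show "adj1 y x" if "adj1 x y" for x y using that by (simp add: adj1_def insert_commute)
  show "\<not> adj1 x x" for x using edge(3)[of x x] by (auto simp: adj1_def)
  show "finite A" using A_sub finite_subset by blast
  show "x \<in> A" if "adj1 x y" for x y using that by (simp add: adj1_def)
qed

definition envok :: "(arr \<Rightarrow> nat \<Rightarrow> nat) \<Rightarrow> bool" where
  "envok \<mu> \<longleftrightarrow> \<mu> Raw = input \<and> (\<forall>i. 0 < \<mu> AL i \<longleftrightarrow> i \<in> A)"

definition at :: "(arr \<Rightarrow> nat \<Rightarrow> nat) \<Rightarrow> arr \<Rightarrow> nat set" where
  "at \<mu> a = {i. i \<le> n \<and> 0 < \<mu> a i}"

declare tv_adjA [simp del]

lemma envok_upd [simp]: "a \<noteq> Raw \<Longrightarrow> a \<noteq> AL \<Longrightarrow> envok (\<mu>(a := f)) = envok \<mu>"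
  by (simp add: envok_def)

lemma envok_AL [simp]: "envok \<mu> \<Longrightarrow> 0 < \<mu> AL i \<longleftrightarrow> i \<in> A"
  by (simp add: envok_def)

lemma envok_frame: "envok (snd \<sigma>) \<Longrightarrow> Raw \<notin> wa c \<Longrightarrow> AL \<notin> wa c \<Longrightarrow> envok (snd (sem n c \<sigma>))"
  by (simp add: envok_def frame_arr)

lemma tv_adj [simp]:
  assumes "envok \<mu>" "x \<noteq> L 0" "y \<noteq> L 0"
  shows "tv n \<mu> \<rho> (adjA x y) \<longleftrightarrow> adj1 (\<rho> x) (\<rho> y)"
  using tv_adjA[of \<mu> x y \<rho>] assms by (auto simp: envok_def adj1_def)

lemma at_le: "at \<mu> a \<subseteq> {..n}"
  by (auto simp: at_def)

lemma at_frame: "a \<notin> wa c \<Longrightarrow> at (snd (sem n c \<sigma>)) a = at (snd \<sigma>) a"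
  by (simp add: at_def frame_arr)

lemma in_at: "i \<le> n \<Longrightarrow> 0 < \<mu> a i \<longleftrightarrow> i \<in> at \<mu> a"
  by (simp add: at_def)

lemma tab_at:
  assumes "a \<noteq> Raw" "\<And>i f. i \<le> n \<Longrightarrow> tv n ((snd \<sigma>)(a := f)) ((fst \<sigma>)(x := i)) e \<longleftrightarrow> P i"
  shows "at (snd (sem n (tab x a e) \<sigma>)) a = {i. i \<le> n \<and> P i}"
proof -
  have "0 < snd (sem n (tab x a e) \<sigma>) a i \<longleftrightarrow> P i" if "i \<le> n" for i
    by (rule tab_tv[OF assms(1) that, THEN trans]) (rule assms(2)[OF that])
  then show ?thesis unfolding at_def by blast
qed

lemma clos_wa: "wa (clos a e) = {a}"
  by (simp add: clos_def)

lemma comp_UN_closed: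
  assumes "I \<subseteq> M" "M \<subseteq> Z" "\<And>x y. x \<in> M \<Longrightarrow> adj1 x y \<Longrightarrow> y \<in> Z \<Longrightarrow> y \<in> M"
  shows "(\<Union>c\<in>I. comp Z c) \<subseteq> M"
proof
  fix y assume "y \<in> (\<Union>c\<in>I. comp Z c)"
  then obtain c where c: "c \<in> I" "reach Z c y" by (auto simp: comp_def)
  from c(2) show "y \<in> M"
    by (rule reach_closed) (use c(1) assms in blast)+
qed

text \<open>A pass that starts from a set not closed in \<open>Z\<close> adds at least one vertex.
  The final set lies below \<open>n\<close>, so it cannot have \<open>Suc n\<close> elements and
  must be closed. Updating in place may only speed this up, as everything added stays within the
  components.\<close>

lemma clos_sem:
  assumes a: "a \<noteq> Raw" "a \<noteq> AL" and ok: "envok (snd \<sigma>)" and Z: "Z \<subseteq> A"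
    and e: "\<And>\<mu> \<rho>. (\<And>b. b \<noteq> a \<Longrightarrow> \<mu> b = snd \<sigma> b) \<Longrightarrow> \<rho> vv \<le> n \<Longrightarrow> tv n \<mu> \<rho> e \<longleftrightarrow> \<rho> vv \<in> Z"
    and I: "at (snd \<sigma>) a \<subseteq> Z"
  shows "at (snd (sem n (clos a e) \<sigma>)) a = (\<Union>c\<in>at (snd \<sigma>) a. comp Z c)"
proof -
  define I where "I = at (snd \<sigma>) a"
  define Cl where "Cl = (\<Union>c\<in>I. comp Z c)"
  define ee where "ee = orE (Rd a (V vv)) (andE e (exE uu (andE (Rd a (V uu)) (adjA uu vv))))"
  have IZ: "I \<subseteq> Z" using I by (simp add: I_def)
  have ICl: "I \<subseteq> Cl" using IZ comp_self by (auto simp: Cl_def)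
  have ClZ: "Cl \<subseteq> Z" using comp_subset by (auto simp: Cl_def)
  have Clcl: "y \<in> Cl" if "x \<in> Cl" "adj1 x y" "y \<in> Z" for x y
    using that comp_closed unfolding Cl_def by blast
  have Zn: "Z \<subseteq> {..<n}" using Z A_sub by auto
  define closed where "closed M \<longleftrightarrow> (\<forall>x\<in>M. \<forall>y\<in>Z. adj1 x y \<longrightarrow> y \<in> M)" for M
  have closedCl: "M = Cl" if "I \<subseteq> M" "M \<subseteq> Cl" "closed M" for M
  proof -
    have "Cl \<subseteq> M" unfolding Cl_def
      by (rule comp_UN_closed) (use that ClZ in \<open>auto simp: closed_def\<close>)
    then show ?thesis using that by auto
  qed
  define Inv where "Inv k \<tau> \<longleftrightarrow> (\<forall>b. b \<noteq> a \<longrightarrow> snd \<tau> b = snd \<sigma> b) \<and> I \<subseteq> at (snd \<tau>) a \<and>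
    at (snd \<tau>) a \<subseteq> Cl \<and> (closed (at (snd \<tau>) a) \<or> k \<le> card (at (snd \<tau>) a))" for k and \<tau> :: st
  have "Inv (Suc n) (sem n (clos a e) \<sigma>)"
    unfolding clos_def ee_def[symmetric]
  proof (rule For_rule[where Inv = Inv])
    show "Inv 0 \<sigma>" unfolding Inv_def I_def[symmetric] using ICl by simp
    fix k \<tau>0 assume "k \<le> n" and inv0: "Inv k \<tau>0"
    define \<tau> where "\<tau> = ((fst \<tau>0)(kk := k), snd \<tau>0)"
    have inv: "Inv k \<tau>" using inv0 by (simp add: Inv_def \<tau>_def)
    define \<tau>' where "\<tau>' = sem n (tab vv a ee) \<tau>"
    define M where "M = at (snd \<tau>) a"
    define M' where "M' = at (snd \<tau>') a"
    have same: "\<And>b. b \<noteq> a \<Longrightarrow> snd \<tau> b = snd \<sigma> b" using inv by (simp add: Inv_def)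
    have ok': "envok (snd \<tau>)" using ok same a unfolding envok_def by metis
    have IM: "I \<subseteq> M" and MCl: "M \<subseteq> Cl" and prog: "closed M \<or> k \<le> card M"
      using inv by (auto simp: Inv_def M_def)
    \<comment> \<open>A neighbour \<open>u\<close> below \<open>i\<close> is read in its new state,
      the others in the state before the pass.\<close>
    have mem: "i \<in> M' \<longleftrightarrow> i \<in> M \<or> i \<in> Z \<and> (\<exists>u. (u < i \<and> u \<in> M' \<or> i \<le> u \<and> u \<in> M) \<and> adj1 u i)"
      if i: "i \<le> n" for i
    proof -
      define \<mu> where "\<mu> = (snd \<tau>)(a := \<lambda>j. if j < i then snd \<tau>' a j else snd \<tau> a j)"
      have okm: "envok \<mu>" using ok' a by (simp add: \<mu>_def)
      have te: "tv n \<mu> ((fst \<tau>)(vv := i)) e \<longleftrightarrow> i \<in> Z"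
        using e[of \<mu> "(fst \<tau>)(vv := i)"] same i by (simp add: \<mu>_def)
      have "0 < snd \<tau>' a i \<longleftrightarrow> tv n \<mu> ((fst \<tau>)(vv := i)) ee"
        unfolding \<tau>'_def \<mu>_def using tab_tv[OF a(1) i, of vv ee \<tau>] .
      also have "\<dots> \<longleftrightarrow> 0 < snd \<tau> a i \<or> i \<in> Z \<and>
          (\<exists>u\<le>n. 0 < (if u < i then snd \<tau>' a u else snd \<tau> a u) \<and> adj1 u i)"
        using te okm unfolding ee_def by (simp add: \<mu>_def)
      finally have 1: "0 < snd \<tau>' a i \<longleftrightarrow> 0 < snd \<tau> a i \<or> i \<in> Z \<and>
          (\<exists>u\<le>n. 0 < (if u < i then snd \<tau>' a u else snd \<tau> a u) \<and> adj1 u i)" .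
      have 2: "0 < (if u < i then snd \<tau>' a u else snd \<tau> a u) \<longleftrightarrow> (u < i \<and> u \<in> M' \<or> i \<le> u \<and> u \<in> M)"
        if "u \<le> n" for u using that by (simp add: M_def M'_def at_def not_less)
      have 3: "u \<le> n" if "u < i \<and> u \<in> M' \<or> i \<le> u \<and> u \<in> M" for u
        using that by (auto simp: M_def M'_def at_def)
      have "(\<exists>u\<le>n. 0 < (if u < i then snd \<tau>' a u else snd \<tau> a u) \<and> adj1 u i) \<longleftrightarrow>
          (\<exists>u. (u < i \<and> u \<in> M' \<or> i \<le> u \<and> u \<in> M) \<and> adj1 u i)"
        by (rule iffI) (use 2 3 in blast)+
      moreover have "i \<in> M' \<longleftrightarrow> 0 < snd \<tau>' a i" "i \<in> M \<longleftrightarrow> 0 < snd \<tau> a i"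
        using i by (auto simp: M_def M'_def at_def)
      ultimately show ?thesis using 1 by simp
    qed
    have MM': "M \<subseteq> M'" using mem at_le[of "snd \<tau>" a] by (auto simp: M_def)
    have M'Cl: "M' \<subseteq> Cl"
    proof
      fix i assume "i \<in> M'"
      then show "i \<in> Cl"
      proof (induction i rule: less_induct)
        case (less i)
        then have "i \<le> n" using at_le[of "snd \<tau>'" a] by (auto simp: M'_def)
        with less.prems mem have "i \<in> M \<or> i \<in> Z \<and> (\<exists>u. (u < i \<and> u \<in> M' \<or> i \<le> u \<and> u \<in> M) \<and> adj1 u i)" by blast
        then show ?case using MCl less.IH Clcl by blast
      qed
    qed
    have "closed M' \<or> Suc k \<le> card M'"
    proof (cases "closed M")
      case True
      then have "M = Cl" using closedCl IM MCl by blast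
      then show ?thesis using True MM' M'Cl by (metis subset_antisym)
    next
      case False
      then obtain x y where xy: "x \<in> M" "y \<in> Z" "adj1 x y" "y \<notin> M" by (auto simp: closed_def)
      have "y \<le> n" using xy(2) Zn by auto
      moreover have "x < y \<or> y \<le> x" by auto
      ultimately have "y \<in> M'" using mem xy MM' by blast
      then have "M \<subset> M'" using xy MM' by auto
      moreover have "finite M'" using at_le finite_subset unfolding M'_def by blast
      ultimately have "card M < card M'" by (simp add: psubset_card_mono)
      then show ?thesis using prog False by auto
    qed
    moreover have "snd \<tau>' b = snd \<sigma> b" if "b \<noteq> a" for b
      using frame_arr[of b "tab vv a ee" n \<tau>] same[OF that] that by (simp add: \<tau>'_def)
    ultimately show "Inv (Suc k) (sem n (tab vv a ee) \<tau>)"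
      using IM MM' M'Cl unfolding Inv_def \<tau>'_def[symmetric] M'_def[symmetric] by auto
  qed
  then have fin: "I \<subseteq> at (snd (sem n (clos a e) \<sigma>)) a" "at (snd (sem n (clos a e) \<sigma>)) a \<subseteq> Cl"
    "closed (at (snd (sem n (clos a e) \<sigma>)) a) \<or> Suc n \<le> card (at (snd (sem n (clos a e) \<sigma>)) a)"
    by (auto simp: Inv_def)
  have "card (at (snd (sem n (clos a e) \<sigma>)) a) \<le> card {..<n}"
    using fin(2) ClZ Zn by (intro card_mono) auto
  then show ?thesis using closedCl fin unfolding Cl_def I_def by auto
qed

definition slot :: "(arr \<Rightarrow> nat \<Rightarrow> nat) \<Rightarrow> nat \<Rightarrow> nat set" where
  "slot \<mu> j = {v. v \<le> n \<and> 0 < \<mu> LL (j * Suc n + v)}"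

lemma bestP_wa: "wa (bestP K) = {BST}"
  by (simp add: bestP_def)

lemma bestP_sem:
  "at (snd (sem n (bestP K) \<sigma>)) BST = best (map (slot (snd \<sigma>)) [0..<Suc n ^ K]) (at (snd \<sigma>) TT)"
proof -
  define T where "T = at (snd \<sigma>) TT"
  define bd where "bd = Sq
     (If (andE (notE (exE vv (andE (Rd LL (Plus (V off) (V vv))) (notE (Rd TT (V vv))))))
           (ltE (cntE vv (Rd BST (V vv))) (cntE vv (Rd LL (Plus (V off) (V vv))))))
       (tab vv BST (Rd LL (Plus (V off) (V vv)))) Nop)
     (Set off (Plus (V off) sizeE))"
  define \<sigma>1 where "\<sigma>1 = sem n (tab vv BST (C 0)) (sem n (Set off (C 0)) \<sigma>)"
  define Inv where "Inv pre \<tau> \<longleftrightarrow> (\<forall>b. b \<noteq> BST \<longrightarrow> snd \<tau> b = snd \<sigma> b) \<and> fst \<tau> off = length pre * Suc n \<and>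
    at (snd \<tau>) BST = best (map (slot (snd \<sigma>)) [0..<length pre]) T" for pre :: "nat list list" and \<tau>
  have "Inv ([] @ tuples n K) (sem n (nest (\<lambda>i. L (10 + i)) K bd) \<sigma>1)"
  proof (rule nest_rule)
    show "Inv [] \<sigma>1"
    proof -
      have "snd \<sigma>1 b = snd \<sigma> b" if "b \<noteq> BST" for b
        using that frame_arr[of b "tab vv BST (C 0)" n] by (simp add: \<sigma>1_def)
      moreover have "fst \<sigma>1 off = 0"
        using frame_var[of off "tab vv BST (C 0)" n] by (simp add: \<sigma>1_def)
      moreover have "at (snd \<sigma>1) BST = {}"
        unfolding \<sigma>1_def by (subst tab_at[where P = "\<lambda>_. False"]) auto
      ultimately show ?thesis by (simp add: Inv_def best_Nil)
    qed
    show "Inv (pre @ [g]) (sem n bd (\<rho>, \<mu>))" if inv: "Inv pre (\<rho>, \<mu>)" for pre g \<rho> \<mu>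
    proof -
      define b where "b = best (map (slot (snd \<sigma>)) [0..<length pre]) T"
      define S where "S = slot (snd \<sigma>) (length pre)"
      have same: "\<mu> x = snd \<sigma> x" if "x \<noteq> BST" for x using inv that by (simp add: Inv_def)
      have offv: "\<rho> off = length pre * Suc n" and bst: "at \<mu> BST = b" using inv by (auto simp: Inv_def b_def)
      have S: "{v. v \<le> n \<and> 0 < \<mu> LL (\<rho> off + v)} = S"
        using same[of LL] offv by (simp add: S_def slot_def)
      have SLL: "0 < \<mu> LL (\<rho> off + v) \<longleftrightarrow> v \<in> S" if "v \<le> n" for v using S that by blast
      have TTv: "0 < \<mu> TT v \<longleftrightarrow> v \<in> T" if "v \<le> n" for v using same[of TT] that by (simp add: T_def at_def)
      have Sn: "S \<subseteq> {..n}" by (auto simp: S_def slot_def)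
      let ?c = "andE (notE (exE vv (andE (Rd LL (Plus (V off) (V vv))) (notE (Rd TT (V vv))))))
           (ltE (cntE vv (Rd BST (V vv))) (cntE vv (Rd LL (Plus (V off) (V vv)))))"
      have cond: "tv n \<mu> \<rho> ?c \<longleftrightarrow> S \<subseteq> T \<and> card b < card S"
      proof -
        have "(\<exists>i\<le>n. 0 < \<mu> LL (\<rho> off + i) \<and> \<not> 0 < \<mu> TT i) \<longleftrightarrow> (\<exists>i\<le>n. i \<in> S \<and> i \<notin> T)"
          by (simp only: SLL TTv cong: conj_cong)
        also have "\<dots> \<longleftrightarrow> \<not> S \<subseteq> T" using Sn by auto
        finally have "(\<exists>i\<le>n. 0 < \<mu> LL (\<rho> off + i) \<and> \<not> 0 < \<mu> TT i) \<longleftrightarrow> \<not> S \<subseteq> T" .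
        moreover have "{i. i \<le> n \<and> 0 < \<mu> BST i} = b" using bst by (simp add: at_def)
        ultimately show ?thesis using S by simp
      qed
      define \<tau> where "\<tau> = sem n (If ?c (tab vv BST (Rd LL (Plus (V off) (V vv)))) Nop) (\<rho>, \<mu>)"
      have "at (snd \<tau>) BST = (if S \<subseteq> T \<and> card b < card S then S else b)"
      proof (cases "S \<subseteq> T \<and> card b < card S")
        case True
        then have "\<tau> = sem n (tab vv BST (Rd LL (Plus (V off) (V vv)))) (\<rho>, \<mu>)"
          using cond unfolding \<tau>_def tv_def by simp
        moreover have "at (snd (sem n (tab vv BST (Rd LL (Plus (V off) (V vv)))) (\<rho>, \<mu>))) BST =
            {i. i \<le> n \<and> i \<in> S}"
          by (rule tab_at) (use SLL in auto)
        ultimately show ?thesis using True Sn by auto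
      next
        case False
        then have "\<tau> = (\<rho>, \<mu>)" using cond unfolding \<tau>_def tv_def by auto
        then show ?thesis using False bst by auto
      qed
      moreover have "fst \<tau> off = \<rho> off" unfolding \<tau>_def by (subst frame_var) auto
      moreover have "snd \<tau> x = snd \<sigma> x" if "x \<noteq> BST" for x
        unfolding \<tau>_def using that same[OF that] by (subst frame_arr) auto
      moreover have "sem n bd (\<rho>, \<mu>) = ((fst \<tau>)(off := fst \<tau> off + Suc n), snd \<tau>)"
        unfolding bd_def \<tau>_def by simp
      ultimately show ?thesis
        using offv unfolding Inv_def by (simp add: best_snoc b_def S_def)
    qed
  qed (auto simp: Inv_def bd_def)
  then have "at (snd (sem n (nest (\<lambda>i. L (10 + i)) K bd) \<sigma>1)) BST =
      best (map (slot (snd \<sigma>)) [0..<Suc n ^ K]) T"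
    by (simp add: Inv_def length_tuples)
  then show ?thesis by (simp add: bestP_def bd_def \<sigma>1_def T_def)
qed

end

declare sem.simps(6) [simp del]

text \<open>Accounts for the slots of the list that are not yet written when it is searched.\<close>

lemma best_padding: "best (Ls @ replicate k {}) T = best Ls T"
proof (induction k)
  case (Suc k)
  have "Ls @ replicate (Suc k) {} = (Ls @ replicate k {}) @ [{}]" by (simp add: replicate_append_same)
  then show ?case using Suc by (simp only: best_snoc card.empty) simp
qed simp

lemma step_frame:
  "wa (bagC q) = {BX, BB}" "wv (bagC q) = {vv}"
  "wa (traceC q s) = {SS}" "wv (traceC q s) = {ww}"
  "wa regionC = {MM, WW}" "wv regionC = {vv, kk}"
  "wa (partC K) = {M2, TT, BST, UU}" "wv (partC K) \<subseteq> range L - {cn, cc}"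
  "wa (collectC K) = {M2, TT, BST, UU}" "wv (collectC K) \<subseteq> range L - {cn}"
  "wa appendC = {LL}" "wv appendC = {vv, cn}"
  by (auto simp: bagC_def traceC_def regionC_def partC_def collectC_def appendC_def clos_def bestP_def nest_wv)

context core_graph
begin

lemma slot_cong: "\<mu> LL = \<mu>' LL \<Longrightarrow> slot \<mu> = slot \<mu>'"
  by (simp add: slot_def fun_eq_iff)

definition dec :: "nat \<Rightarrow> nat \<Rightarrow> nat list \<Rightarrow> code" where
  "dec q s g = (map (\<lambda>i. g ! (3 + i)) [0..<q], g ! 1, if g ! 2 < n then Some (g ! 2) else None,
     map (\<lambda>i. (g ! (3 + q + i), g ! (3 + q + s + i))) [0..<s])"

lemma bagC_sem:
  assumes ok: "envok (snd \<sigma>)" and X: "X = (\<lambda>i. fst \<sigma> (G (3 + i))) ` {0..<q}"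
  shows "at (snd (sem n (bagC q) \<sigma>)) BX = bag X" "at (snd (sem n (bagC q) \<sigma>)) BB = bag (insert (fst \<sigma> (G 1)) X)"
proof -
  define e1 where "e1 = andE (Rd AL (V vv)) (orsE (map (\<lambda>i. orE (eqE (V (G (3 + i))) (V vv)) (adjA (G (3 + i)) vv)) [0..<q]))"
  define e2 where "e2 = andE (Rd AL (V vv)) (orE (Rd BX (V vv)) (orE (eqE (V (G 1)) (V vv)) (adjA (G 1) vv)))"
  define \<sigma>1 where "\<sigma>1 = sem n (tab vv BX e1) \<sigma>"
  have An: "i \<le> n" if "i \<in> A" for i using that A_sub by auto
  have "at (snd \<sigma>1) BX = {i. i \<le> n \<and> i \<in> A \<and> (\<exists>j<q. fst \<sigma> (G (3 + j)) = i \<or> adj1 (fst \<sigma> (G (3 + j))) i)}"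
    unfolding \<sigma>1_def by (rule tab_at) (use ok in \<open>auto simp: e1_def\<close>)
  also have "\<dots> = bag X" using An by (auto simp: bag_def cnbr_def X)
  finally have BX: "at (snd \<sigma>1) BX = bag X" .
  have ok1: "envok (snd \<sigma>1)" unfolding \<sigma>1_def by (rule envok_frame[OF ok]) auto
  have p: "fst \<sigma>1 (G 1) = fst \<sigma> (G 1)" unfolding \<sigma>1_def by (rule frame_var) simp
  have BXi: "0 < snd \<sigma>1 BX i \<longleftrightarrow> i \<in> bag X" if "i \<le> n" for i using that BX by (simp add: in_at)
  have "at (snd (sem n (tab vv BB e2) \<sigma>1)) BB =
      {i. i \<le> n \<and> i \<in> A \<and> (i \<in> bag X \<or> fst \<sigma> (G 1) = i \<or> adj1 (fst \<sigma> (G 1)) i)}"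
    by (rule tab_at) (use ok1 p BXi in \<open>auto simp: e2_def\<close>)
  also have "\<dots> = bag (insert (fst \<sigma> (G 1)) X)" using An by (auto simp: bag_def cnbr_def)
  finally have BB: "at (snd (sem n (tab vv BB e2) \<sigma>1)) BB = bag (insert (fst \<sigma> (G 1)) X)" .
  have eq: "sem n (bagC q) \<sigma> = sem n (tab vv BB e2) \<sigma>1" by (simp add: bagC_def \<sigma>1_def e1_def e2_def)
  show "at (snd (sem n (bagC q) \<sigma>)) BB = bag (insert (fst \<sigma> (G 1)) X)" using BB eq by simp
  show "at (snd (sem n (bagC q) \<sigma>)) BX = bag X"
    unfolding eq using BX at_frame[of BX "tab vv BB e2" \<sigma>1] by simp
qed

text \<open>When entry \<open>w\<close> is computed, the trace below \<open>w\<close> is final, so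
  the in-place table carries out the recursion of \<open>is_trace\<close>. The bound
  \<open>le\<close> lets the lookup in \<open>BB\<close> agree with \<open>at\<close>, which sees
  entries up to \<open>n\<close> only.\<close>

lemma traceC_sem:
  assumes ok: "envok (snd \<sigma>)" and B: "at (snd \<sigma>) BB = B" "B \<subseteq> A"
    and M: "M = map (\<lambda>i. (fst \<sigma> (G (3 + q + i)), fst \<sigma> (G (3 + q + s + i)))) [0..<s]"
    and le: "\<And>i. i < s \<Longrightarrow> fst \<sigma> (G (3 + q + s + i)) \<le> n"
  shows "is_trace B M (at (snd (sem n (traceC q s) \<sigma>)) SS)"
proof -
  define S where "S = at (snd (sem n (traceC q s) \<sigma>)) SS"
  define e where "e = andE (Rd BB (V ww)) (andE
     (andsE (map (\<lambda>i. orE (andE (Rd BB (V (G (3 + q + s + i)))) (notE (ltE (V ww) (V (G (3 + q + s + i))))))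
        (andE (notE (adjA (G (3 + q + i)) ww)) (notE (adjA (G (3 + q + s + i)) ww)))) [0..<s]))
     (notE (exE uu (andE (ltE (V uu) (V ww)) (andE (Rd SS (V uu)) (adjA uu ww))))))"
  have tr: "traceC q s = tab ww SS e" by (simp add: traceC_def e_def)
  have BBi: "0 < snd \<sigma> BB i \<longleftrightarrow> i \<in> B" if "i \<le> n" for i using that B(1) by (auto simp: at_def)
  have Sn: "S \<subseteq> {..n}" unfolding S_def by (rule at_le)
  have "w \<in> S \<longleftrightarrow> w \<in> B \<and> kept B M w \<and> (\<forall>w'\<in>S. w' < w \<longrightarrow> \<not> adj1 w' w)" for w
  proof (cases "w \<le> n")
    case False
    then show ?thesis using Sn B(2) A_sub by auto
  next
    case w: True
    define f where "f = snd (sem n (tab ww SS e) \<sigma>) SS"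
    define \<mu> where "\<mu> = (snd \<sigma>)(SS := \<lambda>j. if j < w then f j else snd \<sigma> SS j)"
    have okm: "envok \<mu>" using ok by (simp add: \<mu>_def)
    have k: "kept B M w \<longleftrightarrow> (\<forall>i<s. fst \<sigma> (G (3 + q + s + i)) \<in> B \<and> \<not> w < fst \<sigma> (G (3 + q + s + i)) \<or>
        \<not> adj1 (fst \<sigma> (G (3 + q + i))) w \<and> \<not> adj1 (fst \<sigma> (G (3 + q + s + i))) w)"
      unfolding kept_def M by auto
    have fS: "0 < f j \<longleftrightarrow> j \<in> S" if "j \<le> n" for j using that by (simp add: S_def at_def tr f_def)
    have "w \<in> S \<longleftrightarrow> 0 < f w" using fS[OF w] by simp
    also have "\<dots> \<longleftrightarrow> tv n \<mu> ((fst \<sigma>)(ww := w)) e"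
      unfolding f_def \<mu>_def by (rule tab_tv) (use w in auto)
    also have "\<dots> \<longleftrightarrow> 0 < \<mu> BB w \<and> (\<forall>i<s. 0 < \<mu> BB (fst \<sigma> (G (3 + q + s + i))) \<and> \<not> w < fst \<sigma> (G (3 + q + s + i)) \<or>
        \<not> adj1 (fst \<sigma> (G (3 + q + i))) w \<and> \<not> adj1 (fst \<sigma> (G (3 + q + s + i))) w) \<and>
        \<not> (\<exists>u\<le>n. u < w \<and> 0 < \<mu> SS u \<and> adj1 u w)"
      unfolding e_def using okm by (auto simp: add.assoc)
    also have "\<dots> \<longleftrightarrow> w \<in> B \<and> kept B M w \<and> \<not> (\<exists>u\<le>n. u < w \<and> u \<in> S \<and> adj1 u w)"
    proof -
      have "0 < \<mu> BB i \<longleftrightarrow> i \<in> B" if "i \<le> n" for i using BBi[OF that] by (simp add: \<mu>_def)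
      then have 1: "0 < \<mu> BB w \<longleftrightarrow> w \<in> B" "\<And>i. i < s \<Longrightarrow>
          0 < \<mu> BB (fst \<sigma> (G (3 + q + s + i))) \<longleftrightarrow> fst \<sigma> (G (3 + q + s + i)) \<in> B"
        using w le by auto
      have 2: "(\<exists>u\<le>n. u < w \<and> 0 < \<mu> SS u \<and> adj1 u w) \<longleftrightarrow> (\<exists>u\<le>n. u < w \<and> u \<in> S \<and> adj1 u w)"
        using fS by (auto simp: \<mu>_def)
      show ?thesis unfolding k 2 using 1 by auto
    qed
    also have "(\<exists>u\<le>n. u < w \<and> u \<in> S \<and> adj1 u w) \<longleftrightarrow> \<not> (\<forall>w'\<in>S. w' < w \<longrightarrow> \<not> adj1 w' w)"
      using Sn by auto
    finally show ?thesis by simp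
  qed
  then show ?thesis unfolding is_trace_def S_def by blast
qed

lemma regionC_sem:
  assumes ok: "envok (snd \<sigma>)" and BX: "at (snd \<sigma>) BX = bag X" and S: "at (snd \<sigma>) SS = S"
  defines "c \<equiv> (if fst \<sigma> (G 2) < n then Some (fst \<sigma> (G 2)) else None)"
  shows "at (snd (sem n regionC \<sigma>)) WW = region X c \<inter> away (S \<inter> bag X)"
proof -
  define Z where "Z = A - bag X"
  define e1 where "e1 = andE (andE (Rd AL (V vv)) (notE (Rd BX (V vv)))) (orE (eqE (V (G 2)) (V vv)) (notE (ltE (V (G 2)) nE)))"
  define e2 where "e2 = andE (Rd AL (V vv)) (notE (Rd BX (V vv)))"
  define e3 where "e3 = andE (Rd MM (V vv)) (notE (exE uu (andE (andE (Rd SS (V uu)) (Rd BX (V uu))) (adjA uu vv))))"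
  define \<sigma>1 where "\<sigma>1 = sem n (tab vv MM e1) \<sigma>"
  define \<sigma>2 where "\<sigma>2 = sem n (clos MM e2) \<sigma>1"
  have An: "i \<le> n" if "i \<in> A" for i using that A_sub by auto
  have BXi: "0 < snd \<sigma> BX i \<longleftrightarrow> i \<in> bag X" if "i \<le> n" for i using that BX by (auto simp: at_def)
  have SSi: "0 < snd \<sigma> SS i \<longleftrightarrow> i \<in> S" if "i \<le> n" for i using that S by (auto simp: at_def)
  have M1: "at (snd \<sigma>1) MM = {i. i \<le> n \<and> i \<in> Z \<and> (fst \<sigma> (G 2) = i \<or> \<not> fst \<sigma> (G 2) < n)}"
    unfolding \<sigma>1_def by (rule tab_at) (use ok BXi in \<open>auto simp: e1_def Z_def\<close>)
  have same1: "snd \<sigma>1 b = snd \<sigma> b" if "b \<noteq> MM" for b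
    unfolding \<sigma>1_def by (rule frame_arr) (use that in simp)
  have ok1: "envok (snd \<sigma>1)" unfolding \<sigma>1_def by (rule envok_frame[OF ok]) auto
  have "at (snd \<sigma>2) MM = (\<Union>c\<in>at (snd \<sigma>1) MM. comp Z c)"
    unfolding \<sigma>2_def
  proof (rule clos_sem[OF _ _ ok1])
    show "Z \<subseteq> A" by (auto simp: Z_def)
    show "tv n \<mu> \<rho> e2 \<longleftrightarrow> \<rho> vv \<in> Z" if "\<And>b. b \<noteq> MM \<Longrightarrow> \<mu> b = snd \<sigma>1 b" "\<rho> vv \<le> n" for \<mu> \<rho>
    proof -
      have "\<mu> AL = snd \<sigma> AL" "\<mu> BX = snd \<sigma> BX" using that(1) same1 by auto
      then show ?thesis using that(2) BXi envok_AL[OF ok] by (simp add: e2_def Z_def)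
    qed
    show "at (snd \<sigma>1) MM \<subseteq> Z" using M1 by auto
  qed auto
  also have "\<dots> = region X c"
  proof (cases "fst \<sigma> (G 2) < n")
    case True
    have "(\<Union>c\<in>at (snd \<sigma>1) MM. comp Z c) = comp Z (fst \<sigma> (G 2))"
    proof (cases "fst \<sigma> (G 2) \<in> Z")
      case True
      then have "at (snd \<sigma>1) MM = {fst \<sigma> (G 2)}" unfolding M1 using \<open>fst \<sigma> (G 2) < n\<close> by auto
      then show ?thesis by simp
    next
      case False
      then have "at (snd \<sigma>1) MM = {}" unfolding M1 using \<open>fst \<sigma> (G 2) < n\<close> by auto
      then show ?thesis using False by (simp add: comp_def)
    qed
    then show ?thesis using True by (simp add: region_def c_def Z_def)
  next
    case False
    have "at (snd \<sigma>1) MM = Z" unfolding M1 using False An by (auto simp: Z_def)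
    moreover have "(\<Union>c\<in>Z. comp Z c) = Z" using comp_subset[of Z] comp_self[of _ Z] by blast
    ultimately show ?thesis using False by (simp add: region_def c_def Z_def)
  qed
  finally have M2: "at (snd \<sigma>2) MM = region X c" .
  have same2: "snd \<sigma>2 b = snd \<sigma> b" if "b \<noteq> MM" for b
    unfolding \<sigma>2_def using that same1 by (subst frame_arr) (auto simp: clos_wa)
  have ok2: "envok (snd \<sigma>2)" unfolding \<sigma>2_def by (rule envok_frame[OF ok1]) (auto simp: clos_wa)
  have "at (snd (sem n (tab vv WW e3) \<sigma>2)) WW =
      {i. i \<le> n \<and> i \<in> region X c \<and> \<not> (\<exists>u\<le>n. (u \<in> S \<and> u \<in> bag X) \<and> adj1 u i)}"
  proof (rule tab_at)
    fix i f assume i: "i \<le> n"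
    have "0 < snd \<sigma>2 MM i \<longleftrightarrow> i \<in> region X c" using i M2 by (auto simp: at_def)
    moreover have "(\<exists>u\<le>n. (0 < snd \<sigma>2 SS u \<and> 0 < snd \<sigma>2 BX u) \<and> adj1 u i) \<longleftrightarrow>
        (\<exists>u\<le>n. (u \<in> S \<and> u \<in> bag X) \<and> adj1 u i)"
      using SSi BXi same2[of SS] same2[of BX] by auto
    ultimately show "tv n ((snd \<sigma>2)(WW := f)) ((fst \<sigma>2)(vv := i)) e3 \<longleftrightarrow>
        i \<in> region X c \<and> \<not> (\<exists>u\<le>n. (u \<in> S \<and> u \<in> bag X) \<and> adj1 u i)"
      unfolding e3_def using ok2 by simp
  qed simp
  also have "\<dots> = region X c \<inter> away (S \<inter> bag X)"
  proof -
    have "region X c \<subseteq> A" using comp_subset[of "A - bag X"] by (auto simp: region_def split: option.splits)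
    moreover have "S \<subseteq> {..n}" using S at_le by blast
    ultimately show ?thesis using An unfolding away_def by blast
  qed
  finally show ?thesis by (simp add: regionC_def \<sigma>1_def \<sigma>2_def e1_def e2_def e3_def)
qed

lemma partC_sem:
  assumes ok: "envok (snd \<sigma>)" and BB: "at (snd \<sigma>) BB = B" and S: "at (snd \<sigma>) SS = S"
    and cc: "fst \<sigma> cc \<in> A - B"
  shows "at (snd (sem n (partC K) \<sigma>)) UU = at (snd \<sigma>) UU \<union>
    best (map (slot (snd \<sigma>)) [0..<Suc n ^ K]) (comp (A - B) (fst \<sigma> cc) \<inter> away S)"
proof -
  define Z where "Z = A - B"
  define e1 where "e1 = eqE (V vv) (V cc)"
  define e2 where "e2 = andE (Rd AL (V vv)) (notE (Rd BB (V vv)))"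
  define e3 where "e3 = andE (Rd M2 (V vv)) (notE (exE uu (andE (Rd SS (V uu)) (adjA uu vv))))"
  define e4 where "e4 = orE (Rd UU (V vv)) (Rd BST (V vv))"
  define \<sigma>1 where "\<sigma>1 = sem n (tab vv M2 e1) \<sigma>"
  define \<sigma>2 where "\<sigma>2 = sem n (clos M2 e2) \<sigma>1"
  define \<sigma>3 where "\<sigma>3 = sem n (tab vv TT e3) \<sigma>2"
  define \<sigma>4 where "\<sigma>4 = sem n (bestP K) \<sigma>3"
  have An: "i \<le> n" if "i \<in> A" for i using that A_sub by auto
  have BBi: "0 < snd \<sigma> BB i \<longleftrightarrow> i \<in> B" if "i \<le> n" for i using that BB by (auto simp: at_def)
  have SSi: "0 < snd \<sigma> SS i \<longleftrightarrow> i \<in> S" if "i \<le> n" for i using that S by (auto simp: at_def)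
  have "at (snd \<sigma>1) M2 = {i. i \<le> n \<and> i = fst \<sigma> cc}"
    unfolding \<sigma>1_def by (rule tab_at) (auto simp: e1_def)
  then have M1: "at (snd \<sigma>1) M2 = {fst \<sigma> cc}" using cc An by auto
  have same1: "snd \<sigma>1 b = snd \<sigma> b" if "b \<noteq> M2" for b
    unfolding \<sigma>1_def by (rule frame_arr) (use that in simp)
  have ok1: "envok (snd \<sigma>1)" unfolding \<sigma>1_def by (rule envok_frame[OF ok]) auto
  have "at (snd \<sigma>2) M2 = (\<Union>c\<in>at (snd \<sigma>1) M2. comp Z c)"
    unfolding \<sigma>2_def
  proof (rule clos_sem[OF _ _ ok1])
    show "Z \<subseteq> A" by (auto simp: Z_def)
    show "tv n \<mu> \<rho> e2 \<longleftrightarrow> \<rho> vv \<in> Z" if "\<And>b. b \<noteq> M2 \<Longrightarrow> \<mu> b = snd \<sigma>1 b" "\<rho> vv \<le> n" for \<mu> \<rho>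
    proof -
      have "\<mu> AL = snd \<sigma> AL" "\<mu> BB = snd \<sigma> BB" using that(1) same1 by auto
      then show ?thesis using that(2) BBi envok_AL[OF ok] by (simp add: e2_def Z_def)
    qed
    show "at (snd \<sigma>1) M2 \<subseteq> Z" using M1 cc by (simp add: Z_def)
  qed auto
  then have M2: "at (snd \<sigma>2) M2 = comp Z (fst \<sigma> cc)" using M1 by simp
  have same2: "snd \<sigma>2 b = snd \<sigma> b" if "b \<noteq> M2" for b
    unfolding \<sigma>2_def using that same1 by (subst frame_arr) (auto simp: clos_wa)
  have ok2: "envok (snd \<sigma>2)" unfolding \<sigma>2_def by (rule envok_frame[OF ok1]) (auto simp: clos_wa)
  have "at (snd \<sigma>3) TT = {i. i \<le> n \<and> i \<in> comp Z (fst \<sigma> cc) \<and> \<not> (\<exists>u\<le>n. u \<in> S \<and> adj1 u i)}"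
    unfolding \<sigma>3_def
  proof (rule tab_at)
    fix i f assume i: "i \<le> n"
    have "0 < snd \<sigma>2 M2 i \<longleftrightarrow> i \<in> comp Z (fst \<sigma> cc)" using i M2 by (auto simp: at_def)
    moreover have "(\<exists>u\<le>n. 0 < snd \<sigma>2 SS u \<and> adj1 u i) \<longleftrightarrow> (\<exists>u\<le>n. u \<in> S \<and> adj1 u i)"
      using SSi same2[of SS] by auto
    ultimately show "tv n ((snd \<sigma>2)(TT := f)) ((fst \<sigma>2)(vv := i)) e3 \<longleftrightarrow>
        i \<in> comp Z (fst \<sigma> cc) \<and> \<not> (\<exists>u\<le>n. u \<in> S \<and> adj1 u i)"
      unfolding e3_def using ok2 by simp
  qed simp
  also have "\<dots> = comp Z (fst \<sigma> cc) \<inter> away S"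
  proof -
    have "comp Z (fst \<sigma> cc) \<subseteq> A" using comp_subset[of Z] by (auto simp: Z_def)
    moreover have "S \<subseteq> {..n}" using S at_le by blast
    ultimately show ?thesis using An unfolding away_def by blast
  qed
  finally have TT: "at (snd \<sigma>3) TT = comp Z (fst \<sigma> cc) \<inter> away S" .
  have same3: "snd \<sigma>3 b = snd \<sigma> b" if "b \<noteq> M2" "b \<noteq> TT" for b
    unfolding \<sigma>3_def using that same2 by (subst frame_arr) auto
  have BST: "at (snd \<sigma>4) BST = best (map (slot (snd \<sigma>)) [0..<Suc n ^ K]) (comp Z (fst \<sigma> cc) \<inter> away S)"
    unfolding \<sigma>4_def bestP_sem TT slot_cong[of "snd \<sigma>3" "snd \<sigma>", OF same3[of LL, simplified]] ..
  have UU4: "at (snd \<sigma>4) UU = at (snd \<sigma>) UU"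
    unfolding \<sigma>4_def using same3[of UU] at_frame[of UU "bestP K" \<sigma>3] by (simp add: bestP_wa at_def)
  have "at (snd (sem n (tab vv UU e4) \<sigma>4)) UU = {i. i \<le> n \<and> (0 < snd \<sigma>4 UU i \<or> 0 < snd \<sigma>4 BST i)}"
  proof -
    have "0 < snd (sem n (tab vv UU e4) \<sigma>4) UU i \<longleftrightarrow> 0 < snd \<sigma>4 UU i \<or> 0 < snd \<sigma>4 BST i" if "i \<le> n" for i
      by (rule tab_tv[OF _ that, THEN trans]) (simp_all add: e4_def)
    then show ?thesis unfolding at_def by (simp cong: conj_cong)
  qed
  also have "\<dots> = at (snd \<sigma>4) UU \<union> at (snd \<sigma>4) BST" by (auto simp: at_def)
  finally show ?thesis
    using UU4 BST by (simp add: partC_def \<sigma>1_def \<sigma>2_def \<sigma>3_def \<sigma>4_def e1_def e2_def e3_def e4_def Z_def)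
qed

lemma collectC_sem:
  assumes ok: "envok (snd \<sigma>)" and BB: "at (snd \<sigma>) BB = bag (insert p X)" and S: "at (snd \<sigma>) SS = S"
    and WW: "at (snd \<sigma>) WW = region X c \<inter> away (S \<inter> bag X)"
  shows "at (snd (sem n (collectC K) \<sigma>)) UU = assemble (map (slot (snd \<sigma>)) [0..<Suc n ^ K]) X p c S"
proof -
  define B where "B = bag (insert p X)"
  define W where "W = region X c \<inter> away (S \<inter> bag X)"
  define Ls where "Ls = map (slot (snd \<sigma>)) [0..<Suc n ^ K]"
  have WA: "W \<subseteq> A" using comp_subset[of "A - bag X"] by (auto simp: W_def region_def split: option.splits)
  define e1 where "e1 = andE (Rd SS (V vv)) (Rd WW (V vv))"
  define \<sigma>1 where "\<sigma>1 = sem n (tab vv UU e1) \<sigma>"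
  define bd where "bd = If (andE (Rd WW (V cc)) (notE (Rd BB (V cc)))) (partC K) Nop"
  have SSi: "0 < snd \<sigma> SS i \<longleftrightarrow> i \<in> S" "0 < snd \<sigma> WW i \<longleftrightarrow> i \<in> W" "0 < snd \<sigma> BB i \<longleftrightarrow> i \<in> B" if "i \<le> n" for i
    using that S WW BB by (auto simp: at_def W_def B_def)
  have "at (snd \<sigma>1) UU = {i. i \<le> n \<and> i \<in> S \<and> i \<in> W}"
    unfolding \<sigma>1_def by (rule tab_at) (use SSi in \<open>auto simp: e1_def\<close>)
  moreover have "S \<subseteq> {..n}" using S at_le by blast
  ultimately have U1: "at (snd \<sigma>1) UU = S \<inter> W" by auto
  define T where "T c' = best Ls (comp (A - B) c' \<inter> away S)" for c'
  define Inv where "Inv i \<tau> \<longleftrightarrow> (\<forall>b. b \<notin> {M2, TT, BST, UU} \<longrightarrow> snd \<tau> b = snd \<sigma> b) \<and>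
    at (snd \<tau>) UU = (S \<inter> W) \<union> (\<Union>c'\<in>{c'\<in>W - B. c' < i}. T c')" for i and \<tau> :: st
  have "Inv (Suc n) (sem n (For cc bd) \<sigma>1)"
  proof (rule For_rule[where Inv = Inv])
    show "Inv 0 \<sigma>1"
      unfolding Inv_def using U1 frame_arr[of _ "tab vv UU e1" n \<sigma>] by (simp add: \<sigma>1_def)
    fix i \<tau>0 assume i: "i \<le> n" and inv0: "Inv i \<tau>0"
    define \<tau> where "\<tau> = ((fst \<tau>0)(cc := i), snd \<tau>0)"
    have same: "snd \<tau> b = snd \<sigma> b" if "b \<notin> {M2, TT, BST, UU}" for b
      using inv0 that by (simp add: Inv_def \<tau>_def)
    have UU: "at (snd \<tau>) UU = (S \<inter> W) \<union> (\<Union>c'\<in>{c'\<in>W - B. c' < i}. T c')"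
      using inv0 by (simp add: Inv_def \<tau>_def)
    have ci: "fst \<tau> cc = i" by (simp add: \<tau>_def)
    have cond: "ev n (snd \<tau>) (fst \<tau>) (andE (Rd WW (V cc)) (notE (Rd BB (V cc)))) \<noteq> 0 \<longleftrightarrow> i \<in> W - B"
      unfolding tv_def[symmetric] using SSi(2,3)[OF i] same ci by simp
    have same': "snd (sem n bd \<tau>) b = snd \<sigma> b" if "b \<notin> {M2, TT, BST, UU}" for b
      using frame_arr[of b bd n \<tau>] same[OF that] that by (simp add: bd_def step_frame)
    have ok': "envok (snd \<tau>)" using ok same unfolding envok_def by simp
    show "Inv (Suc i) (sem n bd \<tau>)"
    proof (cases "i \<in> W - B")
      case True
      have "sem n bd \<tau> = sem n (partC K) \<tau>" using True cond unfolding bd_def by simp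
      moreover have "at (snd (sem n (partC K) \<tau>)) UU = at (snd \<tau>) UU \<union>
          best (map (slot (snd \<tau>)) [0..<Suc n ^ K]) (comp (A - B) (fst \<tau> cc) \<inter> away S)"
      proof (rule partC_sem[OF ok'])
        show "at (snd \<tau>) BB = B" "at (snd \<tau>) SS = S" using same BB S by (simp_all add: at_def B_def)
        show "fst \<tau> cc \<in> A - B" using True WA ci by auto
      qed
      moreover have "map (slot (snd \<tau>)) [0..<Suc n ^ K] = Ls"
        unfolding Ls_def slot_cong[of "snd \<tau>" "snd \<sigma>", OF same[of LL, simplified]] ..
      ultimately have "at (snd (sem n bd \<tau>)) UU = at (snd \<tau>) UU \<union> T i" by (simp add: T_def ci)
      moreover have "{c'\<in>W - B. c' < Suc i} = insert i {c'\<in>W - B. c' < i}" using True by (auto simp: less_Suc_eq)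
      ultimately have "at (snd (sem n bd \<tau>)) UU = (S \<inter> W) \<union> (\<Union>c'\<in>{c'\<in>W - B. c' < Suc i}. T c')"
        using UU by auto
      then show ?thesis using same' unfolding Inv_def by blast
    next
      case False
      have "sem n bd \<tau> = \<tau>" using False cond unfolding bd_def by auto
      moreover have "{c'\<in>W - B. c' < Suc i} = {c'\<in>W - B. c' < i}" using False by (auto simp: less_Suc_eq)
      ultimately show ?thesis using same UU unfolding Inv_def by simp
    qed
  qed
  then have "at (snd (sem n (For cc bd) \<sigma>1)) UU = (S \<inter> W) \<union> (\<Union>c'\<in>{c'\<in>W - B. c' < Suc n}. T c')"
    by (simp only: Inv_def)
  moreover have "{c'\<in>W - B. c' < Suc n} = W - B" using WA A_sub by auto
  ultimately have "at (snd (sem n (For cc bd) \<sigma>1)) UU = (S \<inter> W) \<union> (\<Union>c'\<in>W - B. T c')" by simp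
  then show ?thesis
    by (simp add: collectC_def \<sigma>1_def e1_def bd_def assemble_def Let_def W_def B_def T_def Ls_def)
qed

lemma appendC_sem:
  shows "fst (sem n appendC \<sigma>) cn = fst \<sigma> cn + Suc n"
    and "snd (sem n appendC \<sigma>) LL j =
      (if fst \<sigma> cn \<le> j \<and> j \<le> fst \<sigma> cn + n then snd \<sigma> UU (j - fst \<sigma> cn) else snd \<sigma> LL j)"
proof -
  define bd where "bd = Wr LL (Plus (V cn) (V vv)) (Rd UU (V vv))"
  define Inv where "Inv i \<tau> \<longleftrightarrow> fst \<tau> cn = fst \<sigma> cn \<and> snd \<tau> UU = snd \<sigma> UU \<and>
    (\<forall>j. snd \<tau> LL j = (if fst \<sigma> cn \<le> j \<and> j < fst \<sigma> cn + i then snd \<sigma> UU (j - fst \<sigma> cn) else snd \<sigma> LL j))"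
    for i and \<tau> :: st
  have "Inv (Suc n) (sem n (For vv bd) \<sigma>)"
    by (rule For_rule[where Inv = Inv]) (auto simp: Inv_def bd_def)
  moreover have "sem n appendC \<sigma> = sem n (Set cn (Plus (V cn) sizeE)) (sem n (For vv bd) \<sigma>)"
    by (simp only: appendC_def bd_def sem.simps(4))
  ultimately show "fst (sem n appendC \<sigma>) cn = fst \<sigma> cn + Suc n" "snd (sem n appendC \<sigma>) LL j =
      (if fst \<sigma> cn \<le> j \<and> j \<le> fst \<sigma> cn + n then snd \<sigma> UU (j - fst \<sigma> cn) else snd \<sigma> LL j)"
    by (simp_all add: Inv_def less_Suc_eq_le)
qed

text \<open>The zero tail makes unwritten slots empty, so that a search over all slots equals a
  search of \<open>Ls\<close>.\<close>

definition listed :: "nat set list \<Rightarrow> st \<Rightarrow> bool" where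
  "listed Ls \<sigma> \<longleftrightarrow> envok (snd \<sigma>) \<and> map (slot (snd \<sigma>)) [0..<length Ls] = Ls \<and>
     fst \<sigma> cn = length Ls * Suc n \<and> (\<forall>j\<ge>length Ls * Suc n. snd \<sigma> LL j = 0)"

lemma listed_best:
  assumes "listed Ls \<sigma>" "length Ls \<le> N"
  shows "best (map (slot (snd \<sigma>)) [0..<N]) T = best Ls T"
proof -
  have "slot (snd \<sigma>) j = {}" if "length Ls \<le> j" for j
  proof -
    have "length Ls * Suc n \<le> j * Suc n" using that by (rule mult_le_mono1)
    then have "snd \<sigma> LL (j * Suc n + v) = 0" for v
      using assms(1) unfolding listed_def by (meson le_add1 order_trans)
    then show ?thesis by (simp add: slot_def)
  qed
  then have "map (slot (snd \<sigma>)) [length Ls..<N] = replicate (N - length Ls) {}"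
    by (intro nth_equalityI) auto
  moreover have "[0..<N] = [0..<length Ls] @ [length Ls..<N]"
    using assms(2) upt_add_eq_append[of 0 "length Ls" "N - length Ls"] by simp
  ultimately have "map (slot (snd \<sigma>)) [0..<N] = Ls @ replicate (N - length Ls) {}"
    using assms(1) by (simp add: listed_def)
  then show ?thesis by (simp add: best_padding)
qed

lemma stepC_sem:
  assumes l: "listed Ls \<sigma>" and len: "length Ls < Suc n ^ K" and K: "K = 3 + q + 2 * s"
    and g: "\<And>i. i < K \<Longrightarrow> fst \<sigma> (G i) = g ! i \<and> g ! i \<le> n"
  shows "listed (Ls @ [step Ls (dec q s g)]) (sem n (stepC q s K) \<sigma>)"
proof -
  have ok: "envok (snd \<sigma>)" using l by (simp add: listed_def)
  define X where "X = (\<lambda>i. g ! (3 + i)) ` {0..<q}"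
  define p where "p = g ! 1"
  define c where "c = (if g ! 2 < n then Some (g ! 2) else None)"
  define M where "M = map (\<lambda>i. (g ! (3 + q + i), g ! (3 + q + s + i))) [0..<s]"
  define \<sigma>1 where "\<sigma>1 = sem n (bagC q) \<sigma>"
  define \<sigma>2 where "\<sigma>2 = sem n (traceC q s) \<sigma>1"
  define \<sigma>3 where "\<sigma>3 = sem n regionC \<sigma>2"
  define \<sigma>4 where "\<sigma>4 = sem n (collectC K) \<sigma>3"
  define S where "S = at (snd \<sigma>2) SS"
  have dg: "fst \<sigma> (G 1) = p" "fst \<sigma> (G 2) = g ! 2" "X = (\<lambda>i. fst \<sigma> (G (3 + i))) ` {0..<q}"
    using g[of 1] g[of 2] g K by (auto simp: p_def X_def)
  have v1: "fst \<sigma>1 (G i) = fst \<sigma> (G i)" "fst \<sigma>1 cn = fst \<sigma> cn" for i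
    unfolding \<sigma>1_def by (rule frame_var; simp add: step_frame)+
  have v2: "fst \<sigma>2 (G i) = fst \<sigma> (G i)" "fst \<sigma>2 cn = fst \<sigma> cn" for i
    unfolding \<sigma>2_def v1[symmetric] by (rule frame_var; simp add: step_frame)+
  have v3: "fst \<sigma>3 cn = fst \<sigma> cn"
    unfolding \<sigma>3_def v2(2)[symmetric] by (rule frame_var) (simp add: step_frame)
  have v4: "fst \<sigma>4 cn = fst \<sigma> cn"
    unfolding \<sigma>4_def v3[symmetric] by (rule frame_var) (use step_frame(10)[of K] in blast)
  have a1: "snd \<sigma>1 b = snd \<sigma> b" if "b \<noteq> BX" "b \<noteq> BB" for b
    unfolding \<sigma>1_def by (rule frame_arr) (use that in \<open>simp add: step_frame\<close>)
  have a2: "snd \<sigma>2 b = snd \<sigma>1 b" if "b \<noteq> SS" for b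
    unfolding \<sigma>2_def by (rule frame_arr) (use that in \<open>simp add: step_frame\<close>)
  have a3: "snd \<sigma>3 b = snd \<sigma>2 b" if "b \<noteq> MM" "b \<noteq> WW" for b
    unfolding \<sigma>3_def by (rule frame_arr) (use that in \<open>simp add: step_frame\<close>)
  have a4: "snd \<sigma>4 b = snd \<sigma>3 b" if "b \<notin> {M2, TT, BST, UU}" for b
    unfolding \<sigma>4_def by (rule frame_arr) (use that in \<open>simp add: step_frame\<close>)
  have ok1: "envok (snd \<sigma>1)" and ok2: "envok (snd \<sigma>2)" and ok3: "envok (snd \<sigma>3)" and ok4: "envok (snd \<sigma>4)"
    using ok a1 a2 a3 a4 by (simp_all add: envok_def)
  have BX: "at (snd \<sigma>1) BX = bag X" and BB: "at (snd \<sigma>1) BB = bag (insert p X)"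
    using bagC_sem[OF ok dg(3)] dg(1) by (auto simp: \<sigma>1_def)
  have tr: "is_trace (bag (insert p X)) M S"
    unfolding S_def \<sigma>2_def
  proof (rule traceC_sem[OF ok1 BB])
    show "bag (insert p X) \<subseteq> A" by (auto simp: bag_def)
    show "M = map (\<lambda>i. (fst \<sigma>1 (G (3 + q + i)), fst \<sigma>1 (G (3 + q + s + i)))) [0..<s]"
      unfolding M_def using g v1(1) K by auto
    show "fst \<sigma>1 (G (3 + q + s + i)) \<le> n" if "i < s" for i
      using g[of "3 + q + s + i"] v1(1) K that by simp
  qed
  have WW: "at (snd \<sigma>3) WW = region X c \<inter> away (S \<inter> bag X)"
    unfolding \<sigma>3_def c_def dg(2)[symmetric] v2(1)[of 2, symmetric]
    by (rule regionC_sem[OF ok2]) (use BX a2[of BX] in \<open>simp_all add: S_def at_def\<close>)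
  have "at (snd \<sigma>4) UU = assemble (map (slot (snd \<sigma>3)) [0..<Suc n ^ K]) X p c S"
    unfolding \<sigma>4_def
    by (rule collectC_sem[OF ok3 _ _ WW]) (use BB a2[of BB] a3 in \<open>simp_all add: S_def at_def\<close>)
  also have "map (slot (snd \<sigma>3)) [0..<Suc n ^ K] = map (slot (snd \<sigma>)) [0..<Suc n ^ K]"
    using a1[of LL] a2[of LL] a3[of LL] by (simp only: slot_cong[of "snd \<sigma>3" "snd \<sigma>"] arr.distinct simp_thms)
  also have "assemble (map (slot (snd \<sigma>)) [0..<Suc n ^ K]) X p c S = assemble Ls X p c S"
    unfolding assemble_def listed_best[OF l less_imp_le[OF len]] ..
  also have "\<dots> = step Ls (dec q s g)"
  proof -
    have X: "set (map (\<lambda>i. g ! (3 + i)) [0..<q]) = X" by (simp add: X_def)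
    show ?thesis unfolding dec_def p_def[symmetric] c_def[symmetric] M_def[symmetric]
      by (subst step_eq[where S = S]) (use tr X in simp_all)
  qed
  finally have UU: "at (snd \<sigma>4) UU = step Ls (dec q s g)" .
  have LL4: "snd \<sigma>4 LL = snd \<sigma> LL" using a1[of LL] a2[of LL] a3[of LL] a4[of LL] by simp
  have cnv: "fst \<sigma>4 cn = length Ls * Suc n" using v4 l by (simp add: listed_def)
  define \<sigma>5 where "\<sigma>5 = sem n appendC \<sigma>4"
  have LL5: "snd \<sigma>5 LL j = (if length Ls * Suc n \<le> j \<and> j \<le> length Ls * Suc n + n
      then snd \<sigma>4 UU (j - length Ls * Suc n) else snd \<sigma> LL j)" for j
    unfolding \<sigma>5_def appendC_sem(2) cnv LL4 ..
  have ok5: "envok (snd \<sigma>5)" unfolding \<sigma>5_def by (rule envok_frame[OF ok4]) (simp_all add: step_frame)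
  have old: "slot (snd \<sigma>5) j = slot (snd \<sigma>) j" if "j < length Ls" for j
  proof -
    have lt: "j * Suc n + v < length Ls * Suc n" if "v \<le> n" for v
    proof -
      have "j * Suc n + v < Suc j * Suc n" using that by simp
      also have "\<dots> \<le> length Ls * Suc n" using \<open>j < length Ls\<close> by (intro mult_le_mono1) simp
      finally show ?thesis .
    qed
    have "snd \<sigma>5 LL (j * Suc n + v) = snd \<sigma> LL (j * Suc n + v)" if "v \<le> n" for v
    proof -
      have "\<not> length Ls * Suc n \<le> j * Suc n + v" using lt[OF that] by (simp only: not_le)
      then show ?thesis unfolding LL5 by (simp only: simp_thms if_False)
    qed
    then show ?thesis unfolding slot_def by (simp cong: conj_cong)
  qed
  have new: "slot (snd \<sigma>5) (length Ls) = step Ls (dec q s g)"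
  proof -
    have "slot (snd \<sigma>5) (length Ls) = at (snd \<sigma>4) UU" unfolding slot_def at_def LL5 by auto
    then show ?thesis using UU by simp
  qed
  have "map (slot (snd \<sigma>5)) [0..<length Ls] = Ls"
  proof -
    have "map (slot (snd \<sigma>5)) [0..<length Ls] = map (slot (snd \<sigma>)) [0..<length Ls]"
      by (rule map_cong) (use old in auto)
    then show ?thesis using l by (simp only: listed_def)
  qed
  then have "map (slot (snd \<sigma>5)) [0..<length (Ls @ [step Ls (dec q s g)])] = Ls @ [step Ls (dec q s g)]"
    using new by simp
  moreover have "snd \<sigma>5 LL j = 0" if "Suc (length Ls) * Suc n \<le> j" for j
  proof -
    have "length Ls * Suc n + Suc n \<le> j" using that by simp
    then have "snd \<sigma>5 LL j = snd \<sigma> LL j" "length Ls * Suc n \<le> j" unfolding LL5 by auto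
    then show ?thesis using l by (simp add: listed_def)
  qed
  moreover have "fst \<sigma>5 cn = Suc (length Ls) * Suc n"
    unfolding \<sigma>5_def appendC_sem(1) cnv by simp
  ultimately have "listed (Ls @ [step Ls (dec q s g)]) \<sigma>5"
    using ok5 unfolding listed_def by simp
  then show ?thesis by (simp add: stepC_def \<sigma>1_def \<sigma>2_def \<sigma>3_def \<sigma>4_def \<sigma>5_def)
qed

lemma nest_stepC_sem:
  assumes l: "listed [] \<sigma>" and K: "K = 3 + q + 2 * s"
  shows "listed (run [] (map (dec q s) (tuples n K))) (sem n (nest G K (stepC q s K)) \<sigma>)"
proof -
  \<comment> \<open>The premise on the length ensures that the list still fits into the
    \<open>Suc n ^ K\<close> slots inspected by \<open>bestP\<close>; the nesting rule itself knows
    nothing about prefixes.\<close>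
  define Inv where "Inv pre \<tau> \<longleftrightarrow> (length pre \<le> Suc n ^ K \<longrightarrow> listed (run [] (map (dec q s) pre)) \<tau>)"
    for pre and \<tau> :: st
  have rl: "length (run [] cs) = length cs" for cs
    by (induction cs rule: rev_induct) auto
  have "Inv ([] @ tuples n K) (sem n (nest G K (stepC q s K)) \<sigma>)"
  proof (rule nest_rule)
    show "Inv [] \<sigma>" using l by (simp add: Inv_def)
    show "G i \<notin> wv (stepC q s K)" for i
    proof -
      have "G i \<notin> wv (collectC K)" using step_frame(10)[of K] by blast
      then show ?thesis by (simp add: stepC_def step_frame)
    qed
    show "Inv pre (\<rho>(G i := x), \<mu>)" if "Inv pre (\<rho>, \<mu>)" for pre \<rho> \<mu> i x
      using that by (simp add: Inv_def listed_def)
    show "Inv (pre @ [g]) (sem n (stepC q s K) (\<rho>, \<mu>))"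
      if g: "g \<in> set (tuples n K)" "\<And>i. i < K \<Longrightarrow> \<rho> (G i) = g ! i" "Inv pre (\<rho>, \<mu>)" for pre g \<rho> \<mu>
      unfolding Inv_def
    proof
      assume len: "length (pre @ [g]) \<le> Suc n ^ K"
      have "length g = K" "set g \<subseteq> {..n}" using g(1) by (auto simp: set_tuples)
      then have "\<And>i. i < K \<Longrightarrow> g ! i \<le> n" using nth_mem by blast
      then have "listed (run [] (map (dec q s) pre) @ [step (run [] (map (dec q s) pre)) (dec q s g)])
          (sem n (stepC q s K) (\<rho>, \<mu>))"
        using g len by (intro stepC_sem[OF _ _ K]) (auto simp: Inv_def rl)
      then show "listed (run [] (map (dec q s) (pre @ [g]))) (sem n (stepC q s K) (\<rho>, \<mu>))" by simp
    qed
  qed auto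
  then show ?thesis by (simp add: Inv_def length_tuples)
qed

lemma finishC_sem:
  assumes l: "listed Ls \<sigma>" "length Ls = Suc n ^ K" and v: "v < n"
  shows "snd (sem n (finishC K) \<sigma>) Raw v = 1 \<longleftrightarrow> 0 < snd \<sigma> S0 v \<or> v \<in> best Ls A"
proof -
  have ok: "envok (snd \<sigma>)" using l by (simp add: listed_def)
  define \<sigma>1 where "\<sigma>1 = sem n (tab vv TT (Rd AL (V vv))) \<sigma>"
  define \<sigma>2 where "\<sigma>2 = sem n (bestP K) \<sigma>1"
  have a1: "snd \<sigma>1 b = snd \<sigma> b" if "b \<noteq> TT" for b
    unfolding \<sigma>1_def by (rule frame_arr) (use that in simp)
  have a2: "snd \<sigma>2 b = snd \<sigma>1 b" if "b \<noteq> BST" for b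
    unfolding \<sigma>2_def by (rule frame_arr) (use that in \<open>simp add: bestP_wa\<close>)
  have "at (snd \<sigma>1) TT = {i. i \<le> n \<and> i \<in> A}"
    unfolding \<sigma>1_def by (rule tab_at) (use ok in auto)
  also have "\<dots> = A" using A_sub by auto
  finally have TT: "at (snd \<sigma>1) TT = A" .
  have "at (snd \<sigma>2) BST = best (map (slot (snd \<sigma>)) [0..<Suc n ^ K]) A"
    unfolding \<sigma>2_def bestP_sem TT slot_cong[of "snd \<sigma>1" "snd \<sigma>", OF a1[of LL, simplified]] ..
  also have "\<dots> = best Ls A" using l by (intro listed_best) auto
  finally have BST: "at (snd \<sigma>2) BST = best Ls A" .
  define bd where "bd = Wr Raw (V vv) (Ite (orE (Rd S0 (V vv)) (Rd BST (V vv))) (C 1) (C 0))"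
  have nn: "j < n * n" if "j < n" for j using that le_square[of n] by linarith
  define Inv where "Inv i \<tau> \<longleftrightarrow> snd \<tau> S0 = snd \<sigma> S0 \<and> snd \<tau> BST = snd \<sigma>2 BST \<and>
    (\<forall>j<n. j < i \<longrightarrow> (snd \<tau> Raw j = 1 \<longleftrightarrow> 0 < snd \<sigma> S0 j \<or> 0 < snd \<sigma>2 BST j))" for i and \<tau> :: st
  have "Inv (Suc n) (sem n (For vv bd) \<sigma>2)"
  proof (rule For_rule[where Inv = Inv])
    show "Inv 0 \<sigma>2" using a1[of S0] a2[of S0] by (simp add: Inv_def)
    fix i \<tau>0 assume i: "i \<le> n" and inv: "Inv i \<tau>0"
    define \<tau> where "\<tau> = ((fst \<tau>0)(vv := i), snd \<tau>0)"
    have S: "snd \<tau> S0 = snd \<sigma> S0" "snd \<tau> BST = snd \<sigma>2 BST"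
      "\<And>j. j < n \<Longrightarrow> j < i \<Longrightarrow> snd \<tau> Raw j = 1 \<longleftrightarrow> 0 < snd \<sigma> S0 j \<or> 0 < snd \<sigma>2 BST j"
      using inv by (auto simp: Inv_def \<tau>_def)
    have vi: "fst \<tau> vv = i" by (simp add: \<tau>_def)
    have e: "ev n (snd \<tau>) (fst \<tau>) (Ite (orE (Rd S0 (V vv)) (Rd BST (V vv))) (C 1) (C 0)) =
        (if 0 < snd \<sigma> S0 i \<or> 0 < snd \<sigma>2 BST i then 1 else 0)"
      using S(1,2) vi by (simp add: orE_def)
    have "sem n bd \<tau> = (if n * n \<le> i then \<tau> else (fst \<tau>, (snd \<tau>)(Raw := (snd \<tau> Raw)(i :=
        if 0 < snd \<sigma> S0 i \<or> 0 < snd \<sigma>2 BST i then 1 else 0))))"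
      unfolding bd_def sem.simps e using vi by simp
    moreover have "\<not> n * n \<le> i" if "i < n" using nn[OF that] by simp
    ultimately show "Inv (Suc i) (sem n bd \<tau>)"
      unfolding Inv_def using S by (auto simp: less_Suc_eq)
  qed
  then have "snd (sem n (For vv bd) \<sigma>2) Raw v = 1 \<longleftrightarrow> 0 < snd \<sigma> S0 v \<or> 0 < snd \<sigma>2 BST v"
    using v by (simp add: Inv_def)
  moreover have "0 < snd \<sigma>2 BST v \<longleftrightarrow> v \<in> best Ls A"
    unfolding BST[symmetric] at_def using v by simp
  ultimately show ?thesis by (simp add: finishC_def bd_def \<sigma>1_def \<sigma>2_def)
qed

end

section \<open>Parameters, the exponent, and optimality of the output\<close>

subsection \<open>Correctness and running time\<close>

definition qn :: "nat \<Rightarrow> nat" where "qn t = 3 * t"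
definition sn :: "nat \<Rightarrow> nat" where "sn t = Suc (3 * t) * (13 * t * t)"
text \<open>Digits of a code: the round counter, \<open>p\<close> and \<open>c\<close> make 3; each
  separator entry takes one digit and each pair two.\<close>

definition kn :: "nat \<Rightarrow> nat" where "kn t = 3 + qn t + 2 * sn t"

definition mainC :: "nat \<Rightarrow> com" where
  "mainC t = Sq prep (Sq (nest G (kn t) (stepC (qn t) (sn t) (kn t))) (finishC (kn t)))"

lemma ewt_ors: "(\<And>x. x \<in> set xs \<Longrightarrow> ewt (f x) = w) \<Longrightarrow> ewt (orsE (map f xs)) = length xs * (w + 2)"
  unfolding orsE_def by (induction xs) (simp_all add: orE_def)

lemma ewt_ands: "(\<And>x. x \<in> set xs \<Longrightarrow> ewt (f x) = w) \<Longrightarrow> ewt (andsE (map f xs)) = length xs * (w + 2)"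
  unfolding andsE_def by (induction xs) (simp_all add: andE_def)

lemmas wt_defs = tab_def andE_def orE_def notE_def ltE_def eqE_def exE_def cntE_def sizeE_def nE_def adjR_def adjA_def

text \<open>Loop nests of depth \<open>kn t\<close> occur three times, for the codes, for the search
  within a step and for the final search. They add \<open>15 * kn t\<close>, hence 15 per separator
  entry and 30 per pair, to the 48 and 92 from the tests in \<open>bagC\<close> and
  \<open>traceC\<close>.\<close>

lemma cwt_mainC: "cwt (mainC t) = 999 + 63 * qn t + 122 * sn t"
proof -
  have "cwt prep = 140" by (simp add: prep_def prep_step_def wt_defs)
  moreover have "ewt (orsE (map (\<lambda>i. orE (eqE (V (G (3 + i))) (V vv)) (adjA (G (3 + i)) vv)) [0..<qn t])) = qn t * 48"
    by (subst ewt_ors[where w = 46]) (simp_all add: wt_defs)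
  then have "cwt (bagC (qn t)) = 83 + qn t * 48" by (simp add: bagC_def) (simp add: wt_defs)
  moreover have "ewt (andsE (map (\<lambda>i. orE (andE (Rd BB (V (G (3 + qn t + sn t + i))))
        (notE (ltE (V ww) (V (G (3 + qn t + sn t + i))))))
        (andE (notE (adjA (G (3 + qn t + i)) ww)) (notE (adjA (G (3 + qn t + sn t + i)) ww)))) [0..<sn t])) = sn t * 92"
    by (subst ewt_ands[where w = 90]) (simp_all add: wt_defs)
  then have "cwt (traceC (qn t) (sn t)) = 70 + sn t * 92" unfolding traceC_def by (simp add: wt_defs)
  moreover have "cwt regionC = 197" by (simp add: regionC_def clos_def wt_defs)
  moreover have best: "cwt (bestP K) = 87 + 5 * K" for K by (simp add: bestP_def cwt_nest wt_defs)
  moreover have "cwt (collectC K) = 311 + 5 * K" for K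
    by (simp add: collectC_def partC_def clos_def best wt_defs)
  moreover have "cwt appendC = 24" by (simp add: appendC_def wt_defs)
  moreover have "cwt (finishC K) = 123 + 5 * K" for K by (simp add: finishC_def best wt_defs)
  ultimately show ?thesis by (simp add: mainC_def stepC_def cwt_nest kn_def)
qed

lemma cwt_mainC_bound:
  assumes "1 \<le> t"
  shows "cwt (mainC t) + 5 \<le> 8000 * t ^ 5"
proof -
  have p: "t ^ i \<le> t ^ 5" if "i \<le> 5" for i using assms that by (intro power_increasing) auto
  have "Suc (3 * t) \<le> 4 * t" using assms by simp
  then have "sn t \<le> 4 * t * (13 * t * t)" unfolding sn_def by (rule mult_le_mono1)
  also have "\<dots> = 52 * t ^ 3" by (simp add: power3_eq_cube)
  finally have "sn t \<le> 52 * t ^ 5" using p[of 3] by simp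
  moreover have "qn t \<le> 3 * t ^ 5" using p[of 1] by (simp add: qn_def)
  moreover have "1 \<le> t ^ 5" using p[of 0] by simp
  \<comment> \<open>In total \<open>1004 + 63 * 3 + 122 * 52 = 7537\<close>, rounded up to
    8000.\<close>
  ultimately show ?thesis unfolding cwt_mainC by linarith
qed

lemma set_output_maximum:
  assumes G: "simple_graph ({..<n}, E)" and t: "1 \<le> t"
    and free: "\<not> induced_minor (friendship_graph t) ({..<n}, E)"
  shows "maximum_independent_set ({..<n}, E) {v. v < n \<and> snd (sem n (mainC t) (input_state n E)) Raw v = 1}"
proof -
  interpret input_graph n E by unfold_locales (rule G)
  define \<sigma>0 where "\<sigma>0 = input_state n E"
  have s0: "snd \<sigma>0 Raw = input" "\<And>a. a \<noteq> Raw \<Longrightarrow> snd \<sigma>0 a = (\<lambda>_. 0)" "\<And>x. fst \<sigma>0 x = 0"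
    by (auto simp: \<sigma>0_def input_state_def input_def)
  define \<sigma>1 where "\<sigma>1 = sem n prep \<sigma>0"
  obtain A S where AS: "prep_state A S \<sigma>1" "stable A"
    using prep_sem[of \<sigma>0] s0 unfolding \<sigma>1_def by auto
  have red: "reduced A S" using AS(1) by (simp add: prep_state_def)
  have An: "A \<subseteq> {..<n}" using red by (simp add: reduced_def)
  interpret core_graph n E A by unfold_locales (rule An)
  have fr: "wa prep = {AL, S0}" "wv prep = {vv, kk, ww}"
    by (auto simp: prep_def prep_step_def)
  have "snd \<sigma>1 LL = (\<lambda>_. 0)" "fst \<sigma>1 cn = 0"
    unfolding \<sigma>1_def using frame_arr[of LL prep n \<sigma>0] frame_var[of cn prep n \<sigma>0] s0 fr by auto
  then have l0: "listed [] \<sigma>1" using AS(1) by (simp add: listed_def envok_def prep_state_def)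
  define q where "q = qn t"
  define s where "s = sn t"
  define K where "K = kn t"
  define \<sigma>2 where "\<sigma>2 = sem n (nest G K (stepC q s K)) \<sigma>1"
  define cs where "cs = map (dec q s) (tuples n K)"
  define Ls where "Ls = run [] cs"
  have K: "K = 3 + q + 2 * s" by (simp add: K_def kn_def q_def s_def)
  have l2: "listed Ls \<sigma>2" unfolding Ls_def cs_def \<sigma>2_def by (rule nest_stepC_sem[OF l0 K])
  have len: "length (run L0 cs') = length L0 + length cs'" for L0 cs'
    by (induction cs' arbitrary: L0) auto
  have lenLs: "length Ls = Suc n ^ K" by (simp add: Ls_def cs_def len length_tuples)
  have "S0 \<notin> wa (nest G K (stepC q s K))" by (simp add: stepC_def step_frame)
  then have "snd \<sigma>2 S0 = snd \<sigma>1 S0" unfolding \<sigma>2_def by (rule frame_arr)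
  then have S2: "0 < snd \<sigma>2 S0 v \<longleftrightarrow> v \<in> S" for v using AS(1) by (simp add: prep_state_def)
  define R where "R = best Ls A"
  have main: "sem n (mainC t) \<sigma>0 = sem n (finishC K) \<sigma>2"
    by (simp add: mainC_def \<sigma>2_def \<sigma>1_def q_def s_def K_def)
  have indepS: "indepE S" using red by (simp add: reduced_def)
  have Sn: "S \<subseteq> {..<n}" using indepS by (simp add: indepE_def)
  have RA: "R \<subseteq> A" unfolding R_def by (rule best_subset)
  have out: "{v. v < n \<and> snd (sem n (mainC t) \<sigma>0) Raw v = 1} = S \<union> R"
    unfolding main using finishC_sem[OF l2 lenLs] S2 Sn RA An unfolding R_def by auto
  have indL: "indep_in U" if "U \<in> set (run L0 (map (dec q s) gs))" "\<And>U. U \<in> set L0 \<Longrightarrow> indep_in U"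
    "set gs \<subseteq> set (tuples n K)" for U L0 gs
    using that
  proof (induction gs arbitrary: L0)
    case (Cons g gs)
    \<comment> \<open>\<open>step\<close> takes the trace by definite description, so soundness for
      arbitrary codes needs that first fit always produces one; it is built up vertex by
      vertex.\<close>
    have "\<exists>T. is_trace (bag (insert p X)) M T" for p X M
    proof -
      define B where "B = bag (insert p X)"
      have "\<exists>T\<subseteq>{..<k}. \<forall>w<k. w \<in> T \<longleftrightarrow> w \<in> B \<and> kept B M w \<and> (\<forall>w'\<in>T. w' < w \<longrightarrow> \<not> adj1 w' w)" for k
      proof (induction k)
        case (Suc k)
        then obtain T where T: "T \<subseteq> {..<k}" "\<And>w. w < k \<Longrightarrow> w \<in> T \<longleftrightarrow> w \<in> B \<and> kept B M w \<and> (\<forall>w'\<in>T. w' < w \<longrightarrow> \<not> adj1 w' w)"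
          by blast
        define T' where "T' = (if k \<in> B \<and> kept B M k \<and> (\<forall>w'\<in>T. \<not> adj1 w' k) then insert k T else T)"
        have "T' \<subseteq> {..<Suc k}" using T(1) by (auto simp: T'_def)
        moreover have "w \<in> T' \<longleftrightarrow> w \<in> B \<and> kept B M w \<and> (\<forall>w'\<in>T'. w' < w \<longrightarrow> \<not> adj1 w' w)" if "w < Suc k" for w
        proof (cases "w = k")
          case True
          then show ?thesis using T(1) by (auto simp: T'_def)
        next
          case False
          then have "w < k" using that by simp
          then show ?thesis using T(2)[of w] by (auto simp: T'_def)
        qed
        ultimately show ?case by blast
      qed auto
      from this[of n] obtain T where T: "T \<subseteq> {..<n}"
        "\<And>w. w < n \<Longrightarrow> w \<in> T \<longleftrightarrow> w \<in> B \<and> kept B M w \<and> (\<forall>w'\<in>T. w' < w \<longrightarrow> \<not> adj1 w' w)" by blast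
      have "B \<subseteq> {..<n}" using An by (auto simp: B_def bag_def)
      then have "is_trace B M T" unfolding is_trace_def using T by (metis lessThan_iff subsetD)
      then show ?thesis by (auto simp: B_def)
    qed
    then have "indep_in (step L0 (dec q s g))" unfolding dec_def using step_indep Cons.prems(2) by blast
    then show ?case using Cons.IH[of "L0 @ [step L0 (dec q s g)]"] Cons.prems by auto
  qed simp
  have indR: "indep_in R"
  proof -
    have "R \<in> insert {} (set Ls)" unfolding R_def by (rule best_in)
    moreover have "indep_in {}" by (simp add: indep_in_def)
    ultimately show ?thesis using indL[of R "[]" "tuples n K"] by (auto simp: Ls_def cs_def)
  qed
  have adjE: "adj1 x y \<longleftrightarrow> {x, y} \<in> E" if "x \<in> A" "y \<in> A" for x y using that by (simp add: adj1_def)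
  have indSR: "indepE (S \<union> R)"
  proof -
    have "{x, y} \<notin> E" if "x \<in> R" "y \<in> R" for x y
      using indR that adjE RA unfolding indep_in_def by blast
    moreover have "{x, y} \<notin> E \<and> {y, x} \<notin> E" if "x \<in> S" "y \<in> R" for x y
      using red that RA unfolding reduced_def by (metis insert_commute subsetD)
    ultimately show ?thesis using indepS RA An Sn unfolding indepE_def by auto
  qed
  interpret hub_free adj1 A t
  proof
    show "finite A" by (rule finite_V)
    show "x \<in> A" if "adj1 x y" for x y using that by (simp add: adj1_def)
    fix T J u v
    assume T: "conn T" "T \<subseteq> A" and J: "finite J" "indm J u v"
      and c: "\<And>i. i \<in> J \<Longrightarrow> u i \<notin> T \<and> v i \<notin> T \<and> (\<exists>s\<in>T. adj1 s (u i)) \<and> (\<exists>s\<in>T. adj1 s (v i))"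
    show "card J < t"
    proof (rule ccontr)
      assume "\<not> card J < t"
      \<comment> \<open>A friendship hub has exactly \<open>t\<close> edges, numbered from 0; that
        many are kept and renumbered by \<open>h\<close>.\<close>
      then obtain J' where J': "J' \<subseteq> J" "card J' = t" by (meson not_less obtain_subset_with_card_n)
      then have "finite J'" using J(1) finite_subset by blast
      then obtain h where h: "bij_betw h {..<t} J'"
        using ex_bij_betw_nat_finite[of J'] J'(2) by (auto simp: atLeast0LessThan)
      have hJ: "h i \<in> J" if "i < t" for i using h that J'(1) by (auto simp: bij_betw_def)
      have hinj: "h i \<noteq> h j" if "i < t" "j < t" "i \<noteq> j" for i j
        using h that by (auto simp: bij_betw_def inj_on_def)
      interpret EG: adjacency "\<lambda>x y. {x, y} \<in> snd ({..<n}, E)" by (rule adjacency_edges[OF G])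
      have "EG.conn T"
        unfolding EG.conn_def
      proof (intro conjI ballI)
        show "T \<noteq> {}" using T(1) by (simp add: conn_def)
        fix x y assume "x \<in> T" "y \<in> T"
        then have "reach T x y" using T(1) by (simp add: conn_def)
        then show "EG.reach T x y"
          unfolding reach_def EG.reach_def
          by (rule rtranclp_mono[THEN predicate2D, rotated]) (auto simp: adj1_def)
      qed
      moreover have "friendship_hub ({..<n}, E) T t (u \<circ> h) (v \<circ> h)"
        unfolding friendship_hub_def
      proof (intro conjI allI impI)
        show "T \<subseteq> fst ({..<n}, E)" using T(2) An by auto
        have uvA: "u i \<in> A" "v i \<in> A" if "i \<in> J" for i using J(2) that by (auto simp: indm_def adj1_def)
        show "EG.indm {..<t} (u \<circ> h) (v \<circ> h)"
          unfolding EG.indm_def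
        proof (intro conjI ballI impI)
          fix i assume "i \<in> {..<t}"
          then show "{(u \<circ> h) i, (v \<circ> h) i} \<in> snd ({..<n}, E)"
            using J(2) hJ[of i] by (auto simp: indm_def adj1_def)
        next
          fix i j assume "i \<in> {..<t}" "j \<in> {..<t}" "i \<noteq> j"
          then have ij: "h i \<in> J" "h j \<in> J" "h i \<noteq> h j" using hJ hinj by auto
          then have "\<not> adj1 (u (h i)) (u (h j))" "\<not> adj1 (u (h i)) (v (h j))" "\<not> adj1 (v (h i)) (v (h j))"
            using J(2) unfolding indm_def by blast+
          then show "{(u \<circ> h) i, (u \<circ> h) j} \<notin> snd ({..<n}, E)" "{(u \<circ> h) i, (v \<circ> h) j} \<notin> snd ({..<n}, E)"
            "{(v \<circ> h) i, (v \<circ> h) j} \<notin> snd ({..<n}, E)"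
            using uvA[OF ij(1)] uvA[OF ij(2)] by (auto simp: adj1_def)
        qed
        fix i assume "i < t"
        note ci = c[OF hJ[OF this]]
        show "(u \<circ> h) i \<notin> T" "(v \<circ> h) i \<notin> T" using ci by auto
        show "\<exists>s\<in>T. {s, (u \<circ> h) i} \<in> snd ({..<n}, E)" "\<exists>s\<in>T. {s, (v \<circ> h) i} \<in> snd ({..<n}, E)"
          using ci by (auto simp: adj1_def)
      qed
      ultimately show False using friendship_hub_induced_minor[OF G] free by blast
    qed
  qed
  define \<I> where "\<I> = {I. indep_in I}"
  have "finite \<I>" using finite_V by (auto simp: \<I>_def indep_in_def intro: finite_subset[of _ "Pow A"])
  moreover have "{} \<in> \<I>" by (simp add: \<I>_def indep_in_def)
  ultimately have "Max (card ` \<I>) \<in> card ` \<I>" "\<forall>I'\<in>\<I>. card I' \<le> Max (card ` \<I>)"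
    by (auto intro!: Max_in)
  then obtain I where "I \<in> \<I>" "\<forall>I'\<in>\<I>. card I' \<le> card I" by (metis imageE)
  then have I: "indep_in I" "\<And>I'. indep_in I' \<Longrightarrow> card I' \<le> card I" by (auto simp: \<I>_def)
  have finI: "finite I" using I(1) finite_V finite_subset unfolding indep_in_def by blast
  \<comment> \<open>A maximum independent set of the core is in particular maximal. The padding
    value is \<open>n\<close>: a legal digit, but no vertex.\<close>
  interpret dp_free adj1 A t I n
  proof
    show "n \<notin> A" using An by auto
    show "indep_in I" by (rule I(1))
    show "\<exists>q r. q \<noteq> r \<and> adj1 p q \<and> adj1 p r" if p: "p \<in> A" for p
    proof -
      have "2 \<le> card {w \<in> A. {p, w} \<in> E}" using AS(2) p by (simp add: stable_def deg_in_def)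
      then obtain W where "W \<subseteq> {w \<in> A. {p, w} \<in> E}" "card W = 2" by (meson obtain_subset_with_card_n)
      then obtain a b where "a \<noteq> b" "{a, b} \<subseteq> {w \<in> A. {p, w} \<in> E}" by (auto simp: card_2_iff)
      then show ?thesis using p by (auto simp: adj1_def)
    qed
    show "\<exists>y\<in>I. adj1 b y" if b: "b \<in> A - I" for b
    proof (rule ccontr)
      assume no: "\<not> (\<exists>y\<in>I. adj1 b y)"
      then have "indep_in (insert b I)"
        using I(1) b adj_irrefl adj_sym unfolding indep_in_def by blast
      then have "card (insert b I) \<le> card I" by (rule I(2))
      then show False using finI b by simp
    qed
  qed
  define Tp where "Tp = tuples n (2 + q + 2 * s)"
  define cs0 where "cs0 = map (\<lambda>g. dec q s (0 # g)) Tp"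
  have "g \<in> set cs0" if g: "valid_code g" for g
  proof -
    obtain X p c M where gg: "g = (X, p, c, M)" by (cases g)
    have X: "length X = q" "set X \<subseteq> {..n}" and p: "p \<le> n" and c: "case c of None \<Rightarrow> True | Some c \<Rightarrow> c < n"
      and M: "length M = s" "set M \<subseteq> {..n} \<times> {..n}"
      using g An unfolding gg valid_code_def q_def s_def qn_def sn_def by (auto split: option.splits)
    define cv where "cv = (case c of None \<Rightarrow> n | Some c \<Rightarrow> c)"
    define d where "d = p # cv # X @ map fst M @ map snd M"
    have cvn: "cv \<le> n" using c by (auto simp: cv_def split: option.splits)
    have "set d \<subseteq> {..n}" using X p M cvn by (auto simp: d_def)
    then have dT: "d \<in> set Tp" unfolding Tp_def set_tuples using X M by (simp add: d_def)
    have "dec q s (0 # d) = g"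
    proof -
      have "map (\<lambda>i. (0 # d) ! (3 + i)) [0..<q] = X"
        using X by (intro nth_equalityI) (auto simp: d_def nth_append numeral_3_eq_3)
      moreover have "(0 # d) ! 1 = p" "(0 # d) ! 2 = cv" by (simp_all add: d_def numeral_2_eq_2)
      moreover have "(if cv < n then Some cv else None) = c" using c by (auto simp: cv_def split: option.splits)
      moreover have "map (\<lambda>i. ((0 # d) ! (3 + q + i), (0 # d) ! (3 + q + s + i))) [0..<s] = M"
        using X M by (intro nth_equalityI) (auto simp: d_def nth_append numeral_3_eq_3)
      ultimately show ?thesis unfolding dec_def gg by (simp only:)
    qed
    then show ?thesis unfolding cs0_def set_map using imageI[OF dT, of "\<lambda>g. dec q s (0 # g)"] by (simp only:)
  qed
  moreover have "card A \<le> n" using card_mono[OF finite_lessThan An] by simp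
  ultimately have "card I \<le> card (best (rounds cs0 (Suc n)) A)" by (rule rounds_complete)
  \<comment> \<open>\<open>dec\<close> ignores digit 0, which belongs to the outermost loop, so
    enumerating all tuples amounts to \<open>Suc n\<close> identical passes over
    \<open>cs0\<close>.\<close>
  also have "rounds cs0 (Suc n) = Ls"
  proof -
    have "K = Suc (2 + q + 2 * s)" by (simp add: K)
    then have "cs = concat (map (\<lambda>i. map (\<lambda>g. dec q s (i # g)) Tp) [0..<Suc n])"
      by (simp only: cs_def Tp_def tuples.simps(2) map_concat map_map o_def)
    also have "(\<lambda>i. map (\<lambda>g. dec q s (i # g)) Tp) = (\<lambda>i. cs0)"
      by (simp add: cs0_def dec_def fun_eq_iff numeral_3_eq_3 numeral_2_eq_2)
    also have "concat (map (\<lambda>i. cs0) [0..<Suc n]) = concat (replicate (Suc n) cs0)"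
      by (simp add: map_replicate_const del: upt_Suc)
    finally show ?thesis by (simp add: rounds_def Ls_def)
  qed
  finally have IR: "card I \<le> card R" by (simp add: R_def)
  have finSR: "finite S" "finite R" "S \<inter> R = {}"
  proof -
    show "finite S" by (rule finite_subset[OF Sn]) simp
    show "finite R" by (rule finite_subset[OF RA finite_V])
    show "S \<inter> R = {}" using red RA by (auto simp: reduced_def)
  qed
  have max: "card I' \<le> card (S \<union> R)" if ind: "indepE I'" for I'
  proof -
    obtain I'' where I'': "I'' \<subseteq> A" "indepE I''" "card I' \<le> card S + card I''"
      using red ind unfolding reduced_def by blast
    have "indep_in I''" using I''(1,2) adjE unfolding indep_in_def indepE_def by blast
    then have "card I'' \<le> card I" by (rule I(2))
    with IR have "card I'' \<le> card R" by simp
    then show ?thesis using I''(3) finSR by (simp add: card_Un_disjoint)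
  qed
  have iff: "independent_set ({..<n}, E) T \<longleftrightarrow> indepE T" for T
  proof -
    have "indep T E \<longleftrightarrow> (\<forall>x\<in>T. \<forall>y\<in>T. {x, y} \<notin> E)"
      unfolding indep_def using edge(3) by metis
    then show ?thesis by (simp add: independent_set_def indepE_def)
  qed
  show ?thesis
    unfolding maximum_independent_set_def iff \<sigma>0_def[symmetric] out using indSR max by blast
qed

text \<open>The program depends on \<open>t\<close>, which fixes the depth of its loop nests; the
  constant 8000 does not. The base \<open>max n 2\<close> keeps the bound meaningful for graphs with
  at most one vertex.\<close>

theorem theorem1p1:
  shows "\<exists>C::nat. \<forall>t::nat. t \<ge> 1 \<longrightarrow>
    (\<exists>P::prog. \<forall>(n::nat) (E::nat set set).
       simple_graph ({..<n}, E) \<and> \<not> induced_minor (friendship_graph t) ({..<n}, E) \<longrightarrow>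
       (\<exists>k s. exec P (graph_input n E) k s \<and>
              k \<le> (max n 2) ^ (C * t ^ 5) \<and>
              maximum_independent_set ({..<n}, E) (set_output n s)))"
proof (intro exI[of _ 8000] allI impI)
  fix t :: nat assume t: "t \<ge> 1"
  show "\<exists>P. \<forall>(n::nat) (E::nat set set). simple_graph ({..<n}, E) \<and> \<not> induced_minor (friendship_graph t) ({..<n}, E) \<longrightarrow>
      (\<exists>k s. exec P (graph_input n E) k s \<and> k \<le> (max n 2) ^ (8000 * t ^ 5) \<and>
        maximum_independent_set ({..<n}, E) (set_output n s))"
  proof (intro exI[of _ "Seq init_prog (ccom (mainC t) 0)"] allI impI)
    fix n :: nat and E :: "nat set set"
    assume a: "simple_graph ({..<n}, E) \<and> \<not> induced_minor (friendship_graph t) ({..<n}, E)"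
    obtain k s where ks: "exec (Seq init_prog (ccom (mainC t) 0)) (graph_input n E) k s"
      "k \<le> max n 2 ^ (cwt (mainC t) + 5)"
      "set_output n s = {v. v < n \<and> snd (sem n (mainC t) (input_state n E)) Raw v = 1}"
      using compiled_program by blast
    have "k \<le> max n 2 ^ (8000 * t ^ 5)"
      by (rule power_le_power[OF ks(2) cwt_mainC_bound[OF t]]) simp
    then show "\<exists>k s. exec (Seq init_prog (ccom (mainC t) 0)) (graph_input n E) k s \<and>
        k \<le> max n 2 ^ (8000 * t ^ 5) \<and> maximum_independent_set ({..<n}, E) (set_output n s)"
      using ks(1) set_output_maximum[OF _ t, of n E] a unfolding ks(3)[symmetric] by blast
  qed
qed

end
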